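(* Let $\mathcal C$ be a highest weight category with weight poset $\Lambda$ satisfying the standing assumptions listed in the context, let $\Gamma\subseteq\Lambda$ be a finitely generated ideal, and let $M$ be a $\Gamma$-restricted object of $\mathcal C$. If $\mathrm{Ext}^1_{\mathcal C}(\Delta(\lambda),M)=0$ for all $\lambda\in\Lambda$, then $M$ has a decreasing $\nabla$-filtration. If $\mathrm{Ext}^1_{\mathcal C}(M,\nabla(\lambda))=0$ for all $\lambda\in\Lambda$, then $M$ has an increasing $\Delta$-filtration.
   Context: $K$ is a field. $\mathcal C$ is a $K$-abelian, locally artinian (every object is the union of its subobjects of finite length) Grothendieck category which is a highest weight category in the sense of Cline–Parshall–Scott: there is an interval-finite poset $\Lambda$ indexing a complete set of pairwise non-isomorphic simple objects $L(\lambda)$; with $I(\lambda)$ the injective envelope of $L(\lambda)$, the costandard object $\nabla(\lambda)$ is the largest subobject of $I(\lambda)$ all of whose composition factors $L(\mu)$ satisfy $\mu\le\lambda$; all composition factors $L(\mu)$ of $\nabla(\lambda)/L(\lambda)$ satisfy $\mu<\lambda$; $\dim_K\mathrm{Hom}(\nabla(\lambda),\nabla(\mu))$ and $[\nabla(\lambda):L(\mu)]$ are finite; each $I(\lambda)$ has an increasing filtration $0=F_0\subseteq F_1\subseteq\cdots$ with union $I(\lambda)$, $F_1\simeq\nabla(\lambda)$, $F_k/F_{k-1}\simeq\nabla(\mu(k))$ with $\mu(k)>\lambda$ for $k>1$, each $\mu$ occurring as $\mu(k)$ for only finitely many $k$. Standing assumptions: all $\nabla(\lambda)$ are finite (of finite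 length) and Schurian ($\mathrm{End}_{\mathcal C}(\nabla(\lambda))=K$); the full subcategory $\mathcal C_f$ of finite objects has a duality $\tau$ (contravariant self-equivalence) preserving simple objects; standard objects are $\Delta(\lambda)=\tau(\nabla(\lambda))$. An ideal of $\Lambda$ is a down-closed subset; it is finitely generated if it is a finite union of sets $(\lambda]=\{\mu\mid\mu\le\lambda\}$. It is assumed that every finitely generated ideal $\Gamma$ has a decreasing chain of finitely generated subideals $\Gamma=\Gamma_0\supseteq\Gamma_1\supseteq\cdots$ with each $\Gamma\setminus\Gamma_k$ finite and $\bigcap_k\Gamma_k=\emptyset$. $[M:L(\lambda)]$ is the supremum of the multiplicities of $L(\lambda)$ in composition series of finite subobjects of $M$. $\mathcal C[\Gamma]$ is the full subcategory of objects all of whose composition factors $L(\lambda)$ have $\lambda\in\Gamma$. $M$ is $\Gamma$-restricted if $M\in\mathcal C[\Gamma]$ and $[M:L(\lambda)]<\infty$ for every $\lambda\in\Gamma$. For a class $\mathcal R$ of objects, an increasing $\mathcal R$-filtration of $M$ is $0=M_0\subseteq M_1\subseteq\cdots$ with $M_i/M_{i-1}\in\mathcal R$ for $i\ge1$ and $\bigcup_i M_i=M$; a decreasing $\mathcal R$-filtration is $M=M_0\supseteq M_1\supseteq\cdots$ with $M_i/M_{i+1}\in\mathcal R$ for $i\ge0$ and $\bigcap_iM_i=0$ (filtrations may be finite). $\nabla=\{\nabla(\lambda)\mid\lambda\in\Lambda\}$, $\Delta=\{\Delta(\lambda)\mid\lambda\in\Lambda\}$. *)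

theory Defs
  imports Main "HOL-Library.Extended_Nat"
begin

section \<open>Linear categories\<close>

text \<open>Objects and arrows are elements of types; every arrow has one source and one target, so
  hom sets are disjoint. The type \<open>'k\<close> is the ground field.\<close>

record ('o, 'a, 'k) lincat =
  obj :: "'o set"
  arr :: "'a set"
  src :: "'a \<Rightarrow> 'o"
  trg :: "'a \<Rightarrow> 'o"
  idt :: "'o \<Rightarrow> 'a" ("\<one>\<index>")
  cmp :: "'a \<Rightarrow> 'a \<Rightarrow> 'a" (infixl "\<cdot>\<index>" 70)
  hzero :: "'o \<Rightarrow> 'o \<Rightarrow> 'a"
  hadd :: "'a \<Rightarrow> 'a \<Rightarrow> 'a" (infixl "\<oplus>\<index>" 65)
  hscale :: "'k \<Rightarrow> 'a \<Rightarrow> 'a"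

definition hom :: "('o, 'a, 'k, 'm) lincat_scheme \<Rightarrow> 'o \<Rightarrow> 'o \<Rightarrow> 'a set" where
  "hom C X Y = {f \<in> arr C. X \<in> obj C \<and> Y \<in> obj C \<and> src C f = X \<and> trg C f = Y}"

locale linear_category =
  fixes C :: "('o, 'a, 'k::field) lincat" (structure)
  assumes src_obj: "f \<in> arr C \<Longrightarrow> src C f \<in> obj C"
    and trg_obj: "f \<in> arr C \<Longrightarrow> trg C f \<in> obj C"
    and id_hom: "X \<in> obj C \<Longrightarrow> \<one> X \<in> hom C X X"
    and comp_hom: "f \<in> hom C X Y \<Longrightarrow> g \<in> hom C Y Z \<Longrightarrow> g \<cdot> f \<in> hom C X Z"
    and id_left: "f \<in> hom C X Y \<Longrightarrow> \<one> Y \<cdot> f = f"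
    and id_right: "f \<in> hom C X Y \<Longrightarrow> f \<cdot> \<one> X = f"
    and comp_assoc: "f \<in> hom C W X \<Longrightarrow> g \<in> hom C X Y \<Longrightarrow> h \<in> hom C Y Z \<Longrightarrow>
      (h \<cdot> g) \<cdot> f = h \<cdot> (g \<cdot> f)"
    and zero_hom: "X \<in> obj C \<Longrightarrow> Y \<in> obj C \<Longrightarrow> hzero C X Y \<in> hom C X Y"
    and add_hom: "f \<in> hom C X Y \<Longrightarrow> g \<in> hom C X Y \<Longrightarrow> f \<oplus> g \<in> hom C X Y"
    and scale_hom: "f \<in> hom C X Y \<Longrightarrow> hscale C c f \<in> hom C X Y"
    and add_assoc: "f \<in> hom C X Y \<Longrightarrow> g \<in> hom C X Y \<Longrightarrow> h \<in> hom C X Y \<Longrightarrow>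
      (f \<oplus> g) \<oplus> h = f \<oplus> (g \<oplus> h)"
    and add_commute: "f \<in> hom C X Y \<Longrightarrow> g \<in> hom C X Y \<Longrightarrow> f \<oplus> g = g \<oplus> f"
    and add_zero: "f \<in> hom C X Y \<Longrightarrow> f \<oplus> hzero C X Y = f"
    and add_inverse: "f \<in> hom C X Y \<Longrightarrow> \<exists>g\<in>hom C X Y. f \<oplus> g = hzero C X Y"
    and scale_add: "f \<in> hom C X Y \<Longrightarrow> g \<in> hom C X Y \<Longrightarrow>
      hscale C c (f \<oplus> g) = hscale C c f \<oplus> hscale C c g"
    and add_scale: "f \<in> hom C X Y \<Longrightarrow> hscale C (c + d) f = hscale C c f \<oplus> hscale C d f"
    and scale_scale: "f \<in> hom C X Y \<Longrightarrow> hscale C c (hscale C d f) = hscale C (c * d) f"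
    and scale_one: "f \<in> hom C X Y \<Longrightarrow> hscale C 1 f = f"
    and comp_add_left: "f \<in> hom C X Y \<Longrightarrow> g \<in> hom C Y Z \<Longrightarrow> g' \<in> hom C Y Z \<Longrightarrow>
      (g \<oplus> g') \<cdot> f = g \<cdot> f \<oplus> g' \<cdot> f"
    and comp_add_right: "f \<in> hom C X Y \<Longrightarrow> f' \<in> hom C X Y \<Longrightarrow> g \<in> hom C Y Z \<Longrightarrow>
      g \<cdot> (f \<oplus> f') = g \<cdot> f \<oplus> g \<cdot> f'"
    and comp_scale_left: "f \<in> hom C X Y \<Longrightarrow> g \<in> hom C Y Z \<Longrightarrow>
      hscale C c g \<cdot> f = hscale C c (g \<cdot> f)"
    and comp_scale_right: "f \<in> hom C X Y \<Longrightarrow> g \<in> hom C Y Z \<Longrightarrow>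
      g \<cdot> hscale C c f = hscale C c (g \<cdot> f)"

inductive_set lin_span :: "('o, 'a, 'k, 'm) lincat_scheme \<Rightarrow> 'o \<Rightarrow> 'o \<Rightarrow> 'a set \<Rightarrow> 'a set"
  for C :: "('o, 'a, 'k, 'm) lincat_scheme" and X Y :: 'o and B :: "'a set" where
  zero: "hzero C X Y \<in> lin_span C X Y B"
| base: "b \<in> B \<Longrightarrow> b \<in> lin_span C X Y B"
| add: "f \<in> lin_span C X Y B \<Longrightarrow> g \<in> lin_span C X Y B \<Longrightarrow> hadd C f g \<in> lin_span C X Y B"
| scale: "f \<in> lin_span C X Y B \<Longrightarrow> hscale C c f \<in> lin_span C X Y B"

definition finite_dim_hom :: "('o, 'a, 'k, 'm) lincat_scheme \<Rightarrow> 'o \<Rightarrow> 'o \<Rightarrow> bool" where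
  "finite_dim_hom C X Y \<longleftrightarrow> (\<exists>B. finite B \<and> B \<subseteq> hom C X Y \<and> lin_span C X Y B = hom C X Y)"

section \<open>Special objects and arrows\<close>

definition is_mono :: "('o, 'a, 'k, 'm) lincat_scheme \<Rightarrow> 'a \<Rightarrow> bool" where
  "is_mono C f \<longleftrightarrow> f \<in> arr C \<and>
     (\<forall>W. \<forall>g\<in>hom C W (src C f). \<forall>h\<in>hom C W (src C f). cmp C f g = cmp C f h \<longrightarrow> g = h)"

definition is_epi :: "('o, 'a, 'k, 'm) lincat_scheme \<Rightarrow> 'a \<Rightarrow> bool" where
  "is_epi C f \<longleftrightarrow> f \<in> arr C \<and>
     (\<forall>Z. \<forall>g\<in>hom C (trg C f) Z. \<forall>h\<in>hom C (trg C f) Z. cmp C g f = cmp C h f \<longrightarrow> g = h)"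

definition is_iso :: "('o, 'a, 'k, 'm) lincat_scheme \<Rightarrow> 'a \<Rightarrow> bool" where
  "is_iso C f \<longleftrightarrow> f \<in> arr C \<and>
     (\<exists>g\<in>hom C (trg C f) (src C f).
        cmp C g f = idt C (src C f) \<and> cmp C f g = idt C (trg C f))"

definition isomorphic :: "('o, 'a, 'k, 'm) lincat_scheme \<Rightarrow> 'o \<Rightarrow> 'o \<Rightarrow> bool" where
  "isomorphic C X Y \<longleftrightarrow> (\<exists>f\<in>hom C X Y. is_iso C f)"

definition zero_obj :: "('o, 'a, 'k, 'm) lincat_scheme \<Rightarrow> 'o \<Rightarrow> bool" where
  "zero_obj C Z \<longleftrightarrow> Z \<in> obj C \<and>
     (\<forall>X\<in>obj C. (\<exists>!f. f \<in> hom C X Z) \<and> (\<exists>!f. f \<in> hom C Z X))"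

definition is_kernel :: "('o, 'a, 'k, 'm) lincat_scheme \<Rightarrow> 'a \<Rightarrow> 'a \<Rightarrow> bool" where
  "is_kernel C k f \<longleftrightarrow> f \<in> arr C \<and> k \<in> arr C \<and> trg C k = src C f \<and>
     cmp C f k = hzero C (src C k) (trg C f) \<and>
     (\<forall>W. \<forall>h\<in>hom C W (src C f). cmp C f h = hzero C W (trg C f) \<longrightarrow>
        (\<exists>!u. u \<in> hom C W (src C k) \<and> cmp C k u = h))"

definition is_cokernel :: "('o, 'a, 'k, 'm) lincat_scheme \<Rightarrow> 'a \<Rightarrow> 'a \<Rightarrow> bool" where
  "is_cokernel C q f \<longleftrightarrow> f \<in> arr C \<and> q \<in> arr C \<and> src C q = trg C f \<and>
     cmp C q f = hzero C (src C f) (trg C q) \<and>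
     (\<forall>Z. \<forall>h\<in>hom C (trg C f) Z. cmp C h f = hzero C (src C f) Z \<longrightarrow>
        (\<exists>!u. u \<in> hom C (trg C q) Z \<and> cmp C u q = h))"

definition is_biproduct ::
  "('o, 'a, 'k, 'm) lincat_scheme \<Rightarrow> 'o \<Rightarrow> 'o \<Rightarrow> 'o \<Rightarrow> bool" where
  "is_biproduct C X Y P \<longleftrightarrow>
     (\<exists>i\<in>hom C X P. \<exists>j\<in>hom C Y P. \<exists>p\<in>hom C P X. \<exists>q\<in>hom C P Y.
        cmp C p i = idt C X \<and> cmp C q j = idt C Y \<and>
        cmp C p j = hzero C Y X \<and> cmp C q i = hzero C X Y \<and>
        hadd C (cmp C i p) (cmp C j q) = idt C P)"

definition is_coproduct ::
  "('o, 'a, 'k, 'm) lincat_scheme \<Rightarrow> 'i set \<Rightarrow> ('i \<Rightarrow> 'o) \<Rightarrow> 'o \<Rightarrow> ('i \<Rightarrow> 'a) \<Rightarrow> bool" where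
  "is_coproduct C J X P s \<longleftrightarrow> P \<in> obj C \<and> (\<forall>i\<in>J. s i \<in> hom C (X i) P) \<and>
     (\<forall>Z\<in>obj C. \<forall>f. (\<forall>i\<in>J. f i \<in> hom C (X i) Z) \<longrightarrow>
        (\<exists>!u. u \<in> hom C P Z \<and> (\<forall>i\<in>J. cmp C u (s i) = f i)))"

locale abelian_linear_category = linear_category C
  for C :: "('o, 'a, 'k::field) lincat" (structure) +
  assumes ex_zero: "\<exists>Z. zero_obj C Z"
    and ex_biproduct: "X \<in> obj C \<Longrightarrow> Y \<in> obj C \<Longrightarrow> \<exists>P. is_biproduct C X Y P"
    and ex_kernel: "f \<in> arr C \<Longrightarrow> \<exists>k. is_kernel C k f"
    and ex_cokernel: "f \<in> arr C \<Longrightarrow> \<exists>q. is_cokernel C q f"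
    and mono_normal: "is_mono C f \<Longrightarrow> \<exists>g. is_kernel C f g"
    and epi_normal: "is_epi C f \<Longrightarrow> \<exists>g. is_cokernel C f g"

section \<open>Subobjects and subquotients\<close>

text \<open>A subobject of an object is represented by a monomorphism into it; two monomorphisms
  represent the same subobject iff each factors through the other.\<close>

definition subobj :: "('o, 'a, 'k, 'm) lincat_scheme \<Rightarrow> 'o \<Rightarrow> 'a \<Rightarrow> bool" where
  "subobj C X m \<longleftrightarrow> is_mono C m \<and> trg C m = X"

definition sub_le :: "('o, 'a, 'k, 'm) lincat_scheme \<Rightarrow> 'a \<Rightarrow> 'a \<Rightarrow> bool" where
  "sub_le C m n \<longleftrightarrow> (\<exists>j\<in>hom C (src C m) (src C n). cmp C n j = m)"

text \<open>Unions (sums) and intersections are suprema and infima among the subobjects of \<open>X\<close>.\<close>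

definition is_union :: "('o, 'a, 'k, 'm) lincat_scheme \<Rightarrow> 'o \<Rightarrow> 'a set \<Rightarrow> 'a \<Rightarrow> bool" where
  "is_union C X S u \<longleftrightarrow> subobj C X u \<and> (\<forall>s\<in>S. sub_le C s u) \<and>
     (\<forall>v. subobj C X v \<and> (\<forall>s\<in>S. sub_le C s v) \<longrightarrow> sub_le C u v)"

definition is_inter :: "('o, 'a, 'k, 'm) lincat_scheme \<Rightarrow> 'o \<Rightarrow> 'a set \<Rightarrow> 'a \<Rightarrow> bool" where
  "is_inter C X S w \<longleftrightarrow> subobj C X w \<and> (\<forall>s\<in>S. sub_le C w s) \<and>
     (\<forall>v. subobj C X v \<and> (\<forall>s\<in>S. sub_le C v s) \<longrightarrow> sub_le C v w)"

definition directed_subobjs ::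
  "('o, 'a, 'k, 'm) lincat_scheme \<Rightarrow> 'o \<Rightarrow> 'a set \<Rightarrow> bool" where
  "directed_subobjs C X S \<longleftrightarrow> S \<noteq> {} \<and> (\<forall>s\<in>S. subobj C X s) \<and>
     (\<forall>s\<in>S. \<forall>t\<in>S. \<exists>u\<in>S. sub_le C s u \<and> sub_le C t u)"

text \<open>\<open>Q\<close> is the quotient \<open>src n / src m\<close> of the subobject \<open>n\<close> by the smaller subobject \<open>m\<close>. Since
  a cokernel is only determined up to isomorphism, this says that \<open>src n / src m \<cong> Q\<close>.\<close>

definition is_quotient ::
  "('o, 'a, 'k, 'm) lincat_scheme \<Rightarrow> 'a \<Rightarrow> 'a \<Rightarrow> 'o \<Rightarrow> bool" where
  "is_quotient C m n Q \<longleftrightarrow>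
     (\<exists>j\<in>hom C (src C m) (src C n). \<exists>q\<in>hom C (src C n) Q. cmp C n j = m \<and> is_cokernel C q j)"

definition simple_obj :: "('o, 'a, 'k, 'm) lincat_scheme \<Rightarrow> 'o \<Rightarrow> bool" where
  "simple_obj C S \<longleftrightarrow> S \<in> obj C \<and> \<not> zero_obj C S \<and>
     (\<forall>m. subobj C S m \<longrightarrow> zero_obj C (src C m) \<or> is_iso C m)"

definition comp_series ::
  "('o, 'a, 'k, 'm) lincat_scheme \<Rightarrow> 'o \<Rightarrow> nat \<Rightarrow> (nat \<Rightarrow> 'a) \<Rightarrow> bool" where
  "comp_series C X n F \<longleftrightarrow> (\<forall>i\<le>n. subobj C X (F i)) \<and>
     zero_obj C (src C (F 0)) \<and> is_iso C (F n) \<and>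
     (\<forall>i<n. \<exists>S. simple_obj C S \<and> is_quotient C (F i) (F (Suc i)) S)"

definition finite_length :: "('o, 'a, 'k, 'm) lincat_scheme \<Rightarrow> 'o \<Rightarrow> bool" where
  "finite_length C X \<longleftrightarrow> X \<in> obj C \<and> (\<exists>n F. comp_series C X n F)"

text \<open>The multiplicity \<open>[M : S]\<close> of a simple object \<open>S\<close> in an arbitrary object \<open>M\<close>.\<close>

definition mult :: "('o, 'a, 'k, 'm) lincat_scheme \<Rightarrow> 'o \<Rightarrow> 'o \<Rightarrow> enat" where
  "mult C M S = Sup {enat (card {i. i < n \<and> is_quotient C (F i) (F (Suc i)) S}) | m n F.
     subobj C M m \<and> comp_series C (src C m) n F}"

section \<open>Grothendieck categories\<close>

text \<open>HOL has no class of all small sets. Smallness is taken relative to an arbitrary infinite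
  type \<open>'i\<close>: coproducts are required for families indexed by sets of elements of \<open>'i\<close>, so
  that a cocomplete category meets the requirement for every small \<open>'i\<close>. The exactness axiom is
  Grothendieck's AB5, the distributive law for directed sums of subobjects. In the small setting the
  subobjects of an object form a small set, and then every directed sum exists by cocompleteness;
  here the existence of directed sums is part of the axioms.\<close>

locale grothendieck_category = abelian_linear_category C
  for index_type :: "'i itself" and C :: "('o, 'a, 'k::field) lincat" (structure) +
  assumes infinite_index: "infinite (UNIV :: 'i set)"
    and ex_coproduct: "\<And>(J :: 'i set) X. X ` J \<subseteq> obj C \<Longrightarrow> \<exists>P s. is_coproduct C J X P s"
    and ex_directed_union: "X \<in> obj C \<Longrightarrow> directed_subobjs C X S \<Longrightarrow> \<exists>u. is_union C X S u"
    and directed_union_inter: "directed_subobjs C X S \<Longrightarrow> is_union C X S u \<Longrightarrow> subobj C X b \<Longrightarrow>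
      is_inter C X {u, b} w \<Longrightarrow> is_union C X {v. \<exists>s\<in>S. is_inter C X {s, b} v} w"
    and ex_generator: "\<exists>G\<in>obj C. \<forall>X Y. \<forall>f\<in>hom C X Y. \<forall>g\<in>hom C X Y. f \<noteq> g \<longrightarrow>
      (\<exists>h\<in>hom C G X. f \<cdot> h \<noteq> g \<cdot> h)"

locale locally_artinian_category = grothendieck_category index_type C
  for index_type :: "'i itself" and C :: "('o, 'a, 'k::field) lincat" (structure) +
  assumes union_of_finite: "X \<in> obj C \<Longrightarrow>
    is_union C X {m. subobj C X m \<and> finite_length C (src C m)} (\<one> X)"

section \<open>Injective envelopes and extensions\<close>

definition injective_obj :: "('o, 'a, 'k, 'm) lincat_scheme \<Rightarrow> 'o \<Rightarrow> bool" where
  "injective_obj C E \<longleftrightarrow> E \<in> obj C \<and>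
     (\<forall>m f. is_mono C m \<and> f \<in> hom C (src C m) E \<longrightarrow> (\<exists>g\<in>hom C (trg C m) E. cmp C g m = f))"

definition essential :: "('o, 'a, 'k, 'm) lincat_scheme \<Rightarrow> 'a \<Rightarrow> bool" where
  "essential C e \<longleftrightarrow> is_mono C e \<and>
     (\<forall>n z. subobj C (trg C e) n \<and> is_inter C (trg C e) {e, n} z \<and> zero_obj C (src C z) \<longrightarrow>
        zero_obj C (src C n))"

definition injective_envelope :: "('o, 'a, 'k, 'm) lincat_scheme \<Rightarrow> 'o \<Rightarrow> 'a \<Rightarrow> bool" where
  "injective_envelope C X e \<longleftrightarrow> src C e = X \<and> essential C e \<and> injective_obj C (trg C e)"

text \<open>The Yoneda description of \<open>Ext\<^sup>1(A, B)\<close>: equivalence classes of short exact sequences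
  \<open>0 \<rightarrow> B \<rightarrow> E \<rightarrow> A \<rightarrow> 0\<close>. Its zero element is the class of the split sequences.\<close>

definition extensions :: "('o, 'a, 'k, 'm) lincat_scheme \<Rightarrow> 'o \<Rightarrow> 'o \<Rightarrow> ('a \<times> 'a) set" where
  "extensions C A B = {(i, p). src C i = B \<and> trg C p = A \<and> is_kernel C i p \<and> is_cokernel C p i}"

definition extension_equiv ::
  "('o, 'a, 'k, 'm) lincat_scheme \<Rightarrow> 'o \<Rightarrow> 'o \<Rightarrow> (('a \<times> 'a) \<times> ('a \<times> 'a)) set" where
  "extension_equiv C A B = {((i, p), (i', p')). (i, p) \<in> extensions C A B \<and>
     (i', p') \<in> extensions C A B \<and>
     (\<exists>h\<in>hom C (trg C i) (trg C i'). cmp C h i = i' \<and> cmp C p' h = p)}"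

definition Ext1 :: "('o, 'a, 'k, 'm) lincat_scheme \<Rightarrow> 'o \<Rightarrow> 'o \<Rightarrow> ('a \<times> 'a) set set" where
  "Ext1 C A B = extensions C A B // extension_equiv C A B"

definition Ext1_zero :: "('o, 'a, 'k, 'm) lincat_scheme \<Rightarrow> 'o \<Rightarrow> 'o \<Rightarrow> ('a \<times> 'a) set" where
  "Ext1_zero C A B = {(i, p) \<in> extensions C A B. \<exists>s\<in>hom C A (src C p). cmp C p s = idt C A}"

section \<open>Filtrations\<close>

text \<open>The length \<open>N\<close> may be finite or \<open>\<infinity>\<close>; only the \<open>F i\<close> with \<open>i \<le> N\<close> are relevant.\<close>

definition incr_chain ::
  "('o, 'a, 'k, 'm) lincat_scheme \<Rightarrow> 'o \<Rightarrow> enat \<Rightarrow> (nat \<Rightarrow> 'a) \<Rightarrow> bool" where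
  "incr_chain C M N F \<longleftrightarrow> (\<forall>i. enat i \<le> N \<longrightarrow> subobj C M (F i)) \<and>
     zero_obj C (src C (F 0)) \<and>
     (\<forall>i. enat i < N \<longrightarrow> sub_le C (F i) (F (Suc i))) \<and>
     is_union C M {F i | i. enat i \<le> N} (idt C M)"

definition has_incr_filtration ::
  "('o, 'a, 'k, 'm) lincat_scheme \<Rightarrow> 'o set \<Rightarrow> 'o \<Rightarrow> bool" where
  "has_incr_filtration C R M \<longleftrightarrow> M \<in> obj C \<and>
     (\<exists>N F. incr_chain C M N F \<and>
        (\<forall>i. enat i < N \<longrightarrow> (\<exists>Q\<in>R. is_quotient C (F i) (F (Suc i)) Q)))"

definition decr_chain ::
  "('o, 'a, 'k, 'm) lincat_scheme \<Rightarrow> 'o \<Rightarrow> enat \<Rightarrow> (nat \<Rightarrow> 'a) \<Rightarrow> bool" where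
  "decr_chain C M N F \<longleftrightarrow> (\<forall>i. enat i \<le> N \<longrightarrow> subobj C M (F i)) \<and>
     is_iso C (F 0) \<and>
     (\<forall>i. enat i < N \<longrightarrow> sub_le C (F (Suc i)) (F i)) \<and>
     (\<exists>z. zero_obj C (src C z) \<and> is_inter C M {F i | i. enat i \<le> N} z)"

definition has_decr_filtration ::
  "('o, 'a, 'k, 'm) lincat_scheme \<Rightarrow> 'o set \<Rightarrow> 'o \<Rightarrow> bool" where
  "has_decr_filtration C R M \<longleftrightarrow> M \<in> obj C \<and>
     (\<exists>N F. decr_chain C M N F \<and>
        (\<forall>i. enat i < N \<longrightarrow> (\<exists>Q\<in>R. is_quotient C (F (Suc i)) (F i) Q)))"

section \<open>Dualities\<close>

text \<open>Contravariant functors from the full subcategory on the object set \<open>P\<close> to itself, with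
  object part \<open>T\<close> and arrow part \<open>t\<close>.\<close>

definition contra_functor ::
  "('o, 'a, 'k, 'm) lincat_scheme \<Rightarrow> 'o set \<Rightarrow> ('o \<Rightarrow> 'o) \<Rightarrow> ('a \<Rightarrow> 'a) \<Rightarrow> bool" where
  "contra_functor C P T t \<longleftrightarrow> (\<forall>X\<in>P. T X \<in> P) \<and>
     (\<forall>X\<in>P. \<forall>Y\<in>P. \<forall>f\<in>hom C X Y. t f \<in> hom C (T Y) (T X)) \<and>
     (\<forall>X\<in>P. t (idt C X) = idt C (T X)) \<and>
     (\<forall>X\<in>P. \<forall>Y\<in>P. \<forall>Z\<in>P. \<forall>f\<in>hom C X Y. \<forall>g\<in>hom C Y Z. t (cmp C g f) = cmp C (t f) (t g))"

text \<open>\<open>H\<close>, \<open>h\<close> are the object and arrow parts of a (covariant) endofunctor.\<close>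

definition nat_iso_to_identity ::
  "('o, 'a, 'k, 'm) lincat_scheme \<Rightarrow> 'o set \<Rightarrow> ('o \<Rightarrow> 'o) \<Rightarrow> ('a \<Rightarrow> 'a) \<Rightarrow> bool" where
  "nat_iso_to_identity C P H h \<longleftrightarrow>
     (\<exists>\<eta>. (\<forall>X\<in>P. \<eta> X \<in> hom C X (H X) \<and> is_iso C (\<eta> X)) \<and>
        (\<forall>X\<in>P. \<forall>Y\<in>P. \<forall>f\<in>hom C X Y. cmp C (h f) (\<eta> X) = cmp C (\<eta> Y) f))"

definition contra_equivalence ::
  "('o, 'a, 'k, 'm) lincat_scheme \<Rightarrow> 'o set \<Rightarrow> ('o \<Rightarrow> 'o) \<Rightarrow> ('a \<Rightarrow> 'a) \<Rightarrow> bool" where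
  "contra_equivalence C P T t \<longleftrightarrow> contra_functor C P T t \<and>
     (\<exists>S s. contra_functor C P S s \<and>
        nat_iso_to_identity C P (S \<circ> T) (s \<circ> t) \<and> nat_iso_to_identity C P (T \<circ> S) (t \<circ> s))"

section \<open>Highest weight categories\<close>

definition fg_ideal :: "'l::order set \<Rightarrow> 'l set \<Rightarrow> bool" where
  "fg_ideal \<Lambda> \<Gamma> \<longleftrightarrow> (\<exists>A. finite A \<and> A \<subseteq> \<Lambda> \<and> \<Gamma> = (\<Union>\<mu>\<in>A. {\<kappa>\<in>\<Lambda>. \<kappa> \<le> \<mu>}))"

text \<open>Membership in the full subcategory \<open>C[\<Gamma>]\<close>; \<open>L \<mu>\<close> is a composition factor of \<open>M\<close> iff
  \<open>[M : L \<mu>] \<noteq> 0\<close>.\<close>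

definition in_trunc ::
  "('o, 'a, 'k, 'm) lincat_scheme \<Rightarrow> 'l set \<Rightarrow> ('l \<Rightarrow> 'o) \<Rightarrow> 'l set \<Rightarrow> 'o \<Rightarrow> bool" where
  "in_trunc C \<Lambda> L \<Gamma> M \<longleftrightarrow> M \<in> obj C \<and> (\<forall>\<mu>\<in>\<Lambda>. mult C M (L \<mu>) \<noteq> 0 \<longrightarrow> \<mu> \<in> \<Gamma>)"

definition restricted ::
  "('o, 'a, 'k, 'm) lincat_scheme \<Rightarrow> 'l set \<Rightarrow> ('l \<Rightarrow> 'o) \<Rightarrow> 'l set \<Rightarrow> 'o \<Rightarrow> bool" where
  "restricted C \<Lambda> L \<Gamma> M \<longleftrightarrow> in_trunc C \<Lambda> L \<Gamma> M \<and> (\<forall>\<mu>\<in>\<Gamma>. mult C M (L \<mu>) < \<infinity>)"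

text \<open>Data: \<open>\<iota> \<mu>\<close> is the embedding of the simple object \<open>L \<mu>\<close> into its injective envelope
  \<open>I(\<mu>) = trg (\<iota> \<mu>)\<close>, and \<open>\<nu> \<mu>\<close> is the embedding of the costandard object \<open>\<nabla>(\<mu>) = src (\<nu> \<mu>)\<close> into
  \<open>I(\<mu>)\<close>. The poset is a subset \<open>\<Lambda>\<close> of an ordered type.\<close>

definition costandard :: "('o, 'a, 'k, 'm) lincat_scheme \<Rightarrow> ('l \<Rightarrow> 'a) \<Rightarrow> 'l \<Rightarrow> 'o" where
  "costandard C \<nu> \<mu> = src C (\<nu> \<mu>)"

definition standard ::
  "('o, 'a, 'k, 'm) lincat_scheme \<Rightarrow> ('o \<Rightarrow> 'o) \<Rightarrow> ('l \<Rightarrow> 'a) \<Rightarrow> 'l \<Rightarrow> 'o" where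
  "standard C T \<nu> \<mu> = T (costandard C \<nu> \<mu>)"

locale highest_weight_category = locally_artinian_category index_type C
  for index_type :: "'i itself" and C :: "('o, 'a, 'k::field) lincat" (structure) +
  fixes \<Lambda> :: "'l::order set" and L :: "'l \<Rightarrow> 'o" and \<iota> \<nu> :: "'l \<Rightarrow> 'a"
  assumes interval_finite: "\<mu> \<in> \<Lambda> \<Longrightarrow> \<kappa> \<in> \<Lambda> \<Longrightarrow> finite {\<sigma>\<in>\<Lambda>. \<mu> \<le> \<sigma> \<and> \<sigma> \<le> \<kappa>}"
    and simple_L: "\<mu> \<in> \<Lambda> \<Longrightarrow> simple_obj C (L \<mu>)"
    and L_nonisomorphic: "\<mu> \<in> \<Lambda> \<Longrightarrow> \<kappa> \<in> \<Lambda> \<Longrightarrow> isomorphic C (L \<mu>) (L \<kappa>) \<Longrightarrow> \<mu> = \<kappa>"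
    and L_complete: "simple_obj C S \<Longrightarrow> \<exists>\<mu>\<in>\<Lambda>. isomorphic C S (L \<mu>)"
    and envelope: "\<mu> \<in> \<Lambda> \<Longrightarrow> injective_envelope C (L \<mu>) (\<iota> \<mu>)"
    and costandard_sub: "\<mu> \<in> \<Lambda> \<Longrightarrow> subobj C (trg C (\<iota> \<mu>)) (\<nu> \<mu>)"
    and costandard_trunc: "\<mu> \<in> \<Lambda> \<Longrightarrow> in_trunc C \<Lambda> L {\<kappa>. \<kappa> \<le> \<mu>} (costandard C \<nu> \<mu>)"
    and costandard_largest: "\<mu> \<in> \<Lambda> \<Longrightarrow> subobj C (trg C (\<iota> \<mu>)) n \<Longrightarrow>
      in_trunc C \<Lambda> L {\<kappa>. \<kappa> \<le> \<mu>} (src C n) \<Longrightarrow> sub_le C n (\<nu> \<mu>)"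
    and costandard_quotient: "\<mu> \<in> \<Lambda> \<Longrightarrow> is_quotient C (\<iota> \<mu>) (\<nu> \<mu>) Q \<Longrightarrow>
      in_trunc C \<Lambda> L {\<kappa>. \<kappa> < \<mu>} Q"
    and costandard_hom: "\<mu> \<in> \<Lambda> \<Longrightarrow> \<kappa> \<in> \<Lambda> \<Longrightarrow>
      finite_dim_hom C (costandard C \<nu> \<mu>) (costandard C \<nu> \<kappa>)"
    and costandard_mult: "\<mu> \<in> \<Lambda> \<Longrightarrow> \<kappa> \<in> \<Lambda> \<Longrightarrow> mult C (costandard C \<nu> \<mu>) (L \<kappa>) < \<infinity>"
    and envelope_filtration: "\<mu> \<in> \<Lambda> \<Longrightarrow>
      \<exists>N F w. incr_chain C (trg C (\<iota> \<mu>)) N F \<and> 1 \<le> N \<and>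
        isomorphic C (src C (F 1)) (costandard C \<nu> \<mu>) \<and>
        (\<forall>k. 1 < k \<and> enat k \<le> N \<longrightarrow> w k \<in> \<Lambda> \<and> \<mu> < w k \<and>
           is_quotient C (F (k - 1)) (F k) (costandard C \<nu> (w k))) \<and>
        (\<forall>\<kappa>\<in>\<Lambda>. finite {k. 1 < k \<and> enat k \<le> N \<and> w k = \<kappa>})"

locale standing_highest_weight_category = highest_weight_category index_type C \<Lambda> L \<iota> \<nu>
  for index_type :: "'i itself" and C :: "('o, 'a, 'k::field) lincat" (structure)
    and \<Lambda> :: "'l::order set" and L \<iota> \<nu> +
  fixes T :: "'o \<Rightarrow> 'o" and t :: "'a \<Rightarrow> 'a"
  assumes costandard_finite: "\<mu> \<in> \<Lambda> \<Longrightarrow> finite_length C (costandard C \<nu> \<mu>)"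
    and costandard_Schurian: "\<mu> \<in> \<Lambda> \<Longrightarrow>
      bij_betw (\<lambda>c. hscale C c (\<one> (costandard C \<nu> \<mu>))) UNIV
        (hom C (costandard C \<nu> \<mu>) (costandard C \<nu> \<mu>))"
    and duality: "contra_equivalence C {X. finite_length C X} T t"
    and duality_simple: "\<mu> \<in> \<Lambda> \<Longrightarrow> isomorphic C (T (L \<mu>)) (L \<mu>)"
    and ideal_chain: "fg_ideal \<Lambda> \<Gamma> \<Longrightarrow>
      \<exists>G :: nat \<Rightarrow> 'l set. G 0 = \<Gamma> \<and> (\<forall>k. fg_ideal \<Lambda> (G k) \<and> G (Suc k) \<subseteq> G k \<and> finite (\<Gamma> - G k)) \<and>
        (\<Inter>k. G k) = {}"

end

theory Submission
  imports Defs
begin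

text \<open>Suppose that \<open>Ext\<^sup>1(\<Delta>(\<kappa>), N) = 0\<close> for all weights \<open>\<kappa>\<close>, and let \<open>\<mu>\<close> be maximal among the weights of the
  composition factors of \<open>N\<close>. The filtration is built from the top by splitting off a quotient
  \<open>f : N \<rightarrow> \<nabla>(\<mu>)\<close> whose kernel satisfies the same hypothesis.

  To find \<open>f\<close>, recall that \<open>\<nabla>(\<mu>)\<close> is the bottom of a filtration of the injective envelope \<open>I(\<mu>)\<close> by
  costandard objects, all others of which have socles above \<open>\<mu>\<close>. A map from \<open>N\<close> to \<open>I(\<mu>)\<close> therefore lands in
  \<open>\<nabla>(\<mu>)\<close>, so \<open>\<nabla>(\<mu>)\<close> is injective relative to objects such as \<open>N\<close>
  (\<open>costandard_relatively_injective\<close>), and a factor \<open>L(\<mu>)\<close> of \<open>N\<close> gives a nonzero \<open>f\<close>.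

  The main point is that every map \<open>\<Delta>(\<kappa>) \<rightarrow> \<nabla>(\<mu>)\<close> lifts through \<open>f\<close>. For \<open>\<kappa> \<noteq> \<mu>\<close> there is no nonzero map. For
  \<open>\<kappa> = \<mu>\<close> the map factors through the socle \<open>L(\<mu>)\<close>, which the image of \<open>f\<close> contains, and it lifts because
  \<open>\<Delta>(\<mu>)\<close> is dual to \<open>\<nabla>(\<mu>)\<close> and hence projective relative to objects of finite length without factors
  above \<open>\<mu>\<close>. Two consequences are drawn from this. By the long exact sequence
  (\<open>ext_vanishes_kernel\<close>), \<open>Ext\<^sup>1(\<Delta>(\<kappa>), ker f) = 0\<close>. And \<open>f\<close> is epi (\<open>epi_if_filtered_lift\<close>): since
  \<open>Ext\<^sup>1(\<Delta>(\<kappa>), N) = 0\<close>, the lifting property passes from standard objects to objects \<open>P\<close> with a finite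
  \<open>\<Delta>\<close>-filtration. If the cokernel of \<open>f\<close> were nonzero, it would have a simple quotient \<open>L(\<kappa>)\<close>, and the dual
  of a finite stage of the filtration of \<open>I(\<kappa>)\<close> is such a \<open>P\<close>, with a map to \<open>\<nabla>(\<mu>)\<close> that does not vanish in
  \<open>L(\<kappa>)\<close> (\<open>finite_standard_source\<close>). This map lifts through \<open>f\<close>, a contradiction.

  The second half is the same argument with arrows reversed. The two lemmas \<open>ext_vanishes_kernel\<close> and
  \<open>epi_if_filtered_lift\<close> hold in every abelian category and are used once in \<open>C\<close>, with the standard
  objects as test objects, and once in the opposite category, with the costandard objects.

  Iterating yields the filtration, provided that the weights \<open>\<mu>\<close> are chosen so that every weight is
  eventually exhausted. The chain of ideals \<open>\<Gamma>\<^sub>k\<close> makes this possible: always choose \<open>\<mu>\<close> outside \<open>\<Gamma>\<^sub>k\<close> for the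
  least possible \<open>k\<close> (\<open>exhaust_from_above\<close>). Only finitely many weights are outside \<open>\<Gamma>\<^sub>k\<close>, and each can
  be chosen only finitely often, because a step uses up a factor \<open>L(\<mu>)\<close> and \<open>[M : L(\<mu>)]\<close> is finite. What
  remains in the limit has no composition factors, so it is zero.\<close>

section \<open>Arithmetic of arrows\<close>

text \<open>Whether an arrow is zero, said without its source and target. Kernel, exactness and factorization
  conditions are stated in this form, so that a zero arrow never has to be replaced by a name for it.\<close>

definition null :: "('o, 'a, 'k, 'm) lincat_scheme \<Rightarrow> 'a \<Rightarrow> bool" where
  "null C f \<longleftrightarrow> f = hzero C (src C f) (trg C f)"

definition hdiff :: "('o, 'a, 'k::field, 'm) lincat_scheme \<Rightarrow> 'a \<Rightarrow> 'a \<Rightarrow> 'a" where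
  "hdiff C f g = hadd C f (hscale C (- 1) g)"

text \<open>The condition in \<open>extensions\<close>, with the end objects read off from the two arrows.\<close>

definition ses :: "('o, 'a, 'k, 'm) lincat_scheme \<Rightarrow> 'a \<Rightarrow> 'a \<Rightarrow> bool" where
  "ses C i q \<longleftrightarrow> is_kernel C i q \<and> is_cokernel C q i"

context linear_category
begin

text \<open>Typing by sources and targets: the simplifier computes both for every composite, and the side
  conditions of the category laws then contain no objects that it would have to guess.\<close>

lemma hom_iff [simp]: "f \<in> hom C X Y \<longleftrightarrow> f \<in> arr C \<and> src C f = X \<and> trg C f = Y"
  using src_obj trg_obj by (auto simp: hom_def)

declare src_obj [simp] trg_obj [simp]

lemma comp_arr [simp]:
  assumes "f \<in> arr C" "g \<in> arr C" "src C g = trg C f"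
  shows "g \<cdot> f \<in> arr C" "src C (g \<cdot> f) = src C f" "trg C (g \<cdot> f) = trg C g"
  using comp_hom[of f "src C f" "trg C f" g "trg C g"] assms by auto

lemma assoc [simp]:
  assumes "f \<in> arr C" "g \<in> arr C" "h \<in> arr C" "src C g = trg C f" "src C h = trg C g"
  shows "(h \<cdot> g) \<cdot> f = h \<cdot> (g \<cdot> f)"
  using comp_assoc[of f "src C f" "trg C f" g "trg C g" h "trg C h"] assms by auto

lemma id_arr [simp]:
  assumes "X \<in> obj C"
  shows "\<one> X \<in> arr C" "src C (\<one> X) = X" "trg C (\<one> X) = X"
  using id_hom[OF assms] by auto

lemma comp_id [simp]:
  assumes "f \<in> arr C"
  shows "Y = trg C f \<Longrightarrow> \<one> Y \<cdot> f = f" "X = src C f \<Longrightarrow> f \<cdot> \<one> X = f"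
  using id_left[of f] id_right[of f] assms by auto

lemma zero_arr [simp]:
  assumes "X \<in> obj C" "Y \<in> obj C"
  shows "hzero C X Y \<in> arr C" "src C (hzero C X Y) = X" "trg C (hzero C X Y) = Y"
  using zero_hom[OF assms] by auto

lemma null_zero [simp]: "X \<in> obj C \<Longrightarrow> Y \<in> obj C \<Longrightarrow> null C (hzero C X Y)"
  by (simp add: null_def)

lemma add_arr [simp]:
  assumes "f \<in> arr C" "g \<in> arr C" "src C f = src C g" "trg C f = trg C g"
  shows "f \<oplus> g \<in> arr C" "src C (f \<oplus> g) = src C g" "trg C (f \<oplus> g) = trg C g"
  using add_hom[of f "src C f" "trg C f" g] assms by auto

lemma scale_arr [simp]:
  assumes "f \<in> arr C"
  shows "hscale C c f \<in> arr C" "src C (hscale C c f) = src C f" "trg C (hscale C c f) = trg C f"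
  using scale_hom[of f "src C f" "trg C f" c] assms by auto

text \<open>Zero arrows are the idempotents of addition. Distributivity therefore gives that composites with
  zero are zero.\<close>

lemma null_if_idem:
  assumes "f \<in> arr C" "f \<oplus> f = f"
  shows "null C f"
proof -
  let ?X = "src C f" and ?Y = "trg C f"
  obtain g where g: "g \<in> hom C ?X ?Y" "f \<oplus> g = hzero C ?X ?Y"
    using add_inverse[of f ?X ?Y] assms by auto
  have "f = f \<oplus> (f \<oplus> g)"
    using g add_zero[of f ?X ?Y] assms by auto
  also have "\<dots> = (f \<oplus> f) \<oplus> g"
    using add_assoc[of f ?X ?Y f g] assms g by auto
  finally show ?thesis
    using assms(2) g(2) by (simp add: null_def)
qed

lemma null_scale_zero: "f \<in> arr C \<Longrightarrow> null C (hscale C 0 f)"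
  using null_if_idem[of "hscale C 0 f"] add_scale[of f "src C f" "trg C f" 0 0] by auto

lemma diff_arr [simp]:
  assumes "f \<in> arr C" "g \<in> arr C" "src C f = src C g" "trg C f = trg C g"
  shows "hdiff C f g \<in> arr C" "src C (hdiff C f g) = src C g" "trg C (hdiff C f g) = trg C g"
  using assms by (auto simp: hdiff_def)

lemma null_diff_self: "f \<in> arr C \<Longrightarrow> null C (hdiff C f f)"
  using null_scale_zero[of f] add_scale[of f "src C f" "trg C f" 1 "- 1"]
    scale_one[of f "src C f" "trg C f"]
  by (simp add: hdiff_def)

lemma null_diff_iff:
  assumes "f \<in> arr C" "g \<in> arr C" "src C f = src C g" "trg C f = trg C g"
  shows "null C (hdiff C f g) \<longleftrightarrow> f = g"
proof
  let ?X = "src C g" and ?Y = "trg C g" and ?n = "hscale C (- 1) g"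
  assume n: "null C (hdiff C f g)"
  have "f = f \<oplus> (?n \<oplus> g)"
    using null_diff_self[of g] add_zero[of f ?X ?Y] add_commute[of g ?X ?Y ?n] assms
    by (simp add: hdiff_def null_def)
  also have "\<dots> = (f \<oplus> ?n) \<oplus> g"
    using add_assoc[of f ?X ?Y ?n g] assms by auto
  also have "\<dots> = g"
    using n add_zero[of g ?X ?Y] add_commute[of g ?X ?Y "hzero C ?X ?Y"] assms
    by (simp add: hdiff_def null_def)
  finally show "f = g" .
qed (use assms null_diff_self in auto)

lemma comp_diff:
  assumes "f \<in> arr C" "g \<in> arr C" "src C f = src C g" "trg C f = trg C g" "h \<in> arr C"
  shows "src C h = trg C f \<Longrightarrow> h \<cdot> hdiff C f g = hdiff C (h \<cdot> f) (h \<cdot> g)"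
    and "trg C h = src C f \<Longrightarrow> hdiff C f g \<cdot> h = hdiff C (f \<cdot> h) (g \<cdot> h)"
proof -
  let ?X = "src C g" and ?Y = "trg C g" and ?n = "hscale C (- 1) g"
  show "h \<cdot> hdiff C f g = hdiff C (h \<cdot> f) (h \<cdot> g)" if "src C h = trg C f"
    using comp_add_right[of f ?X ?Y ?n h "trg C h"] comp_scale_right[of g ?X ?Y h "trg C h"] assms that
    by (auto simp: hdiff_def)
  show "hdiff C f g \<cdot> h = hdiff C (f \<cdot> h) (g \<cdot> h)" if "trg C h = src C f"
    using comp_add_left[of h "src C h" ?X f ?Y ?n] comp_scale_left[of h "src C h" ?X g ?Y] assms that
    by (auto simp: hdiff_def)
qed

lemma null_comp:
  assumes "f \<in> arr C" "g \<in> arr C" "src C g = trg C f"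
  shows "null C f \<Longrightarrow> null C (g \<cdot> f)" "null C g \<Longrightarrow> null C (g \<cdot> f)"
proof -
  show "null C (g \<cdot> f)" if n: "null C f"
  proof -
    let ?X = "src C f" and ?Y = "trg C f"
    have "f \<oplus> f = f"
      using n add_zero[of f ?X ?Y] assms by (simp add: null_def)
    then have "g \<cdot> f \<oplus> g \<cdot> f = g \<cdot> f"
      using comp_add_right[of f ?X ?Y f g "trg C g"] assms by auto
    then show ?thesis
      using null_if_idem[of "g \<cdot> f"] assms by auto
  qed
  show "null C (g \<cdot> f)" if n: "null C g"
  proof -
    let ?X = "src C g" and ?Y = "trg C g"
    have "g \<oplus> g = g"
      using n add_zero[of g ?X ?Y] assms by (simp add: null_def)
    then have "g \<cdot> f \<oplus> g \<cdot> f = g \<cdot> f"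
      using comp_add_left[of f "src C f" ?X g ?Y g] assms by auto
    then show ?thesis
      using null_if_idem[of "g \<cdot> f"] assms by auto
  qed
qed

lemma diff_null_right:
  assumes "f \<in> arr C" "g \<in> arr C" "src C f = src C g" "trg C f = trg C g" "null C g"
  shows "hdiff C f g = f"
proof -
  let ?X = "src C g" and ?Y = "trg C g"
  have "hscale C (- 1) (hzero C ?X ?Y) = hscale C (- 1) (g \<cdot> hzero C ?X ?X)"
    using assms null_comp[of "hzero C ?X ?X" g] by (simp add: null_def)
  also have "\<dots> = hscale C (- 1) g \<cdot> hzero C ?X ?X"
    using comp_scale_left[of "hzero C ?X ?X" ?X ?X g ?Y] assms by auto
  also have "\<dots> = hzero C ?X ?Y"
    using assms null_comp[of "hzero C ?X ?X" "hscale C (- 1) g"] by (simp add: null_def)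
  finally show ?thesis
    using assms add_zero[of f ?X ?Y] by (simp add: hdiff_def null_def)
qed

lemma null_diff_null:
  assumes "f \<in> arr C" "g \<in> arr C" "src C f = src C g" "trg C f = trg C g" "null C f"
  shows "null C (hdiff C f g) \<longleftrightarrow> null C g"
  using assms null_diff_iff[of f g] by (auto simp: null_def)

lemma null_eq: "null C f \<Longrightarrow> null C g \<Longrightarrow> src C f = src C g \<Longrightarrow> trg C f = trg C g \<Longrightarrow> f = g"
  by (metis null_def)

lemma null_iff: "src C f = X \<Longrightarrow> trg C f = Y \<Longrightarrow> null C f \<longleftrightarrow> f = hzero C X Y"
  by (auto simp only: null_def)

lemma mono_arr: "is_mono C f \<Longrightarrow> f \<in> arr C"
  by (simp add: is_mono_def)

lemma epi_arr: "is_epi C f \<Longrightarrow> f \<in> arr C"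
  by (simp add: is_epi_def)

lemma iso_arr: "is_iso C f \<Longrightarrow> f \<in> arr C"
  by (simp add: is_iso_def)

lemma mono_cancel:
  assumes "is_mono C f" "g \<in> arr C" "h \<in> arr C" "src C g = src C h" "trg C g = src C f"
    "trg C h = src C f" "f \<cdot> g = f \<cdot> h"
  shows "g = h"
  using assms by (auto simp: is_mono_def)

lemma epi_cancel:
  assumes "is_epi C f" "g \<in> arr C" "h \<in> arr C" "trg C g = trg C h" "src C g = trg C f"
    "src C h = trg C f" "g \<cdot> f = h \<cdot> f"
  shows "g = h"
  using assms by (auto simp: is_epi_def)

lemma mono_null:
  assumes f: "is_mono C f" and g: "g \<in> arr C" "trg C g = src C f"
  shows "null C (f \<cdot> g) \<longleftrightarrow> null C g"
proof
  let ?z = "hzero C (src C g) (src C f)"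
  have z: "?z \<in> arr C" "src C ?z = src C g" "trg C ?z = src C f" "null C ?z"
    using g mono_arr[OF f] by simp_all
  assume "null C (f \<cdot> g)"
  then have "f \<cdot> g = f \<cdot> ?z"
    using z g mono_arr[OF f] null_comp(1)[of ?z f] by - (rule null_eq; simp)
  then have "g = ?z"
    using mono_cancel[OF f g(1) z(1)] z g by simp
  with z(4) show "null C g" by metis
qed (use null_comp(1)[of g f] mono_arr[OF f] g in simp)

lemma epi_null:
  assumes f: "is_epi C f" and g: "g \<in> arr C" "src C g = trg C f"
  shows "null C (g \<cdot> f) \<longleftrightarrow> null C g"
proof
  let ?z = "hzero C (trg C f) (trg C g)"
  have z: "?z \<in> arr C" "trg C ?z = trg C g" "src C ?z = trg C f" "null C ?z"
    using g epi_arr[OF f] by simp_all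
  assume "null C (g \<cdot> f)"
  then have "g \<cdot> f = ?z \<cdot> f"
    using z g epi_arr[OF f] null_comp(2)[of f ?z] by - (rule null_eq; simp)
  then have "g = ?z"
    using epi_cancel[OF f g(1) z(1)] z g by simp
  with z(4) show "null C g" by metis
qed (use null_comp(2)[of f g] epi_arr[OF f] g in simp)

lemma monoI:
  assumes f: "f \<in> arr C"
    and k: "\<And>h. h \<in> arr C \<Longrightarrow> trg C h = src C f \<Longrightarrow> null C (f \<cdot> h) \<Longrightarrow> null C h"
  shows "is_mono C f"
  unfolding is_mono_def
proof (intro conjI f allI ballI impI)
  fix W g h
  assume g: "g \<in> hom C W (src C f)" and h: "h \<in> hom C W (src C f)" and e: "f \<cdot> g = f \<cdot> h"
  have "null C (f \<cdot> hdiff C g h)"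
    using g h e f by (simp add: comp_diff null_diff_self)
  with g h have "null C (hdiff C g h)"
    using k[of "hdiff C g h"] by simp
  then show "g = h"
    using g h by (simp add: null_diff_iff)
qed

lemma epiI:
  assumes f: "f \<in> arr C"
    and k: "\<And>h. h \<in> arr C \<Longrightarrow> src C h = trg C f \<Longrightarrow> null C (h \<cdot> f) \<Longrightarrow> null C h"
  shows "is_epi C f"
  unfolding is_epi_def
proof (intro conjI f allI ballI impI)
  fix Z g h
  assume g: "g \<in> hom C (trg C f) Z" and h: "h \<in> hom C (trg C f) Z" and e: "g \<cdot> f = h \<cdot> f"
  have "null C (hdiff C g h \<cdot> f)"
    using g h e f by (simp add: comp_diff null_diff_self)
  with g h have "null C (hdiff C g h)"
    using k[of "hdiff C g h"] by simp
  then show "g = h"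
    using g h by (simp add: null_diff_iff)
qed

lemma mono_comp: "is_mono C f \<Longrightarrow> is_mono C g \<Longrightarrow> src C g = trg C f \<Longrightarrow> is_mono C (g \<cdot> f)"
  using mono_arr[of f] mono_arr[of g] by (intro monoI) (auto simp: mono_null)

lemma epi_comp: "is_epi C f \<Longrightarrow> is_epi C g \<Longrightarrow> src C g = trg C f \<Longrightarrow> is_epi C (g \<cdot> f)"
  using epi_arr[of f] epi_arr[of g]
  by (intro epiI) (auto simp: epi_null simp flip: assoc)

lemma mono_first:
  assumes "f \<in> arr C" "g \<in> arr C" "src C g = trg C f" "is_mono C (g \<cdot> f)"
  shows "is_mono C f"
proof (rule monoI)
  fix h assume h: "h \<in> arr C" "trg C h = src C f" "null C (f \<cdot> h)"
  then have "null C ((g \<cdot> f) \<cdot> h)" using assms null_comp[of "f \<cdot> h" g] by auto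
  then show "null C h" using mono_null[OF assms(4)] h assms by auto
qed (fact assms)

lemma epi_second:
  assumes "f \<in> arr C" "g \<in> arr C" "src C g = trg C f" "is_epi C (g \<cdot> f)"
  shows "is_epi C g"
proof (rule epiI)
  fix h assume h: "h \<in> arr C" "src C h = trg C g" "null C (h \<cdot> g)"
  then have "null C (h \<cdot> (g \<cdot> f))" using assms null_comp[of f "h \<cdot> g"] by auto
  then show "null C h" using epi_null[OF assms(4)] h assms by auto
qed (fact assms)

lemma iso_mono_epi:
  assumes "is_iso C f"
  shows "is_mono C f" "is_epi C f"
proof -
  obtain g where g: "g \<in> hom C (trg C f) (src C f)" "g \<cdot> f = \<one> (src C f)" "f \<cdot> g = \<one> (trg C f)"
    and f: "f \<in> arr C"
    using assms by (auto simp: is_iso_def)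
  have "is_mono C (\<one> (src C f))" "is_epi C (\<one> (trg C f))"
    using f by (auto intro!: monoI epiI)
  then show "is_mono C f" "is_epi C f"
    using mono_first[of f g] epi_second[of g f] f g by auto
qed

lemma isoE:
  assumes "is_iso C f"
  obtains g where "g \<in> arr C" "src C g = trg C f" "trg C g = src C f"
    "g \<cdot> f = \<one> (src C f)" "f \<cdot> g = \<one> (trg C f)" "is_iso C g"
  using assms by (fastforce simp: is_iso_def)

lemma isoI:
  assumes "f \<in> arr C" "g \<in> arr C" "src C g = trg C f" "trg C g = src C f"
    "g \<cdot> f = \<one> (src C f)" "f \<cdot> g = \<one> (trg C f)"
  shows "is_iso C f"
  using assms by (fastforce simp: is_iso_def)

lemma id_iso: "X \<in> obj C \<Longrightarrow> is_iso C (\<one> X)"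
  by (rule isoI[of _ "\<one> X"]) auto

lemma zero_obj_iff_null: "zero_obj C Z \<longleftrightarrow> Z \<in> obj C \<and> null C (\<one> Z)"
proof
  assume z: "zero_obj C Z"
  then have "Z \<in> obj C" "\<exists>!f. f \<in> hom C Z Z" by (auto simp: zero_obj_def)
  then show "Z \<in> obj C \<and> null C (\<one> Z)"
    unfolding null_def by (metis id_arr zero_arr hom_iff)
next
  assume z: "Z \<in> obj C \<and> null C (\<one> Z)"
  have 1: "null C f" if "f \<in> arr C" "trg C f = Z" for f
    using null_comp(2)[of f "\<one> Z"] that z by auto
  have 2: "null C f" if "f \<in> arr C" "src C f = Z" for f
    using null_comp(1)[of "\<one> Z" f] that z by auto
  show "zero_obj C Z"
    unfolding zero_obj_def
  proof (intro conjI ballI)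
    fix X assume X: "X \<in> obj C"
    show "\<exists>!f. f \<in> hom C X Z"
    proof (rule ex1I)
      show "f = hzero C X Z" if "f \<in> hom C X Z" for f
        using that 1[of f] null_iff[of f X Z] by simp
    qed (use X z in simp)
    show "\<exists>!f. f \<in> hom C Z X"
    proof (rule ex1I)
      show "f = hzero C Z X" if "f \<in> hom C Z X" for f
        using that 2[of f] null_iff[of f Z X] by simp
    qed (use X z in simp)
  qed (use z in auto)
qed

lemma null_of_zero_obj:
  assumes "f \<in> arr C" "zero_obj C (src C f) \<or> zero_obj C (trg C f)"
  shows "null C f"
  using assms null_comp(1)[of "\<one> (src C f)" f] null_comp(2)[of f "\<one> (trg C f)"]
  by (auto simp: zero_obj_iff_null)

lemma mono_null_src: "is_mono C f \<Longrightarrow> null C f \<longleftrightarrow> zero_obj C (src C f)"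
  using null_of_zero_obj[of f] mono_arr[of f] mono_null[of f "\<one> (src C f)"]
  by (auto simp: zero_obj_iff_null)

lemma epi_null_trg: "is_epi C f \<Longrightarrow> null C f \<longleftrightarrow> zero_obj C (trg C f)"
  using null_of_zero_obj[of f] epi_arr[of f] epi_null[of f "\<one> (trg C f)"]
  by (auto simp: zero_obj_iff_null)

text \<open>The uniqueness clause in the definition of a kernel is monicity.\<close>

lemma kernel_iff:
  "is_kernel C k f \<longleftrightarrow> f \<in> arr C \<and> is_mono C k \<and> trg C k = src C f \<and> null C (f \<cdot> k) \<and>
     (\<forall>h\<in>arr C. trg C h = src C f \<and> null C (f \<cdot> h) \<longrightarrow>
        (\<exists>u\<in>hom C (src C h) (src C k). k \<cdot> u = h))" (is "_ \<longleftrightarrow> ?R")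
proof
  assume k: "is_kernel C k f"
  then have a: "f \<in> arr C" "k \<in> arr C" "trg C k = src C f"
    and n: "f \<cdot> k = hzero C (src C k) (trg C f)"
    by (simp_all add: is_kernel_def)
  have u: "\<exists>!u. u \<in> hom C (src C h) (src C k) \<and> k \<cdot> u = h"
    if "h \<in> arr C" "trg C h = src C f" "null C (f \<cdot> h)" for h
  proof -
    have "f \<cdot> h = hzero C (src C h) (trg C f)" "h \<in> hom C (src C h) (src C f)"
      using that a null_iff[of "f \<cdot> h" "src C h" "trg C f"] by simp_all
    then show ?thesis using k unfolding is_kernel_def by blast
  qed
  have "is_mono C k"
  proof (rule monoI)
    fix h assume h: "h \<in> arr C" "trg C h = src C k" "null C (k \<cdot> h)"
    let ?z = "hzero C (src C h) (src C k)"
    have z: "?z \<in> hom C (src C h) (src C k)" "null C ?z" using h a by simp_all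
    have "null C (f \<cdot> (k \<cdot> h))" using a h null_comp(1)[of "k \<cdot> h" f] by simp
    then have "\<exists>!u. u \<in> hom C (src C h) (src C k) \<and> k \<cdot> u = k \<cdot> h"
      using u[of "k \<cdot> h"] a h by simp
    moreover have "k \<cdot> ?z = k \<cdot> h"
      using z a h null_comp(1)[of ?z k] by - (rule null_eq; simp)
    moreover have "h \<in> hom C (src C h) (src C k)" using h by simp
    ultimately have "h = ?z" using z(1) by metis
    with z(2) show "null C h" by metis
  qed (fact a)
  moreover have nfk: "null C (f \<cdot> k)" using n a null_iff[of "f \<cdot> k" "src C k" "trg C f"] by simp
  moreover have "\<exists>u\<in>hom C (src C h) (src C k). k \<cdot> u = h"
    if "h \<in> arr C" "trg C h = src C f" "null C (f \<cdot> h)" for h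
    using ex1_implies_ex[OF u[OF that]] by (simp add: Bex_def del: hom_iff)
  ultimately show ?R
    using a by (simp del: hom_iff)
next
  assume R: ?R
  then have a: "f \<in> arr C" "is_mono C k" "trg C k = src C f" "null C (f \<cdot> k)" "k \<in> arr C"
    by (simp_all add: mono_arr)
  show "is_kernel C k f"
    unfolding is_kernel_def
  proof (intro conjI allI ballI impI a)
    show "f \<cdot> k = hzero C (src C k) (trg C f)" using a null_iff[of "f \<cdot> k" "src C k" "trg C f"] by simp
    fix W h assume h: "h \<in> hom C W (src C f)" "f \<cdot> h = hzero C W (trg C f)"
    then have hh: "h \<in> arr C" "trg C h = src C f" by simp_all
    then have "null C (f \<cdot> h)"
      using null_zero[OF src_obj[of h] trg_obj[OF a(1)]] h by simp
    with hh have "\<exists>u\<in>hom C (src C h) (src C k). k \<cdot> u = h"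
      using R by blast
    then obtain u where u: "u \<in> hom C (src C h) (src C k)" "k \<cdot> u = h"
      by blast
    show "\<exists>!u. u \<in> hom C W (src C k) \<and> k \<cdot> u = h"
    proof (rule ex1I[of _ u])
      show "v = u" if "v \<in> hom C W (src C k) \<and> k \<cdot> v = h" for v
        using that u h a by - (rule mono_cancel[OF a(2)]; simp)
    qed (use u h in simp)
  qed
qed

end

section \<open>The opposite category\<close>

text \<open>Cokernels, epimorphisms and pushouts are obtained below from kernels, monomorphisms and
  pullbacks in this category. Its other use is that the two halves of the theorem share the
  argument by which a single step of a filtration is constructed.\<close>

definition opp :: "('o, 'a, 'k) lincat \<Rightarrow> ('o, 'a, 'k) lincat" where
  "opp C = \<lparr>obj = obj C, arr = arr C, src = trg C, trg = src C, idt = idt C,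
     cmp = (\<lambda>f g. cmp C g f), hzero = (\<lambda>X Y. hzero C Y X), hadd = hadd C, hscale = hscale C\<rparr>"

lemma opp_simps [simp]:
  "obj (opp C) = obj C" "arr (opp C) = arr C" "src (opp C) = trg C" "trg (opp C) = src C"
  "idt (opp C) = idt C" "cmp (opp C) f g = cmp C g f" "hzero (opp C) X Y = hzero C Y X"
  "hadd (opp C) = hadd C" "hscale (opp C) = hscale C"
  by (simp_all add: opp_def)

lemma opp_hom [simp]: "hom (opp C) X Y = hom C Y X"
  by (auto simp: hom_def)

lemma opp_opp [simp]: "opp (opp C) = C"
  by (simp add: opp_def)

lemma opp_null [simp]: "null (opp C) f = null C f"
  by (simp add: null_def)

lemma opp_mono [simp]: "is_mono (opp C) f = is_epi C f"
  by (simp add: is_mono_def is_epi_def)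

lemma opp_epi [simp]: "is_epi (opp C) f = is_mono C f"
  by (simp add: is_mono_def is_epi_def)

lemma opp_iso [simp]: "is_iso (opp C) f = is_iso C f"
  by (auto simp: is_iso_def)

lemma opp_zero_obj [simp]: "zero_obj (opp C) Z = zero_obj C Z"
  by (auto simp: zero_obj_def)

lemma opp_kernel [simp]: "is_kernel (opp C) k f = is_cokernel C k f"
  by (simp add: is_kernel_def is_cokernel_def)

lemma opp_cokernel [simp]: "is_cokernel (opp C) k f = is_kernel C k f"
  by (simp add: is_kernel_def is_cokernel_def)

lemma opp_ses [simp]: "ses (opp C) i q = ses C q i"
  by (auto simp: ses_def)

lemma opp_biproduct: "is_biproduct C X Y P \<Longrightarrow> is_biproduct (opp C) X Y P"
proof -
  assume "is_biproduct C X Y P"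
  then obtain i j p q where "i\<in>hom C X P" "j\<in>hom C Y P" "p\<in>hom C P X" "q\<in>hom C P Y"
    "cmp C p i = idt C X" "cmp C q j = idt C Y" "cmp C p j = hzero C Y X"
    "cmp C q i = hzero C X Y" "hadd C (cmp C i p) (cmp C j q) = idt C P"
    unfolding is_biproduct_def by blast
  then show ?thesis
    unfolding is_biproduct_def
    by (intro bexI[of _ p] bexI[of _ q] bexI[of _ i] bexI[of _ j]) auto
qed

lemma (in linear_category) linear_opp: "linear_category (opp C)"
proof (rule linear_category.intro, unfold opp_simps opp_hom)
qed (use src_obj trg_obj in blast |
    (rule id_hom comp_hom id_left id_right comp_assoc[symmetric] zero_hom add_hom scale_hom
      add_assoc add_commute add_zero add_inverse scale_add add_scale scale_scale scale_one
      comp_add_left comp_add_right comp_scale_left comp_scale_right; assumption))+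

lemma (in abelian_linear_category) abelian_opp: "abelian_linear_category (opp C)"
proof -
  interpret o: linear_category "opp C" by (rule linear_opp)
  show ?thesis
  proof
    show "\<exists>P. is_biproduct (opp C) X Y P" if "X \<in> obj (opp C)" "Y \<in> obj (opp C)" for X Y
      using ex_biproduct[of X Y] opp_biproduct[of C X Y] that by auto
  qed (use ex_zero ex_kernel ex_cokernel mono_normal epi_normal in auto)
qed

section \<open>Short exact sequences\<close>

context linear_category
begin

text \<open>Composites are normalized by bracketing to the right; this lets an equation apply to the left
  part of such a composite.\<close>

lemma comp_reduce:
  assumes "h \<cdot> g = k" "g \<in> arr C" "h \<in> arr C" "src C h = trg C g" "f \<in> arr C" "trg C f = src C g"
  shows "h \<cdot> (g \<cdot> f) = k \<cdot> f"
  using assms assoc[of f g h] by simp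

lemma comp_diff_null:
  assumes fg: "f \<in> arr C" "g \<in> arr C" "src C f = src C g" "trg C f = trg C g"
    and h: "h \<in> arr C" "src C h = trg C f" and e: "h \<cdot> f = h \<cdot> g"
  shows "null C (h \<cdot> hdiff C f g)"
  unfolding comp_diff(1)[OF fg h] e using fg h by (intro null_diff_self) simp

lemma diff_comp_null:
  assumes fg: "f \<in> arr C" "g \<in> arr C" "src C f = src C g" "trg C f = trg C g"
    and h: "h \<in> arr C" "trg C h = src C f" and e: "f \<cdot> h = g \<cdot> h"
  shows "null C (hdiff C f g \<cdot> h)"
  unfolding comp_diff(2)[OF fg h] e using fg h by (intro null_diff_self) simp

lemma diff_comp_eq:
  assumes fg: "f \<in> arr C" "g \<in> arr C" "src C f = src C g" "trg C f = trg C g"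
    and h: "h \<in> arr C" "trg C h = src C f" and n: "null C (g \<cdot> h)"
  shows "hdiff C f g \<cdot> h = f \<cdot> h"
  unfolding comp_diff(2)[OF fg h] using fg h n by - (rule diff_null_right; simp)

lemma kernelD:
  assumes "is_kernel C k f"
  shows "f \<in> arr C" "k \<in> arr C" "is_mono C k" "trg C k = src C f" "null C (f \<cdot> k)"
  using assms mono_arr unfolding kernel_iff by blast+

lemma kernel_lift:
  assumes "is_kernel C k f" "h \<in> arr C" "trg C h = src C f" "null C (f \<cdot> h)"
  shows "\<exists>u. u \<in> arr C \<and> src C u = src C h \<and> trg C u = src C k \<and> k \<cdot> u = h"
  using assms unfolding kernel_iff Bex_def hom_iff by blast

lemma kernelI:
  assumes "f \<in> arr C" "is_mono C k" "trg C k = src C f" "null C (f \<cdot> k)"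
    and "\<And>h. h \<in> arr C \<Longrightarrow> trg C h = src C f \<Longrightarrow> null C (f \<cdot> h) \<Longrightarrow>
      \<exists>u. u \<in> arr C \<and> src C u = src C h \<and> trg C u = src C k \<and> k \<cdot> u = h"
  shows "is_kernel C k f"
  using assms unfolding kernel_iff Bex_def hom_iff by blast

lemma cokernelD:
  assumes "is_cokernel C q f"
  shows "f \<in> arr C" "q \<in> arr C" "is_epi C q" "src C q = trg C f" "null C (q \<cdot> f)"
  using linear_category.kernelD[OF linear_opp, of q f] assms by simp_all

lemma cokernel_colift:
  assumes "is_cokernel C q f" "h \<in> arr C" "src C h = trg C f" "null C (h \<cdot> f)"
  shows "\<exists>u. u \<in> arr C \<and> trg C u = trg C h \<and> src C u = trg C q \<and> u \<cdot> q = h"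
  using linear_category.kernel_lift[OF linear_opp, of q f h] assms by simp

lemma cokernelI:
  assumes "f \<in> arr C" "is_epi C q" "src C q = trg C f" "null C (q \<cdot> f)"
    and "\<And>h. h \<in> arr C \<Longrightarrow> src C h = trg C f \<Longrightarrow> null C (h \<cdot> f) \<Longrightarrow>
      \<exists>u. u \<in> arr C \<and> trg C u = trg C h \<and> src C u = trg C q \<and> u \<cdot> q = h"
  shows "is_cokernel C q f"
  using linear_category.kernelI[OF linear_opp, of f q] assms by simp

lemma sesD:
  assumes "ses C i q"
  shows "i \<in> arr C" "q \<in> arr C" "src C q = trg C i" "is_mono C i" "is_epi C q" "null C (q \<cdot> i)"
  using assms kernelD[of i q] cokernelD[of q i] unfolding ses_def by simp_all

lemma ses_lift:
  assumes "ses C i q" "h \<in> arr C" "trg C h = trg C i" "null C (q \<cdot> h)"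
  obtains u where "u \<in> arr C" "src C u = src C h" "trg C u = src C i" "i \<cdot> u = h"
  using kernel_lift[of i q h] assms sesD(3)[OF assms(1)] unfolding ses_def by metis

lemma ses_colift:
  assumes "ses C i q" "h \<in> arr C" "src C h = src C q" "null C (h \<cdot> i)"
  obtains u where "u \<in> arr C" "src C u = trg C q" "trg C u = trg C h" "u \<cdot> q = h"
  using cokernel_colift[of q i h] assms sesD(3)[OF assms(1)] unfolding ses_def by metis

end

context abelian_linear_category
begin

text \<open>The monomorphism is the kernel of some \<open>g\<close>, and \<open>g\<close> factors through the cokernel; hence all that
  the cokernel kills is killed by \<open>g\<close>.\<close>

lemma mono_ses:
  assumes i: "is_mono C i"
  obtains q where "ses C i q"
proof -
  obtain g where g: "is_kernel C i g" using mono_normal i by blast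
  obtain q where q: "is_cokernel C q i" using ex_cokernel i mono_arr by blast
  note gD = kernelD[OF g] and qD = cokernelD[OF q]
  obtain w where w: "w \<in> arr C" "trg C w = trg C g" "src C w = trg C q" "w \<cdot> q = g"
    using cokernel_colift[OF q, of g] gD by auto
  have "is_kernel C i q"
  proof (rule kernelI)
    fix h assume h: "h \<in> arr C" "trg C h = src C q" "null C (q \<cdot> h)"
    then have "null C (w \<cdot> (q \<cdot> h))" using w qD by - (rule null_comp(1); simp)
    moreover have "w \<cdot> (q \<cdot> h) = g \<cdot> h"
      using assoc[of h q w] w h qD by simp
    ultimately show "\<exists>u. u \<in> arr C \<and> src C u = src C h \<and> trg C u = src C i \<and> i \<cdot> u = h"
      using kernel_lift[OF g, of h] h qD gD by simp
  qed (use qD i in simp_all)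
  then show ?thesis using that[of q] q by (simp add: ses_def)
qed

lemma epi_ses:
  assumes "is_epi C q"
  obtains i where "ses C i q"
  by (rule abelian_linear_category.mono_ses[OF abelian_opp, of q]) (use assms in simp_all)

lemma kernelE:
  assumes "f \<in> arr C"
  obtains k where "is_kernel C k f" "is_mono C k" "k \<in> arr C" "trg C k = src C f" "null C (f \<cdot> k)"
  using ex_kernel[OF assms] kernelD by metis

lemma cokernelE:
  assumes "f \<in> arr C"
  obtains q where "is_cokernel C q f" "is_epi C q" "q \<in> arr C" "src C q = trg C f" "null C (q \<cdot> f)"
  using ex_cokernel[OF assms] cokernelD by metis

text \<open>An epimorphism is the cokernel of one of its kernels, and any two kernels factor through each other.\<close>

lemma epi_kernel_ses:
  assumes q: "is_epi C q" and k: "is_kernel C i q"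
  shows "ses C i q"
proof -
  note qa = epi_arr[OF q] and kD = kernelD[OF k]
  obtain j where j: "ses C j q" using epi_ses q by blast
  note jD = sesD[OF j]
  obtain v where v: "v \<in> arr C" "src C v = src C j" "trg C v = src C i" "i \<cdot> v = j"
    using kernel_lift[OF k, of j] jD by auto
  have "is_cokernel C q i"
  proof (rule cokernelI)
    fix h assume h: "h \<in> arr C" "src C h = trg C i" "null C (h \<cdot> i)"
    have "null C ((h \<cdot> i) \<cdot> v)" using h kD v by - (rule null_comp(2); simp)
    then have "null C (h \<cdot> j)" using h v kD by simp
    then obtain u where "u \<in> arr C" "src C u = trg C q" "trg C u = trg C h" "u \<cdot> q = h"
      using ses_colift[OF j, of h] h kD by metis
    then show "\<exists>u. u \<in> arr C \<and> trg C u = trg C h \<and> src C u = trg C q \<and> u \<cdot> q = h"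
      by blast
  qed (use q kD in simp_all)
  with k show ?thesis by (simp add: ses_def)
qed

lemma mono_cokernel_ses: "is_mono C i \<Longrightarrow> is_cokernel C q i \<Longrightarrow> ses C i q"
  using abelian_linear_category.epi_kernel_ses[OF abelian_opp, of i q] by simp

lemma mono_epi_iso:
  assumes m: "is_mono C f" and e: "is_epi C f"
  shows "is_iso C f"
proof -
  note f = mono_arr[OF m]
  obtain q where q: "ses C f q" using mono_ses m by blast
  note s = sesD[OF q]
  have "null C q" using epi_null[OF e, of q] s by simp
  then have "null C (q \<cdot> \<one> (trg C f))" using s f by simp
  then obtain u where u: "u \<in> arr C" "src C u = trg C f" "trg C u = src C f" "f \<cdot> u = \<one> (trg C f)"
    using ses_lift[OF q, of "\<one> (trg C f)"] f by auto
  have "f \<cdot> (u \<cdot> f) = f \<cdot> \<one> (src C f)"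
    using u f assoc[of f u f] by simp
  then have "u \<cdot> f = \<one> (src C f)"
    using m u f by - (rule mono_cancel[of f]; simp)
  then show ?thesis
    using u f by (intro isoI[of f u]) auto
qed

text \<open>The mono part is the kernel \<open>m\<close> of the cokernel of \<open>f\<close>. Suppose that \<open>h\<close> kills the other part and let
  \<open>k\<close> be the kernel of \<open>h\<close>. Then \<open>f\<close> factors through \<open>m k\<close>, so that the cokernel of \<open>m k\<close> factors through
  that of \<open>f\<close> and kills \<open>m\<close>. Therefore \<open>m\<close> factors through \<open>m k\<close>, so \<open>k\<close> has a right inverse and \<open>h\<close> is zero.\<close>

lemma image:
  assumes f: "f \<in> arr C"
  obtains m e where "is_mono C m" "is_epi C e" "m \<in> arr C" "e \<in> arr C" "trg C m = trg C f"
    "src C e = src C f" "src C m = trg C e" "m \<cdot> e = f"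
proof -
  obtain q where cq: "is_cokernel C q f"
    and q: "is_epi C q" "q \<in> arr C" "src C q = trg C f" "null C (q \<cdot> f)"
    using cokernelE[OF f] by metis
  obtain m where km: "is_kernel C m q"
    and m: "is_mono C m" "m \<in> arr C" "trg C m = src C q" "null C (q \<cdot> m)"
    using kernelE[OF q(2)] by metis
  obtain e where e: "e \<in> arr C" "src C e = src C f" "trg C e = src C m" "m \<cdot> e = f"
    using kernel_lift[OF km, of f] f q by auto
  have "is_epi C e"
  proof (rule epiI)
    fix h assume h: "h \<in> arr C" "src C h = trg C e" "null C (h \<cdot> e)"
    obtain k where kk: "is_kernel C k h"
      and k: "is_mono C k" "k \<in> arr C" "trg C k = src C h" "null C (h \<cdot> k)"
      using kernelE[OF h(1)] by metis
    obtain e' where e': "e' \<in> arr C" "src C e' = src C e" "trg C e' = src C k" "k \<cdot> e' = e"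
      using kernel_lift[OF kk, of e] h e by auto
    have "is_mono C (m \<cdot> k)" using m k h e by (intro mono_comp) auto
    then obtain c where c: "ses C (m \<cdot> k) c" using mono_ses by blast
    note cD = sesD[OF c]
    have mk: "m \<cdot> k \<in> arr C" "trg C (m \<cdot> k) = trg C m" "src C (m \<cdot> k) = src C k"
      using m k h e by auto
    have "null C (c \<cdot> (m \<cdot> k) \<cdot> e')" using cD e' mk by - (rule null_comp(2); simp)
    moreover have "c \<cdot> (m \<cdot> k) \<cdot> e' = c \<cdot> f"
    proof -
      have "c \<cdot> (m \<cdot> k) \<cdot> e' = c \<cdot> (m \<cdot> (k \<cdot> e'))" using cD(1-3) m k e' h e by simp
      then show ?thesis using e' e by simp
    qed
    ultimately have "null C (c \<cdot> f)" by simp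
    then obtain c' where c': "c' \<in> arr C" "src C c' = trg C q" "c' \<cdot> q = c"
      using cokernel_colift[OF cq, of c] cD mk m q by auto
    have "null C (c' \<cdot> (q \<cdot> m))" using c' q m by - (rule null_comp(1); simp)
    then have "null C (c \<cdot> m)" using c' q m assoc[of m q c'] by simp
    then obtain w where w: "w \<in> arr C" "src C w = src C m" "trg C w = src C (m \<cdot> k)"
      "(m \<cdot> k) \<cdot> w = m"
      using ses_lift[OF c, of m] mk m by auto
    have "m \<cdot> (k \<cdot> w) = m \<cdot> \<one> (src C m)" using w mk m k h e by simp
    then have kw: "k \<cdot> w = \<one> (src C m)" using w mk m k h e by - (rule mono_cancel[of m]; simp)
    have "null C ((h \<cdot> k) \<cdot> w)" using h k w mk by - (rule null_comp(2); simp)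
    then show "null C h" using kw h k w mk e by simp
  qed (use e in simp)
  then show ?thesis using that[of m e] m e q by simp
qed

lemma nonzero_image:
  assumes "m \<in> arr C" "e \<in> arr C" "src C m = trg C e" "\<not> null C (m \<cdot> e)"
  shows "\<not> null C m" "\<not> null C e"
  using assms null_comp[of e m] by auto

end

section \<open>Pullbacks\<close>

context abelian_linear_category
begin

lemma biproductE:
  assumes "X \<in> obj C" "Y \<in> obj C"
  obtains P i j p q where "i \<in> arr C" "j \<in> arr C" "p \<in> arr C" "q \<in> arr C"
    "src C i = X" "trg C i = P" "src C j = Y" "trg C j = P"
    "src C p = P" "trg C p = X" "src C q = P" "trg C q = Y"
    "p \<cdot> i = \<one> X" "q \<cdot> j = \<one> Y" "null C (p \<cdot> j)" "null C (q \<cdot> i)"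
    "(i \<cdot> p) \<oplus> (j \<cdot> q) = \<one> P"
proof -
  obtain P where "is_biproduct C X Y P" using ex_biproduct assms by blast
  then obtain i j p q where "i \<in> hom C X P" "j \<in> hom C Y P" "p \<in> hom C P X" "q \<in> hom C P Y"
    "p \<cdot> i = \<one> X" "q \<cdot> j = \<one> Y" "p \<cdot> j = hzero C Y X" "q \<cdot> i = hzero C X Y"
    "(i \<cdot> p) \<oplus> (j \<cdot> q) = \<one> P"
    unfolding is_biproduct_def by blast
  then show ?thesis using that[of i j p q P] assms by simp
qed

lemma add_null:
  assumes "f \<in> arr C" "g \<in> arr C" "src C f = src C g" "trg C f = trg C g"
  shows "null C g \<Longrightarrow> f \<oplus> g = f" "null C f \<Longrightarrow> f \<oplus> g = g"
proof -
  show a: "f \<oplus> g = f" if "null C g"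
    using add_zero[of f "src C g" "trg C g"] assms that null_iff[of g "src C g" "trg C g"] by simp
  show "f \<oplus> g = g" if "null C f"
    using add_zero[of g "src C g" "trg C g"] add_commute[of f "src C g" "trg C g" g] assms that
      null_iff[of f "src C g" "trg C g"] by simp
qed

text \<open>Uniqueness of the induced arrow is stated as joint monicity of the two projections.\<close>

definition is_pullback :: "'a \<Rightarrow> 'a \<Rightarrow> 'a \<Rightarrow> 'a \<Rightarrow> bool" where
  "is_pullback f g p q \<longleftrightarrow> p \<in> arr C \<and> q \<in> arr C \<and> src C p = src C q \<and> trg C p = src C f \<and>
     trg C q = src C g \<and> f \<cdot> p = g \<cdot> q \<and>
     (\<forall>a b. a \<in> arr C \<and> b \<in> arr C \<and> src C a = src C b \<and> trg C a = src C f \<and>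
        trg C b = src C g \<and> f \<cdot> a = g \<cdot> b \<longrightarrow>
        (\<exists>u. u \<in> arr C \<and> src C u = src C a \<and> trg C u = src C p \<and> p \<cdot> u = a \<and> q \<cdot> u = b)) \<and>
     (\<forall>h. h \<in> arr C \<and> trg C h = src C p \<and> null C (p \<cdot> h) \<and> null C (q \<cdot> h) \<longrightarrow> null C h)"

lemma is_pullbackD:
  assumes "is_pullback f g p q"
  shows "p \<in> arr C" "q \<in> arr C" "src C p = src C q" "trg C p = src C f" "trg C q = src C g"
    "f \<cdot> p = g \<cdot> q"
  using assms unfolding is_pullback_def by blast+

lemma is_pullback_lift:
  assumes "is_pullback f g p q" "a \<in> arr C" "b \<in> arr C" "src C a = src C b" "trg C a = src C f"
    "trg C b = src C g" "f \<cdot> a = g \<cdot> b"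
  obtains u where "u \<in> arr C" "src C u = src C a" "trg C u = src C p" "p \<cdot> u = a" "q \<cdot> u = b"
  using assms unfolding is_pullback_def by blast

lemma is_pullback_null:
  assumes "is_pullback f g p q" "h \<in> arr C" "trg C h = src C p" "null C (p \<cdot> h)" "null C (q \<cdot> h)"
  shows "null C h"
  using assms unfolding is_pullback_def by blast

text \<open>The pullback of \<open>f\<close> and \<open>g\<close> is the kernel of \<open>(f, -g)\<close> on the direct sum of the sources. If
  \<open>g\<close> is epi, then so is \<open>(f, -g)\<close>, and the kernel and this map form a short exact sequence. An
  arrow \<open>a\<close> that kills \<open>p\<close> therefore factors, after projection to the source of \<open>f\<close>, through
  \<open>(f, -g)\<close>; restriction to the source of \<open>g\<close> shows that the factor is zero.\<close>

lemma pullback: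
  assumes f: "f \<in> arr C" and g: "g \<in> arr C" and fg: "trg C f = trg C g"
  obtains p q where "is_pullback f g p q"
    "is_epi C g \<Longrightarrow> is_epi C p" "is_mono C f \<Longrightarrow> is_mono C q"
proof -
  obtain P i j p0 q0 where b: "i \<in> arr C" "j \<in> arr C" "p0 \<in> arr C" "q0 \<in> arr C"
    "src C i = src C f" "trg C i = P" "src C j = src C g" "trg C j = P"
    "src C p0 = P" "trg C p0 = src C f" "src C q0 = P" "trg C q0 = src C g"
    "p0 \<cdot> i = \<one> (src C f)" "q0 \<cdot> j = \<one> (src C g)" "null C (p0 \<cdot> j)" "null C (q0 \<cdot> i)"
    "(i \<cdot> p0) \<oplus> (j \<cdot> q0) = \<one> P"
    using biproductE[OF src_obj[OF f] src_obj[OF g]] by metis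
  \<comment> \<open>The map \<open>(f, -g)\<close> on the direct sum.\<close>
  let ?d = "hdiff C (f \<cdot> p0) (g \<cdot> q0)"
  have d: "?d \<in> arr C" "src C ?d = P" "trg C ?d = trg C g" using b f g fg by simp_all
  have P: "P \<in> obj C" using src_obj[OF b(3)] b by simp
  obtain k where kk: "is_kernel C k ?d"
    and k: "is_mono C k" "k \<in> arr C" "trg C k = src C ?d" "null C (?d \<cdot> k)"
    using kernelE[OF d(1)] by metis
  have dh: "?d \<cdot> h = hdiff C (f \<cdot> (p0 \<cdot> h)) (g \<cdot> (q0 \<cdot> h))" if "h \<in> arr C" "trg C h = P" for h
    using comp_diff(2)[of "f \<cdot> p0" "g \<cdot> q0" h] b f g fg that by simp
  let ?p = "p0 \<cdot> k" and ?q = "q0 \<cdot> k"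
  have kP: "trg C k = P" using k d by simp
  have pq: "?p \<in> arr C" "?q \<in> arr C" "src C ?p = src C k" "src C ?q = src C k"
    "trg C ?p = src C f" "trg C ?q = src C g"
    using b k kP by simp_all
  have eq: "f \<cdot> ?p = g \<cdot> ?q"
    using null_diff_iff[of "f \<cdot> ?p" "g \<cdot> ?q"] dh[OF k(2) kP] k(4) b f g fg pq kP k(2) by simp
  have dec: "h = (i \<cdot> (p0 \<cdot> h)) \<oplus> (j \<cdot> (q0 \<cdot> h))" if "h \<in> arr C" "trg C h = P" for h
  proof -
    have "h = ((i \<cdot> p0) \<oplus> (j \<cdot> q0)) \<cdot> h" using b(17) that by simp
    also have "\<dots> = (i \<cdot> p0) \<cdot> h \<oplus> (j \<cdot> q0) \<cdot> h"
      using comp_add_left[of h "src C h" P "i \<cdot> p0" P "j \<cdot> q0"] that b by simp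
    finally show ?thesis using that b by simp
  qed
  have jm: "null C h" if h: "h \<in> arr C" "trg C h = src C k" "null C (?p \<cdot> h)" "null C (?q \<cdot> h)" for h
  proof -
    have kh: "k \<cdot> h \<in> arr C" "trg C (k \<cdot> h) = P" using h k kP by simp_all
    have "null C (p0 \<cdot> (k \<cdot> h))" "null C (q0 \<cdot> (k \<cdot> h))" using h k kP b by simp_all
    then have n: "null C (i \<cdot> (p0 \<cdot> (k \<cdot> h)))" "null C (j \<cdot> (q0 \<cdot> (k \<cdot> h)))"
      using kh b null_comp(1)[of "p0 \<cdot> (k \<cdot> h)" i] null_comp(1)[of "q0 \<cdot> (k \<cdot> h)" j] by simp_all
    have "k \<cdot> h = i \<cdot> (p0 \<cdot> (k \<cdot> h))"
      using dec[OF kh] add_null(1)[OF _ _ _ _ n(2), of "i \<cdot> (p0 \<cdot> (k \<cdot> h))"] b kh by simp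
    then have "null C (k \<cdot> h)" using n(1) by metis
    then show ?thesis using mono_null[OF k(1)] h by simp
  qed
  have univ: "\<exists>u. u \<in> arr C \<and> src C u = src C a \<and> trg C u = src C ?p \<and> ?p \<cdot> u = a \<and> ?q \<cdot> u = b"
      if h: "a \<in> arr C" "b \<in> arr C" "src C a = src C b" "trg C a = src C f" "trg C b = src C g"
        "f \<cdot> a = g \<cdot> b" for a b
    proof -
      let ?h = "(i \<cdot> a) \<oplus> (j \<cdot> b)"
      have hh: "?h \<in> arr C" "src C ?h = src C a" "trg C ?h = P" using \<open>i \<in> arr C\<close> b h by simp_all
      have "p0 \<cdot> ?h = p0 \<cdot> (i \<cdot> a) \<oplus> p0 \<cdot> (j \<cdot> b)"
        using comp_add_right[of "i \<cdot> a" "src C a" P "j \<cdot> b" p0 "src C f"] b(1-12) h by simp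
      moreover have "p0 \<cdot> (i \<cdot> a) = a" using assoc[of a i p0] b(1-13) h by simp
      moreover have "null C (p0 \<cdot> (j \<cdot> b))"
        using null_comp(2)[OF _ _ _ b(15), of b] b(1-12) h by simp
      ultimately have p: "p0 \<cdot> ?h = a"
        using add_null(1)[of a "p0 \<cdot> (j \<cdot> b)"] b(1-12) h by simp
      have "q0 \<cdot> ?h = q0 \<cdot> (i \<cdot> a) \<oplus> q0 \<cdot> (j \<cdot> b)"
        using comp_add_right[of "i \<cdot> a" "src C a" P "j \<cdot> b" q0 "src C g"] b(1-12) h by simp
      moreover have "q0 \<cdot> (j \<cdot> b) = b" using assoc[of b j q0] b(1-14) h by simp
      moreover have "null C (q0 \<cdot> (i \<cdot> a))"
        using null_comp(2)[OF _ _ _ b(16), of a] b(1-12) h by simp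
      ultimately have q: "q0 \<cdot> ?h = b"
        using add_null(2)[of "q0 \<cdot> (i \<cdot> a)" b] b(1-12) h by simp
      have "null C (?d \<cdot> ?h)"
        using dh[OF hh(1,3)] p q h f g null_diff_self[of "g \<cdot> b"] by simp
      then obtain u where u: "u \<in> arr C" "src C u = src C ?h" "trg C u = src C k" "k \<cdot> u = ?h"
        using kernel_lift[OF kk, of ?h] hh d by auto
      then show ?thesis
        using p q hh k kP b(1-12) by (intro exI[of _ u]) simp
    qed
  show ?thesis
  proof (rule that[of ?p ?q])
    show "is_pullback f g ?p ?q"
      unfolding is_pullback_def
    proof (intro conjI allI impI)
      fix a b
      assume "a \<in> arr C \<and> b \<in> arr C \<and> src C a = src C b \<and> trg C a = src C f \<and>
        trg C b = src C g \<and> f \<cdot> a = g \<cdot> b"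
      then show "\<exists>u. u \<in> arr C \<and> src C u = src C a \<and> trg C u = src C ?p \<and> ?p \<cdot> u = a \<and> ?q \<cdot> u = b"
        by (intro univ) simp_all
    next
      fix h
      assume "h \<in> arr C \<and> trg C h = src C ?p \<and> null C (?p \<cdot> h) \<and> null C (?q \<cdot> h)"
      then show "null C h" using jm[of h] pq by simp
    qed (use pq eq in simp_all)
    show "is_epi C ?p" if e: "is_epi C g"
    proof (rule epiI)
      fix a assume a: "a \<in> arr C" "src C a = trg C ?p" "null C (a \<cdot> ?p)"
      have dj: "?d \<cdot> j = hdiff C (f \<cdot> (p0 \<cdot> j)) g"
        using dh[of j] b g by simp
      have nf: "null C (f \<cdot> (p0 \<cdot> j))" using b f by - (rule null_comp(1); simp)
      have key: "null C (x \<cdot> g)" if x: "x \<in> arr C" "src C x = trg C g" "null C (x \<cdot> (?d \<cdot> j))" for x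
      proof -
        have "x \<cdot> (?d \<cdot> j) = hdiff C (x \<cdot> (f \<cdot> (p0 \<cdot> j))) (x \<cdot> g)"
          unfolding dj using x f g fg b by (intro comp_diff(1)) simp_all
        moreover have "null C (x \<cdot> (f \<cdot> (p0 \<cdot> j)))" using nf x f b fg by - (rule null_comp(1); simp)
        ultimately show ?thesis
          using null_diff_null[of "x \<cdot> (f \<cdot> (p0 \<cdot> j))" "x \<cdot> g"] x f g fg b by simp
      qed
      \<comment> \<open>It is already epi on the second summand.\<close>
      have "is_epi C ?d"
      proof (rule epiI[OF d(1)])
        fix x assume x: "x \<in> arr C" "src C x = trg C ?d" "null C (x \<cdot> ?d)"
        then have "null C ((x \<cdot> ?d) \<cdot> j)" using d b by - (rule null_comp(2); simp)
        then have "null C (x \<cdot> g)" using key[of x] x d b by simp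
        then show "null C x" using epi_null[OF e] x d by simp
      qed
      then have ses: "ses C k ?d"
        using kk by (rule epi_kernel_ses)
      have ap: "a \<cdot> p0 \<in> arr C" "src C (a \<cdot> p0) = P" "trg C (a \<cdot> p0) = trg C a"
        using a b pq by simp_all
      moreover have "null C ((a \<cdot> p0) \<cdot> k)" using a b pq k kP by simp
      ultimately obtain w where w: "w \<in> arr C" "src C w = trg C ?d" "trg C w = trg C (a \<cdot> p0)"
        "w \<cdot> ?d = a \<cdot> p0"
        using ses_colift[OF ses, of "a \<cdot> p0"] d by auto
      have "w \<cdot> (?d \<cdot> j) = a \<cdot> (p0 \<cdot> j)"
      proof -
        have "w \<cdot> (?d \<cdot> j) = (a \<cdot> p0) \<cdot> j"
          using comp_reduce[OF w(4) d(1) w(1,2) b(2)] d b by simp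
        then show ?thesis using a b pq by simp
      qed
      moreover have "null C (a \<cdot> (p0 \<cdot> j))" using a b pq by - (rule null_comp(1); simp)
      ultimately have "null C (w \<cdot> g)" using key[of w] w d by simp
      then have "null C w" using epi_null[OF e] w d by simp
      then have "null C (w \<cdot> ?d)" using w d by - (rule null_comp(2); simp)
      then have "null C ((a \<cdot> p0) \<cdot> i)" using w ap b by - (rule null_comp(2); simp)
      then show "null C a" using a b pq by simp
    qed (use pq in simp)
    show "is_mono C ?q" if e: "is_mono C f"
    proof (rule monoI)
      fix h assume h: "h \<in> arr C" "trg C h = src C ?q" "null C (?q \<cdot> h)"
      have "null C (g \<cdot> (?q \<cdot> h))" using h pq g by - (rule null_comp(1); simp)
      also have "g \<cdot> (?q \<cdot> h) = f \<cdot> (?p \<cdot> h)"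
        using eq h pq f g assoc[of h ?p f] assoc[of h ?q g] by simp
      finally have "null C (?p \<cdot> h)" using mono_null[OF e, of "?p \<cdot> h"] h pq by simp
      then show "null C h" using jm[of h] h pq by simp
    qed (use pq in simp)
  qed
qed

end

context abelian_linear_category
begin

text \<open>Base change of an extension: the kernel of the epimorphism embeds into the pullback because it maps
  to zero in the common target.\<close>

lemma pullback_extension:
  assumes kg: "ses C k g" and f: "f \<in> arr C" "trg C f = trg C g"
  obtains k' p q where "ses C k' p" "src C k' = src C k" "trg C p = src C f"
    "q \<in> arr C" "src C q = trg C k'" "trg C q = trg C k" "q \<cdot> k' = k" "f \<cdot> p = g \<cdot> q" "is_mono C f \<Longrightarrow> is_mono C q"
proof -
  note kgD = sesD[OF kg]
  obtain p q where pb: "is_pullback f g p q" and pe: "is_epi C g \<Longrightarrow> is_epi C p"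
    and qm: "is_mono C f \<Longrightarrow> is_mono C q"
    using pullback[OF f(1) kgD(2) f(2)] by metis
  note pq = is_pullbackD[OF pb]
  \<comment> \<open>The kernel of \<open>g\<close> enters the pullback as the pair \<open>(0, k)\<close>.\<close>
  let ?z = "hzero C (src C k) (src C f)"
  have z: "?z \<in> arr C" "src C ?z = src C k" "trg C ?z = src C f" "null C ?z"
    using kgD f by simp_all
  have "f \<cdot> ?z = g \<cdot> k"
    using null_comp(1)[of ?z f] z kgD f by - (rule null_eq; simp)
  then obtain k' where k': "k' \<in> arr C" "src C k' = src C k" "trg C k' = src C p"
    "p \<cdot> k' = ?z" "q \<cdot> k' = k"
    using is_pullback_lift[OF pb, of ?z k] z kgD by metis
  have "is_mono C k'"
    using mono_first[of k' q] k' pq kgD by simp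
  have "is_kernel C k' p"
  proof (rule kernelI)
    fix h assume h: "h \<in> arr C" "trg C h = src C p" "null C (p \<cdot> h)"
    have "null C (f \<cdot> (p \<cdot> h))" using h pq f by - (rule null_comp(1); simp)
    then have "null C (g \<cdot> (q \<cdot> h))"
      using comp_reduce[of f p "g \<cdot> q" h] assoc[of h q g] pq kgD f h by simp
    then obtain u where u: "u \<in> arr C" "src C u = src C h" "trg C u = src C k" "k \<cdot> u = q \<cdot> h"
      using ses_lift[OF kg, of "q \<cdot> h"] h pq kgD by auto
    let ?d = "hdiff C (k' \<cdot> u) h"
    have d: "?d \<in> arr C" "trg C ?d = src C p" "src C ?d = src C h" using h u k' by simp_all
    have ku: "k' \<cdot> u \<in> arr C" "src C (k' \<cdot> u) = src C h" "trg C (k' \<cdot> u) = src C p"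
      using h u k' by simp_all
    have "q \<cdot> (k' \<cdot> u) = q \<cdot> h" using comp_reduce[OF k'(5)] k' pq u by simp
    then have qd: "null C (q \<cdot> ?d)"
      using ku h pq by (intro comp_diff_null) simp_all
    have "null C (p \<cdot> (k' \<cdot> u))"
      using comp_reduce[OF k'(4), of u] null_comp(2)[OF _ _ _ z(4), of u] k' pq u z by simp
    then have pd: "null C (p \<cdot> ?d)"
      using comp_diff(1)[of "k' \<cdot> u" h p] null_diff_null[of "p \<cdot> (k' \<cdot> u)" "p \<cdot> h"] ku h pq by simp
    have "k' \<cdot> u = h"
      using is_pullback_null[OF pb d(1,2) pd qd] null_diff_iff[of "k' \<cdot> u" h] ku h by simp
    then show "\<exists>u. u \<in> arr C \<and> src C u = src C h \<and> trg C u = src C k' \<and> k' \<cdot> u = h"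
      using u k' by auto
  qed (use k' pq z \<open>is_mono C k'\<close> in simp_all)
  then have "ses C k' p"
    using pe kgD by (intro epi_kernel_ses)
  then show ?thesis using that[of k' p q] k' pq qm sesD(1,3)[OF kg] by simp
qed

lemma pushout_extension:
  assumes "ses C i q" "f \<in> arr C" "src C f = src C i"
  obtains i' q' r where "ses C i' q'" "trg C q' = trg C q" "src C i' = trg C f"
    "r \<in> arr C" "trg C r = src C q'" "src C r = src C q" "q' \<cdot> r = q" "i' \<cdot> f = r \<cdot> i"
  by (rule abelian_linear_category.pullback_extension[OF abelian_opp, of q i f]) (use assms in auto)

lemma epi_lift:
  assumes g: "is_epi C g" and f: "f \<in> arr C" "trg C f = trg C g"
  obtains p q where "is_epi C p" "p \<in> arr C" "q \<in> arr C" "trg C p = src C f" "src C p = src C q"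
    "trg C q = src C g" "f \<cdot> p = g \<cdot> q" "is_mono C f \<Longrightarrow> is_mono C q"
proof -
  obtain p q where pb: "is_pullback f g p q" and "is_epi C p" "is_mono C f \<Longrightarrow> is_mono C q"
    using pullback[OF f(1) epi_arr[OF g] f(2)] g by metis
  then show ?thesis using that[of p q] is_pullbackD[OF pb] by simp
qed

end

section \<open>Vanishing of first extension groups\<close>

text \<open>Vanishing of \<open>Ext\<^sup>1(A, B)\<close> as an extension property, to which arbitrary extensions with quotient
  \<open>A\<close> reduce by pushout. It suits long exact sequence arguments, where the kernel is not \<open>B\<close> but only
  maps to \<open>B\<close>. In the opposite category \<open>ext_vanishes (opp C) B A\<close> says that arrows from \<open>A\<close> lift
  through epimorphisms with kernel \<open>B\<close>.\<close>

definition ext_vanishes :: "('o, 'a, 'k, 'm) lincat_scheme \<Rightarrow> 'o \<Rightarrow> 'o \<Rightarrow> bool" where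
  "ext_vanishes C A B \<longleftrightarrow> (\<forall>i q f. ses C i q \<and> trg C q = A \<and> f \<in> hom C (src C i) B \<longrightarrow>
     (\<exists>g\<in>hom C (trg C i) B. cmp C g i = f))"

context abelian_linear_category
begin

lemma ext_vanishesE:
  assumes "ext_vanishes C A B" "ses C i q" "trg C q = A" "f \<in> arr C" "src C f = src C i" "trg C f = B"
  obtains g where "g \<in> arr C" "src C g = trg C i" "trg C g = B" "g \<cdot> i = f"
  using assms unfolding ext_vanishes_def Bex_def hom_iff by metis

lemma ext_vanishesI:
  assumes "\<And>i q f. ses C i q \<Longrightarrow> trg C q = A \<Longrightarrow> f \<in> arr C \<Longrightarrow> src C f = src C i \<Longrightarrow> trg C f = B \<Longrightarrow>
    \<exists>g. g \<in> arr C \<and> src C g = trg C i \<and> trg C g = B \<and> g \<cdot> i = f"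
  shows "ext_vanishes C A B"
  using assms unfolding ext_vanishes_def Bex_def hom_iff by blast

lemma ext_vanishes_if_split:
  assumes "\<And>i q. ses C i q \<Longrightarrow> src C i = B \<Longrightarrow> trg C q = A \<Longrightarrow>
    \<exists>r\<in>hom C (trg C i) B. r \<cdot> i = \<one> B"
  shows "ext_vanishes C A B"
proof (rule ext_vanishesI)
  fix i q f assume s: "ses C i q" "trg C q = A" and f: "f \<in> arr C" "src C f = src C i" "trg C f = B"
  obtain i' q' r where e: "ses C i' q'" "trg C q' = trg C q" "src C i' = trg C f"
    "r \<in> arr C" "trg C r = src C q'" "src C r = src C q" "q' \<cdot> r = q" "i' \<cdot> f = r \<cdot> i"
    using pushout_extension[OF s(1) f(1,2)] by metis
  note sD = sesD[OF s(1)] and eD = sesD[OF e(1)]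
  obtain s where s: "s \<in> hom C (trg C i') B" "s \<cdot> i' = \<one> B"
    using assms[OF e(1)] e s f by auto
  have "s \<cdot> (r \<cdot> i) = f"
    using comp_reduce[OF s(2), of f] s e sD eD f by simp
  then show "\<exists>g. g \<in> arr C \<and> src C g = trg C i \<and> trg C g = B \<and> g \<cdot> i = f"
    using s e sD eD by (intro exI[of _ "s \<cdot> r"]) simp
qed

lemma retraction_of_section:
  assumes e: "ses C i q" and s: "s \<in> arr C" "src C s = trg C q" "trg C s = src C q" "q \<cdot> s = \<one> (trg C q)"
  shows "\<exists>r\<in>hom C (trg C i) (src C i). r \<cdot> i = \<one> (src C i)"
proof -
  note eD = sesD[OF e]
  let ?Y = "trg C i"
  \<comment> \<open>The complementary idempotent \<open>1 - s q\<close>.\<close>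
  let ?d = "hdiff C (\<one> ?Y) (s \<cdot> q)"
  have d: "?d \<in> arr C" "src C ?d = ?Y" "trg C ?d = ?Y" using eD s by simp_all
  have "q \<cdot> (s \<cdot> q) = q" using comp_reduce[OF s(4), of q] eD s by simp
  then have "null C (q \<cdot> ?d)"
    using eD s(1-3) by (intro comp_diff_null) simp_all
  then obtain r where r: "r \<in> arr C" "src C r = ?Y" "trg C r = src C i" "i \<cdot> r = ?d"
    using ses_lift[OF e, of ?d] d by auto
  have "null C (s \<cdot> (q \<cdot> i))" using eD s by - (rule null_comp(1); simp)
  then have "?d \<cdot> i = i"
    using diff_comp_eq[of "\<one> ?Y" "s \<cdot> q" i] eD(1-3) s(1-3) by simp
  then have "i \<cdot> (r \<cdot> i) = i \<cdot> \<one> (src C i)"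
    using comp_reduce[OF r(4), of i] r eD by simp
  then have "r \<cdot> i = \<one> (src C i)"
    using r eD by - (rule mono_cancel[of i]; simp)
  then show ?thesis using r by (intro bexI[of _ r]) simp_all
qed

lemma Ext1_zero_split:
  assumes E: "Ext1 C A B = {Ext1_zero C A B}" and e: "ses C i q" "src C i = B" "trg C q = A"
  shows "\<exists>s\<in>hom C A (src C q). q \<cdot> s = \<one> A"
proof -
  have x: "(i, q) \<in> extensions C A B" using e by (simp add: extensions_def ses_def)
  have "((i, q), (i, q)) \<in> extension_equiv C A B"
    unfolding extension_equiv_def using x sesD[OF e(1)] by (auto intro!: bexI[of _ "\<one> (trg C i)"])
  then have "(i, q) \<in> extension_equiv C A B `` {(i, q)}" by blast
  have "extension_equiv C A B `` {(i, q)} \<in> Ext1 C A B"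
    unfolding Ext1_def using x by (rule quotientI)
  then have eq: "extension_equiv C A B `` {(i, q)} = Ext1_zero C A B" using E by blast
  have "(i, q) \<in> Ext1_zero C A B" unfolding eq[symmetric] by fact
  then show ?thesis by (simp add: Ext1_zero_def del: hom_iff)
qed

lemma ext_vanishes_of_Ext1:
  assumes E: "Ext1 C A B = {Ext1_zero C A B}"
  shows "ext_vanishes C A B"
proof (rule ext_vanishes_if_split)
  fix i q assume e: "ses C i q" "src C i = B" "trg C q = A"
  obtain s where "s \<in> hom C A (src C q)" "q \<cdot> s = \<one> A"
    using Ext1_zero_split[OF E e] by blast
  then show "\<exists>r\<in>hom C (trg C i) B. r \<cdot> i = \<one> B"
    using retraction_of_section[OF e(1), of s] e by simp
qed

lemma ext_vanishes_opp_of_Ext1: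
  assumes E: "Ext1 C A B = {Ext1_zero C A B}"
  shows "ext_vanishes (opp C) B A"
proof (rule abelian_linear_category.ext_vanishes_if_split[OF abelian_opp])
  fix i q assume e: "ses (opp C) i q" "src (opp C) i = A" "trg (opp C) q = B"
  then show "\<exists>r\<in>hom (opp C) (trg (opp C) i) A. cmp (opp C) r i = idt (opp C) A"
    using Ext1_zero_split[OF E, of q i] by simp
qed

lemma ext_vanishes_zero:
  assumes "zero_obj C A"
  shows "ext_vanishes C A B"
proof (rule ext_vanishesI)
  fix i q f assume s: "ses C i q" "trg C q = A" and f: "f \<in> arr C" "src C f = src C i" "trg C f = B"
  note sD = sesD[OF s(1)]
  have "null C q" using null_of_zero_obj[of q] sD s assms by simp
  then have "null C (q \<cdot> \<one> (trg C i))" using sD by simp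
  then obtain u where u: "u \<in> arr C" "src C u = trg C i" "trg C u = src C i" "i \<cdot> u = \<one> (trg C i)"
    using ses_lift[OF s(1), of "\<one> (trg C i)"] sD by auto
  have "i \<cdot> (u \<cdot> i) = i \<cdot> \<one> (src C i)" using comp_reduce[OF u(4), of i] u sD by simp
  then have "u \<cdot> i = \<one> (src C i)" using u sD by - (rule mono_cancel[of i]; simp)
  then show "\<exists>g. g \<in> arr C \<and> src C g = trg C i \<and> trg C g = B \<and> g \<cdot> i = f"
    using u f sD by (intro exI[of _ "f \<cdot> u"]) simp
qed

text \<open>The preimage of \<open>src C i\<close> under the epimorphism \<open>b\<close>: it contains the kernel of \<open>b\<close> with quotient
  \<open>src C i\<close>, and it is the kernel of the composite to \<open>trg C q\<close>. Every argument that inserts an object into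
  a filtration rests on this.\<close>

lemma ses_preimage:
  assumes e: "ses C i q" and s: "ses C a b" "trg C b = trg C i"
  obtains k a' c where "ses C k (q \<cdot> b)" "ses C a' c" "src C a' = src C a" "trg C a' = src C k"
    "trg C c = src C i" "k \<cdot> a' = a" "i \<cdot> c = b \<cdot> k" "trg C k = trg C a"
proof -
  note eD = sesD[OF e] and sD = sesD[OF s(1)]
  have "is_epi C (q \<cdot> b)" using eD sD s by (intro epi_comp) simp_all
  then obtain k where k: "ses C k (q \<cdot> b)" using epi_ses by blast
  note kD = sesD[OF k]
  have "null C (q \<cdot> (b \<cdot> a))" using eD sD s by - (rule null_comp(1); simp)
  then obtain a' where a': "a' \<in> arr C" "src C a' = src C a" "trg C a' = src C k" "k \<cdot> a' = a"
    using ses_lift[OF k, of a] eD sD s kD by auto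
  have "null C (q \<cdot> (b \<cdot> k))" using kD eD sD s by simp
  then obtain c where c: "c \<in> arr C" "src C c = src C k" "trg C c = src C i" "i \<cdot> c = b \<cdot> k"
    using ses_lift[OF e, of "b \<cdot> k"] eD sD s kD by auto
  have a'c: "is_kernel C a' c"
  proof (rule kernelI)
    show "is_mono C a'" using mono_first[of a' k] a' kD sD by simp
    have "null C ((b \<cdot> k) \<cdot> a')" using a' kD eD sD s by simp
    then have "null C (i \<cdot> (c \<cdot> a'))" using comp_reduce[OF c(4), of a'] a' c eD by simp
    then show "null C (c \<cdot> a')" using mono_null[of i "c \<cdot> a'"] eD c a' by simp
    fix h assume h: "h \<in> arr C" "trg C h = src C c" "null C (c \<cdot> h)"
    have "null C (i \<cdot> (c \<cdot> h))" using h c eD by - (rule null_comp(1); simp)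
    then have "null C (b \<cdot> (k \<cdot> h))" using comp_reduce[OF c(4), of h] h c eD kD sD s by simp
    then obtain v where v: "v \<in> arr C" "src C v = src C h" "trg C v = src C a" "a \<cdot> v = k \<cdot> h"
      using ses_lift[OF s(1), of "k \<cdot> h"] h c kD sD eD s by auto
    have "k \<cdot> (a' \<cdot> v) = k \<cdot> h" using comp_reduce[OF a'(4), of v] v a' kD by simp
    then have "a' \<cdot> v = h" using v h c a' kD by - (rule mono_cancel[of k]; simp)
    then show "\<exists>u. u \<in> arr C \<and> src C u = src C h \<and> trg C u = src C a' \<and> a' \<cdot> u = h"
      using v a' by auto
  qed (use c a' in simp_all)
  have "is_epi C c"
  proof -
    obtain r1 r2 where r: "is_epi C r1" "r1 \<in> arr C" "r2 \<in> arr C" "trg C r1 = src C i"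
      "src C r1 = src C r2" "trg C r2 = src C b" "i \<cdot> r1 = b \<cdot> r2"
      using epi_lift[of b i] sD eD s by metis
    have "null C ((q \<cdot> i) \<cdot> r1)" using eD r by - (rule null_comp(2); simp)
    then have "null C ((q \<cdot> b) \<cdot> r2)" using r eD sD s by simp
    then obtain r3 where r3: "r3 \<in> arr C" "src C r3 = src C r2" "trg C r3 = src C k" "k \<cdot> r3 = r2"
      using ses_lift[OF k, of r2] r eD sD s kD by auto
    have "i \<cdot> (c \<cdot> r3) = i \<cdot> r1" using comp_reduce[OF c(4), of r3] c r3 eD kD sD s r by simp
    then have "c \<cdot> r3 = r1" using c r3 eD r by - (rule mono_cancel[of i]; simp)
    then show ?thesis using epi_second[of r3 c] r c r3 by simp
  qed
  then have ac: "ses C a' c" using a'c by (rule epi_kernel_ses)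
  then show ?thesis using that[OF k ac] a' c kD eD sD s by simp
qed

text \<open>Extend first to the preimage of the subobject \<open>src C i\<close>, then from there to the whole object.\<close>

lemma ext_vanishes_extension:
  assumes e: "ses C i q" and A: "ext_vanishes C (src C i) N" and B: "ext_vanishes C (trg C q) N"
  shows "ext_vanishes C (trg C i) N"
proof (rule ext_vanishesI)
  fix a b f assume s: "ses C a b" "trg C b = trg C i"
    and f: "f \<in> arr C" "src C f = src C a" "trg C f = N"
  note eD = sesD[OF e] and sD = sesD[OF s(1)]
  obtain k a' c where k: "ses C k (q \<cdot> b)" and ac: "ses C a' c" and a': "src C a' = src C a"
    "trg C a' = src C k" "trg C c = src C i" "k \<cdot> a' = a" and "i \<cdot> c = b \<cdot> k" and kt: "trg C k = trg C a"
    using ses_preimage[OF e s] by metis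
  note kD = sesD[OF k] and acD = sesD[OF ac]
  obtain g where g: "g \<in> arr C" "src C g = trg C a'" "trg C g = N" "g \<cdot> a' = f"
    using ext_vanishesE[OF A ac, of f] f a' by metis
  obtain g' where g': "g' \<in> arr C" "src C g' = trg C k" "trg C g' = N" "g' \<cdot> k = g"
    using ext_vanishesE[OF B k, of g] g a' eD sD s by auto
  have "g' \<cdot> a = f" using comp_reduce[OF g'(4), of a'] a' g g' kD acD by simp
  then show "\<exists>g. g \<in> arr C \<and> src C g = trg C a \<and> trg C g = N \<and> g \<cdot> a = f"
    using g' kt by (intro exI[of _ g']) simp
qed

text \<open>This is exactness of \<open>Hom(D, N) \<rightarrow> Hom(D, V) \<rightarrow> Ext\<^sup>1(D, ker f) \<rightarrow> Ext\<^sup>1(D, N)\<close>. An arrow into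
  the kernel extends as an arrow \<open>a\<close> into \<open>N\<close>; the composite \<open>f a\<close> factors through \<open>D\<close>, and subtraction of
  a lift of it moves \<open>a\<close> into the kernel.\<close>

lemma ext_vanishes_kernel:
  assumes N: "ext_vanishes C D (src C f)" and k: "is_kernel C k f"
    and lift: "\<And>g. g \<in> hom C D (trg C f) \<Longrightarrow> \<exists>h\<in>hom C D (src C f). f \<cdot> h = g"
  shows "ext_vanishes C D (src C k)"
proof (rule ext_vanishesI)
  fix i q u assume s: "ses C i q" "trg C q = D"
    and u: "u \<in> arr C" "src C u = src C i" "trg C u = src C k"
  note sD = sesD[OF s(1)] and kD = kernelD[OF k]
  obtain a where a: "a \<in> arr C" "src C a = trg C i" "trg C a = src C f" "a \<cdot> i = k \<cdot> u"
    using ext_vanishesE[OF N s, of "k \<cdot> u"] u kD by auto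
  have "null C ((f \<cdot> k) \<cdot> u)" using u kD by - (rule null_comp(2); simp)
  then have "null C ((f \<cdot> a) \<cdot> i)" using a u kD sD by simp
  then obtain b where b: "b \<in> arr C" "src C b = trg C q" "trg C b = trg C f" "b \<cdot> q = f \<cdot> a"
    using ses_colift[OF s(1), of "f \<cdot> a"] a kD sD by auto
  obtain c where c: "c \<in> arr C" "src C c = D" "trg C c = src C f" "f \<cdot> c = b"
    using lift[of b] b s by auto
  let ?d = "hdiff C a (c \<cdot> q)"
  have d: "?d \<in> arr C" "src C ?d = trg C i" "trg C ?d = src C f" using a c s sD by simp_all
  have "f \<cdot> (c \<cdot> q) = f \<cdot> a" using comp_reduce[OF c(4), of q] b c s sD kD by simp
  then have "null C (f \<cdot> ?d)"
    using a(1-3) c(1-3) s sD kD by (intro comp_diff_null) simp_all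
  then obtain g where g: "g \<in> arr C" "src C g = src C ?d" "trg C g = src C k" "k \<cdot> g = ?d"
    using kernel_lift[OF k, of ?d] d by auto
  have "null C (c \<cdot> (q \<cdot> i))" using c s sD by - (rule null_comp(1); simp)
  then have "?d \<cdot> i = k \<cdot> u"
    unfolding a(4)[symmetric] using a(1-3) c(1-3) s sD by - (rule diff_comp_eq; simp)
  then have "k \<cdot> (g \<cdot> i) = k \<cdot> u" using comp_reduce[OF g(4), of i] g d kD sD by simp
  then have "g \<cdot> i = u" using g d u kD sD by - (rule mono_cancel[of k]; simp)
  then show "\<exists>g. g \<in> arr C \<and> src C g = trg C i \<and> trg C g = src C k \<and> g \<cdot> i = u"
    using g d by (intro exI[of _ g]) simp
qed

end

text \<open>Finite filtrations with quotients in \<open>R\<close>. The rule adds a subobject in \<open>R\<close> at the bottom; read in the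
  opposite category, it adds a quotient in \<open>R\<close> at the top. This
  gives the \<open>\<Delta>\<close>-filtered objects in \<open>C\<close> and the \<open>\<nabla>\<close>-filtered objects in \<open>opp C\<close>.\<close>

inductive filtered_by :: "('o, 'a, 'k, 'm) lincat_scheme \<Rightarrow> 'o set \<Rightarrow> 'o \<Rightarrow> bool"
  for C :: "('o, 'a, 'k, 'm) lincat_scheme" and R :: "'o set" where
  zero: "zero_obj C P \<Longrightarrow> filtered_by C R P"
| ext: "filtered_by C R (trg C q) \<Longrightarrow> ses C i q \<Longrightarrow> src C i \<in> R \<Longrightarrow> filtered_by C R (trg C i)"

context abelian_linear_category
begin

text \<open>A map from a filtered object is lifted on the bottom piece, the lift is extended to the whole object
  because \<open>Ext\<^sup>1\<close> vanishes on the quotient, and the error factors through the quotient, where induction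
  applies.\<close>

lemma filtered_by_lift:
  assumes P: "filtered_by C R P"
    and N: "\<And>D. D \<in> R \<Longrightarrow> ext_vanishes C D (src C f)"
    and f: "f \<in> arr C"
    and lift: "\<And>D g. D \<in> R \<Longrightarrow> g \<in> hom C D (trg C f) \<Longrightarrow> \<exists>h\<in>hom C D (src C f). f \<cdot> h = g"
  shows "ext_vanishes C P (src C f)"
    and "\<And>g. g \<in> hom C P (trg C f) \<Longrightarrow> \<exists>h\<in>hom C P (src C f). f \<cdot> h = g"
proof -
  have "ext_vanishes C P (src C f) \<and>
    (\<forall>g\<in>hom C P (trg C f). \<exists>h\<in>hom C P (src C f). f \<cdot> h = g)"
    using P
  proof induction
    case (zero P)
    have "\<exists>h\<in>hom C P (src C f). f \<cdot> h = g" if g: "g \<in> hom C P (trg C f)" for g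
    proof (rule bexI)
      let ?z = "hzero C P (src C f)"
      have Z: "P \<in> obj C" using zero by (simp add: zero_obj_iff_null)
      show z: "?z \<in> hom C P (src C f)" using Z f by simp
      have "null C g" "null C (f \<cdot> ?z)"
        using null_of_zero_obj[of g] null_of_zero_obj[of "f \<cdot> ?z"] zero g z f by simp_all
      then show "f \<cdot> ?z = g" using g z f by - (rule null_eq; simp)
    qed
    then show ?case using ext_vanishes_zero[OF zero] by blast
  next
    case (ext q i)
    note eD = sesD[OF ext(2)]
    have "\<exists>h\<in>hom C (trg C i) (src C f). f \<cdot> h = g" if g: "g \<in> hom C (trg C i) (trg C f)" for g
    proof -
      obtain h where h: "h \<in> arr C" "src C h = src C i" "trg C h = src C f" "f \<cdot> h = g \<cdot> i"
        using lift[OF ext(3), of "g \<cdot> i"] g eD by auto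
      obtain h' where h': "h' \<in> arr C" "src C h' = trg C i" "trg C h' = src C f" "h' \<cdot> i = h"
        using ext_vanishesE[OF _ ext(2) refl, of "src C f" h] ext h by metis
      let ?d = "hdiff C g (f \<cdot> h')"
      have d: "?d \<in> arr C" "src C ?d = trg C i" "trg C ?d = trg C f" using g h' f by simp_all
      have "null C (?d \<cdot> i)"
        using g h h' f eD by (intro diff_comp_null) simp_all
      then obtain w where w: "w \<in> arr C" "src C w = trg C q" "trg C w = trg C f" "w \<cdot> q = ?d"
        using ses_colift[OF ext(2), of ?d] d eD by auto
      then obtain v where v: "v \<in> arr C" "src C v = trg C q" "trg C v = src C f" "f \<cdot> v = w"
        using conjunct2[OF ext(4)] unfolding Ball_def Bex_def hom_iff by blast
      have vq: "v \<cdot> q \<in> arr C" "src C (v \<cdot> q) = trg C i" "trg C (v \<cdot> q) = src C f"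
        using v eD by simp_all
      have fvq: "f \<cdot> (v \<cdot> q) = ?d" using comp_reduce[OF v(4), of q] v w f eD by simp
      have "f \<cdot> ((v \<cdot> q) \<oplus> h') = f \<cdot> (v \<cdot> q) \<oplus> f \<cdot> h'"
        using comp_add_right[of "v \<cdot> q" "trg C i" "src C f" h' f "trg C f"] vq h' f by simp
      also have "\<dots> = ?d \<oplus> f \<cdot> h'" by (simp only: fvq)
      also have "\<dots> = g"
      proof -
        let ?X = "trg C i" and ?Y = "trg C f"
        let ?a = "f \<cdot> h'"
        have a: "?a \<in> arr C" "src C ?a = ?X" "trg C ?a = ?Y" using h' f by simp_all
        have n: "null C (?a \<oplus> hscale C (- 1) ?a)" using null_diff_self[OF a(1)] by (simp add: hdiff_def)
        have "?d \<oplus> ?a = g \<oplus> (hscale C (- 1) ?a \<oplus> ?a)"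
          using add_assoc[of g ?X ?Y "hscale C (- 1) ?a" ?a] g a by (simp add: hdiff_def)
        also have "\<dots> = g"
          using add_commute[of ?a ?X ?Y "hscale C (- 1) ?a"] add_null(1)[OF _ _ _ _ n, of g] a g by simp
        finally show ?thesis .
      qed
      finally show ?thesis using vq h' by (intro bexI[of _ "(v \<cdot> q) \<oplus> h'"]) simp_all
    qed
    then show ?case
      using ext_vanishes_extension[OF ext(2)] N ext by blast
  qed
  then show "ext_vanishes C P (src C f)"
    "\<And>g. g \<in> hom C P (trg C f) \<Longrightarrow> \<exists>h\<in>hom C P (src C f). f \<cdot> h = g" by blast+
qed

end

section \<open>Composition factors\<close>

text \<open>\<open>S\<close> is a subquotient of \<open>X\<close>. For simple \<open>S\<close> this means nonzero multiplicity, but the condition passes to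
  subobjects, quotients and the opposite category directly.\<close>

definition has_factor :: "('o, 'a, 'k, 'm) lincat_scheme \<Rightarrow> 'o \<Rightarrow> 'o \<Rightarrow> bool" where
  "has_factor C X S \<longleftrightarrow> (\<exists>m e. is_mono C m \<and> is_epi C e \<and> trg C m = X \<and> src C m = src C e \<and> trg C e = S)"

context abelian_linear_category
begin

text \<open>A quotient of a subobject is a subobject of a quotient, by pushout.\<close>

lemma has_factor_opp_imp:
  assumes "has_factor C X S"
  shows "has_factor (opp C) X S"
proof -
  obtain m e where m: "is_mono C m" "is_epi C e" "trg C m = X" "src C m = src C e" "trg C e = S"
    using assms by (auto simp: has_factor_def)
  obtain p q where "is_mono C p" "p \<in> arr C" "q \<in> arr C" "src C p = trg C e" "trg C p = trg C q"
    "src C q = trg C m" "is_epi C e \<Longrightarrow> is_epi C q"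
    by (rule abelian_linear_category.epi_lift[OF abelian_opp, of m e])
      (use m epi_arr[of e] in auto)
  then show ?thesis
    unfolding has_factor_def using m by (intro exI[of _ q] exI[of _ p]) simp
qed

lemma has_factor_opp [simp]: "has_factor (opp C) X S \<longleftrightarrow> has_factor C X S"
  using has_factor_opp_imp abelian_linear_category.has_factor_opp_imp[OF abelian_opp, of X S] by auto

lemma has_factor_sub:
  assumes "is_mono C n" "has_factor C (src C n) S"
  shows "has_factor C (trg C n) S"
proof -
  obtain m e where m: "is_mono C m" "is_epi C e" "trg C m = src C n" "src C m = src C e" "trg C e = S"
    using assms by (auto simp: has_factor_def)
  then show ?thesis
    unfolding has_factor_def using assms(1) mono_comp[of m n] mono_arr[of m] mono_arr[of n]
    by (intro exI[of _ "n \<cdot> m"] exI[of _ e]) simp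
qed

lemma has_factor_quotient:
  assumes "is_epi C q" "has_factor C (trg C q) S"
  shows "has_factor C (src C q) S"
  using abelian_linear_category.has_factor_sub[OF abelian_opp, of q S] assms by simp

lemma has_factor_self: "X \<in> obj C \<Longrightarrow> has_factor C X X"
  unfolding has_factor_def using iso_mono_epi[OF id_iso[of X]]
  by (intro exI[of _ "\<one> X"]) simp

lemma has_factor_of_epi: "is_epi C q \<Longrightarrow> has_factor C (src C q) (trg C q)"
  using has_factor_quotient[of q] has_factor_self[of "trg C q"] epi_arr[of q] by simp

lemma has_factor_of_mono: "is_mono C m \<Longrightarrow> has_factor C (trg C m) (src C m)"
  using has_factor_sub[of m] has_factor_self[of "src C m"] mono_arr[of m] by simp

lemma simple_obj [simp]: "simple_obj C S \<Longrightarrow> S \<in> obj C"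
  by (simp add: simple_obj_def)

lemma simple_epi:
  assumes S: "simple_obj C (trg C f)" and f: "f \<in> arr C" "\<not> null C f"
  shows "is_epi C f"
proof -
  obtain m e where m: "is_mono C m" "is_epi C e" "m \<in> arr C" "e \<in> arr C" "trg C m = trg C f"
    "src C e = src C f" "src C m = trg C e" "m \<cdot> e = f"
    using image[OF f(1)] by metis
  have "\<not> null C m" using nonzero_image[of m e] m f by simp
  then have "\<not> zero_obj C (src C m)" using mono_null_src m by blast
  then have "is_iso C m" using S m by (auto simp: simple_obj_def subobj_def)
  then show ?thesis using iso_mono_epi(2) epi_comp[of e m] m by simp
qed

lemma simple_mono:
  assumes S: "simple_obj C (src C f)" and f: "f \<in> arr C" "\<not> null C f"
  shows "is_mono C f"
proof -
  obtain k where kk: "is_kernel C k f"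
    and k: "is_mono C k" "k \<in> arr C" "trg C k = src C f" "null C (f \<cdot> k)"
    using kernelE[OF f(1)] by metis
  have "\<not> is_epi C k" using epi_null[of k f] k f by auto
  then have "\<not> is_iso C k" using iso_mono_epi by blast
  then have "zero_obj C (src C k)" using S k by (auto simp: simple_obj_def subobj_def)
  then have kn: "null C k" using mono_null_src k by blast
  show ?thesis
  proof (rule monoI[OF f(1)])
    fix h assume h: "h \<in> arr C" "trg C h = src C f" "null C (f \<cdot> h)"
    obtain u where u: "u \<in> arr C" "src C u = src C h" "trg C u = src C k" "k \<cdot> u = h"
      using kernel_lift[OF kk h] by auto
    have "null C (k \<cdot> u)" using kn u k by - (rule null_comp(2); simp)
    then show "null C h" using u by simp
  qed
qed

lemma simple_nonzero_iso:
  assumes "simple_obj C (src C f)" "simple_obj C (trg C f)" "f \<in> arr C" "\<not> null C f"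
  shows "is_iso C f"
  using assms simple_mono simple_epi mono_epi_iso by blast

lemma simple_epi_nonzero: "simple_obj C (trg C f) \<Longrightarrow> is_epi C f \<Longrightarrow> \<not> null C f"
  using epi_null_trg[of f] by (auto simp: simple_obj_def)

lemma simple_mono_nonzero: "simple_obj C (src C f) \<Longrightarrow> is_mono C f \<Longrightarrow> \<not> null C f"
  using mono_null_src[of f] by (auto simp: simple_obj_def)

lemma isomorphicI: "is_iso C f \<Longrightarrow> isomorphic C (src C f) (trg C f)"
  unfolding isomorphic_def using iso_arr[of f] by (intro bexI[of _ f]) simp_all

lemma isomorphicE:
  assumes "isomorphic C X Y"
  obtains f where "is_iso C f" "f \<in> arr C" "src C f = X" "trg C f = Y"
  using assms by (auto simp: isomorphic_def)

lemma isomorphic_sym: "isomorphic C X Y \<Longrightarrow> isomorphic C Y X"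
  by (metis isomorphicE isomorphicI isoE)

lemma iso_comp:
  assumes "is_iso C f" "is_iso C g" "src C g = trg C f"
  shows "is_iso C (g \<cdot> f)"
  using assms mono_epi_iso[of "g \<cdot> f"] mono_comp epi_comp iso_mono_epi by blast

lemma isomorphic_trans: "isomorphic C X Y \<Longrightarrow> isomorphic C Y Z \<Longrightarrow> isomorphic C X Z"
  using iso_comp isomorphicI by (metis isomorphicE comp_arr(2,3))

lemma has_factor_iso_left: "isomorphic C X Y \<Longrightarrow> has_factor C X S \<Longrightarrow> has_factor C Y S"
  using has_factor_sub iso_mono_epi by (metis isomorphicE)

lemma has_factor_iso_right:
  assumes "isomorphic C S S'" "has_factor C X S"
  shows "has_factor C X S'"
proof -
  obtain f where f: "is_iso C f" "f \<in> arr C" "src C f = S" "trg C f = S'"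
    using assms isomorphicE by metis
  obtain m e where m: "is_mono C m" "is_epi C e" "trg C m = X" "src C m = src C e" "trg C e = S"
    using assms by (auto simp: has_factor_def)
  then show ?thesis
    unfolding has_factor_def using epi_comp[of e f] f iso_mono_epi(2)[of f] epi_arr[of e]
    by (intro exI[of _ m] exI[of _ "f \<cdot> e"]) simp
qed

lemma has_factor_simple:
  assumes "simple_obj C S" "simple_obj C S'" "has_factor C S S'"
  shows "isomorphic C S S'"
proof -
  obtain m e where m: "is_mono C m" "is_epi C e" "trg C m = S" "src C m = src C e" "trg C e = S'"
    using assms by (auto simp: has_factor_def)
  note a = mono_arr[OF m(1)] epi_arr[OF m(2)]
  have "\<not> null C e" using simple_epi_nonzero m assms by metis
  then have "\<not> zero_obj C (src C m)" using null_of_zero_obj[of e] a m by auto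
  then have "is_iso C m" using m assms(1) by (auto simp: simple_obj_def subobj_def)
  then obtain n where n: "n \<in> arr C" "src C n = S" "trg C n = src C m" "is_iso C n"
    using isoE[of m] m by metis
  then have "is_epi C (e \<cdot> n)" using m iso_mono_epi by (intro epi_comp) auto
  then have "\<not> null C (e \<cdot> n)" using simple_epi_nonzero[of "e \<cdot> n"] m n a assms by simp
  then have "is_iso C (e \<cdot> n)" using simple_nonzero_iso[of "e \<cdot> n"] m n a assms by simp
  then show ?thesis using isomorphicI[of "e \<cdot> n"] n m a by simp
qed

end

section \<open>Objects of finite length\<close>

lemma comp_seriesD:
  assumes "comp_series C X n F"
  shows "i \<le> n \<Longrightarrow> subobj C X (F i)" "zero_obj C (src C (F 0))" "is_iso C (F n)"
    "i < n \<Longrightarrow> \<exists>S. simple_obj C S \<and> is_quotient C (F i) (F (Suc i)) S"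
  using assms unfolding comp_series_def by blast+

text \<open>\<open>X\<close> has a composition series in which at least \<open>n\<close> of the factors are \<open>S\<close>: since \<open>step\<close> may also add
  a copy of \<open>S\<close>, the number is a lower bound. In particular \<open>series C S 0 X\<close> says that \<open>X\<close> has finite
  length, for whichever \<open>S\<close>. Lower bounds are additive in extensions; this makes it possible to
  bound the length of a filtration by multiplicities.\<close>

inductive series :: "('o, 'a, 'k, 'm) lincat_scheme \<Rightarrow> 'o \<Rightarrow> nat \<Rightarrow> 'o \<Rightarrow> bool"
  for C :: "('o, 'a, 'k, 'm) lincat_scheme" and S :: 'o where
  zero: "zero_obj C Z \<Longrightarrow> series C S 0 Z"
| step: "series C S n (src C i) \<Longrightarrow> ses C i q \<Longrightarrow> simple_obj C (trg C q) \<Longrightarrow> series C S n (trg C i)"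
| hit: "series C S n (src C i) \<Longrightarrow> ses C i q \<Longrightarrow> simple_obj C (trg C q) \<Longrightarrow> trg C q = S \<Longrightarrow>
    series C S (Suc n) (trg C i)"

lemma series_zero: "series C S n X \<Longrightarrow> series C S' 0 X"
  by (induction rule: series.induct) (auto intro: series.intros)

context abelian_linear_category
begin

lemma ses_null_iso:
  assumes "ses C i q" "null C q"
  shows "is_iso C i"
proof -
  note D = sesD[OF assms(1)]
  have "is_epi C i"
  proof (rule epiI)
    fix h assume h: "h \<in> arr C" "src C h = trg C i" "null C (h \<cdot> i)"
    then obtain u where u: "u \<in> arr C" "src C u = trg C q" "trg C u = trg C h" "u \<cdot> q = h"
      using ses_colift[OF assms(1), of h] D by metis
    have "null C (u \<cdot> q)" using u D assms by - (rule null_comp(1); simp)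
    then show "null C h" using u by simp
  qed (use D in simp)
  then show ?thesis using D mono_epi_iso by blast
qed

lemma iso_ses:
  assumes f: "is_iso C f" and e: "ses C i q" "trg C i = src C f"
  obtains q' where "ses C (f \<cdot> i) q'" "trg C q' = trg C q"
proof -
  note D = sesD[OF e(1)] and fa = iso_arr[OF f]
  obtain g where g: "g \<in> arr C" "src C g = trg C f" "trg C g = src C f"
    "g \<cdot> f = \<one> (src C f)" "f \<cdot> g = \<one> (trg C f)" "is_iso C g"
    using isoE[OF f] by metis
  have gfi: "g \<cdot> (f \<cdot> i) = i" using comp_reduce[OF g(4), of i] D fa g e by simp
  have "is_mono C (f \<cdot> i)" using mono_comp[of i f] iso_mono_epi(1)[OF f] D e by simp
  moreover have "is_cokernel C (q \<cdot> g) (f \<cdot> i)"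
  proof (rule cokernelI)
    show "null C ((q \<cdot> g) \<cdot> (f \<cdot> i))" using gfi D g e fa by simp
    show "is_epi C (q \<cdot> g)" using epi_comp[of g q] iso_mono_epi(2)[OF g(6)] D g e by simp
    fix h assume h: "h \<in> arr C" "src C h = trg C (f \<cdot> i)" "null C (h \<cdot> (f \<cdot> i))"
    then have hs: "src C h = trg C f" using D fa e by simp
    obtain u where u: "u \<in> arr C" "src C u = trg C q" "trg C u = trg C (h \<cdot> f)" "u \<cdot> q = h \<cdot> f"
      using ses_colift[OF e(1), of "h \<cdot> f"] h D fa e by auto
    have "u \<cdot> (q \<cdot> g) = (h \<cdot> f) \<cdot> g" using comp_reduce[OF u(4), of g] u D g e by simp
    also have "\<dots> = h" using h hs fa g by simp
    finally show "\<exists>u. u \<in> arr C \<and> trg C u = trg C h \<and> src C u = trg C (q \<cdot> g) \<and> u \<cdot> (q \<cdot> g) = h"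
      using u D g e fa hs h by (intro exI[of _ u]) simp
  qed (use D g e fa in simp_all)
  ultimately have "ses C (f \<cdot> i) (q \<cdot> g)" by (rule mono_cokernel_ses)
  then show ?thesis using that[of "q \<cdot> g"] D g e by simp
qed

lemma zero_obj_iso:
  assumes "zero_obj C X" "isomorphic C X Y"
  shows "zero_obj C Y"
proof -
  obtain f where f: "is_iso C f" "f \<in> arr C" "src C f = X" "trg C f = Y"
    using assms isomorphicE by metis
  then have "null C f" using null_of_zero_obj assms by blast
  then show ?thesis using epi_null_trg[of f] f iso_mono_epi by auto
qed

lemma series_iso:
  assumes "series C S n X" "isomorphic C X Y"
  shows "series C S n Y"
proof -
  obtain f where f: "is_iso C f" "f \<in> arr C" "src C f = X" "trg C f = Y"
    using assms isomorphicE by metis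
  show ?thesis
    using assms(1)
  proof cases
    case zero
    then show ?thesis using series.zero[OF zero_obj_iso[of X Y], of S] assms(2) by simp
  next
    case (step i q)
    then obtain q' where q': "ses C (f \<cdot> i) q'" "trg C q' = trg C q" using iso_ses[OF f(1), of i q] f by metis
    then have "series C S n (trg C (f \<cdot> i))"
      using step sesD[OF step(3)] f by (intro series.step[OF _ q'(1)]) simp_all
    then show ?thesis using step sesD[OF step(3)] f by simp
  next
    case (hit n' i q)
    then obtain q' where q': "ses C (f \<cdot> i) q'" "trg C q' = trg C q" using iso_ses[OF f(1), of i q] f by metis
    then have "series C S (Suc n') (trg C (f \<cdot> i))"
      using hit sesD[OF hit(4)] f by (intro series.hit[OF _ q'(1)]) simp_all
    then show ?thesis using hit sesD[OF hit(4)] f by simp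
  qed
qed

text \<open>Pull the composition series of the quotient back to the whole object.\<close>

lemma series_extension:
  assumes "series C S m B" "ses C a b" "trg C b = B" "series C S n (src C a)"
  shows "series C S (n + m) (trg C a)"
  using assms
proof (induction arbitrary: a b)
  case (zero Z)
  note D = sesD[OF zero(2)]
  have "null C b" using null_of_zero_obj[of b] zero D by simp
  then have "is_iso C a" using ses_null_iso zero by blast
  then show ?case using series_iso[OF zero(4) isomorphicI[of a]] by simp
next
  case (step m i q)
  obtain k a' c where k: "ses C k (q \<cdot> b)" and ac: "ses C a' c" and a': "src C a' = src C a"
    "trg C a' = src C k" "trg C c = src C i" and kt: "trg C k = trg C a"
    using ses_preimage[OF step(2) step(5,6)] by metis
  have "series C S (n + m) (trg C a')" using step.IH[OF ac] a' step.prems by simp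
  then have "series C S (n + m) (trg C k)"
    using a' step sesD[OF step(2)] sesD[OF step(5)] by (intro series.step[OF _ k]) simp_all
  then show ?case by (simp add: kt)
next
  case (hit m i q)
  obtain k a' c where k: "ses C k (q \<cdot> b)" and ac: "ses C a' c" and a': "src C a' = src C a"
    "trg C a' = src C k" "trg C c = src C i" and kt: "trg C k = trg C a"
    using ses_preimage[OF hit(2) hit(6,7)] by metis
  have "series C S (n + m) (trg C a')" using hit.IH[OF ac] a' hit.prems by simp
  then have "series C S (Suc (n + m)) (trg C k)"
    using a' hit sesD[OF hit(2)] sesD[OF hit(6)] by (intro series.hit[OF _ k]) simp_all
  then show ?case by (simp add: kt)
qed

text \<open>Intersect with the series. Where the intersection grows, the factor is a nonzero subobject of a simple
  object, hence all of it.\<close>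

lemma series_sub:
  assumes "series C S n Y" "is_mono C b" "trg C b = Y"
  shows "series C S 0 (src C b)"
proof -
  have st: "series C S 0 (src C b)"
    if IH: "\<And>b. is_mono C b \<Longrightarrow> trg C b = src C i \<Longrightarrow> series C S 0 (src C b)"
      and s: "ses C i q" "simple_obj C (trg C q)" and b: "is_mono C b" "trg C b = trg C i" for i q b
  proof -
    note D = sesD[OF s(1)] and ba = mono_arr[OF b(1)]
    show ?thesis
    proof (cases "null C (q \<cdot> b)")
      case True
      then obtain u where u: "u \<in> arr C" "src C u = src C b" "trg C u = src C i" "i \<cdot> u = b"
        using ses_lift[OF s(1), of b] D ba b by auto
      then have "is_mono C u" using mono_first[of u i] D b by simp
      then show ?thesis using IH[of u] u by simp
    next
      case False
      then have "is_epi C (q \<cdot> b)" using simple_epi[of "q \<cdot> b"] D ba b s by simp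
      then obtain k where k: "ses C k (q \<cdot> b)" using epi_ses by blast
      note kD = sesD[OF k]
      have "null C (q \<cdot> (b \<cdot> k))" using kD D ba b by simp
      then obtain v where v: "v \<in> arr C" "src C v = src C k" "trg C v = src C i" "i \<cdot> v = b \<cdot> k"
        using ses_lift[OF s(1), of "b \<cdot> k"] D ba b kD by auto
      have "is_mono C (b \<cdot> k)" using mono_comp[of k b] b kD D ba by simp
      then have "is_mono C v" using mono_first[of v i] v D by simp
      then have "series C S 0 (src C k)" using IH[of v] v by simp
      then have "series C S 0 (trg C k)" using k s D ba b by (intro series.step[OF _ k]) simp_all
      then show ?thesis using kD D ba b by simp
    qed
  qed
  show ?thesis
    using assms
  proof (induction arbitrary: b)
    case (zero Z)
    then have "null C b" using null_of_zero_obj[of b] mono_arr by auto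
    then show ?case using zero mono_null_src[of b] by (intro series.zero) simp
  qed (use st in blast)+
qed

lemma zero_ses:
  assumes X: "X \<in> obj C"
  obtains z where "ses C z (\<one> X)" "zero_obj C (src C z)"
proof -
  obtain z where z: "ses C z (\<one> X)" using epi_ses iso_mono_epi(2)[OF id_iso[OF X]] by blast
  note D = sesD[OF z]
  have "null C z" using D X by simp
  then show ?thesis using that[OF z] mono_null_src[of z] D by simp
qed

lemma series_simple: "simple_obj C Q \<Longrightarrow> series C S 0 Q"
proof -
  assume Q: "simple_obj C Q"
  obtain z where z: "ses C z (\<one> Q)" "zero_obj C (src C z)" using zero_ses[of Q] Q by auto
  have "series C S 0 (trg C z)"
    using Q z by (intro series.step[OF series.zero z(1)]) simp_all
  then show ?thesis using sesD[OF z(1)] Q by simp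
qed

lemma simple_opp_imp:
  assumes S: "simple_obj C S"
  shows "simple_obj (opp C) S"
  unfolding simple_obj_def
proof (intro conjI allI impI)
  fix m assume "subobj (opp C) S m"
  then have m: "is_epi C m" "src C m = S" "m \<in> arr C" by (auto simp: subobj_def epi_arr)
  show "zero_obj (opp C) (src (opp C) m) \<or> is_iso (opp C) m"
  proof (cases "null C m")
    case True
    then show ?thesis using m epi_null_trg[of m] by simp
  next
    case False
    then show ?thesis using m S simple_mono[of m] mono_epi_iso by simp
  qed
qed (use S in \<open>simp_all add: simple_obj_def\<close>)

lemma simple_opp [simp]: "simple_obj (opp C) S \<longleftrightarrow> simple_obj C S"
  using simple_opp_imp abelian_linear_category.simple_opp_imp[OF abelian_opp, of S] by auto

text \<open>In the opposite category a series is built from the other end, which extension closure allows.\<close>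

lemma finite_opp_imp: "series C S n X \<Longrightarrow> series (opp C) S 0 X"
proof (induction rule: series.induct)
  case (zero Z)
  then show ?case by (intro series.zero) simp
next
  case (step n i q)
  then show ?case
    using abelian_linear_category.series_extension[OF abelian_opp, of S 0 "src C i" q i 0]
      abelian_linear_category.series_simple[OF abelian_opp, of "trg C q" S] sesD[OF step(2)] by simp
next
  case (hit n i q)
  then show ?case
    using abelian_linear_category.series_extension[OF abelian_opp, of S 0 "src C i" q i 0]
      abelian_linear_category.series_simple[OF abelian_opp, of "trg C q" S] sesD[OF hit(2)] by simp
qed

lemma finite_opp [simp]: "series (opp C) S 0 X \<longleftrightarrow> series C S 0 X"
  using finite_opp_imp abelian_linear_category.finite_opp_imp[OF abelian_opp, of S 0 X] by auto

lemma series_quotient: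
  assumes "series C S n Y" "is_epi C b" "src C b = Y"
  shows "series C S 0 (trg C b)"
  using abelian_linear_category.series_sub[OF abelian_opp, of S 0 Y b] assms series_zero[OF assms(1)]
  by simp

lemma series_epi_simple:
  assumes "series C S n X" "is_epi C e" "src C e = X" "trg C e = S" "simple_obj C S"
  shows "series C S 1 X"
proof -
  obtain k where k: "ses C k e" using epi_ses assms by blast
  note D = sesD[OF k]
  have "series C S 0 (src C k)" using series_sub[OF assms(1), of k] D assms by simp
  then have "series C S (Suc 0) (trg C k)" using assms by (intro series.hit[OF _ k]) simp_all
  then show ?thesis using D assms by simp
qed

lemma finite_simple_quotient:
  assumes "series C S n X" "\<not> zero_obj C X"
  obtains q where "is_epi C q" "src C q = X" "simple_obj C (trg C q)"
  using assms(1)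
proof cases
  case zero then show ?thesis using assms by simp
next
  case (step i q) then show ?thesis using that[of q] sesD[OF step(3)] by simp
next
  case (hit n i q) then show ?thesis using that[of q] sesD[OF hit(4)] by simp
qed

lemma is_quotientE:
  assumes "is_quotient C m n Q" "is_mono C m" "is_mono C n"
  obtains j q where "ses C j q" "src C j = src C m" "trg C j = src C n" "trg C q = Q" "n \<cdot> j = m"
proof -
  obtain j q where j: "j \<in> arr C" "src C j = src C m" "trg C j = src C n" "n \<cdot> j = m"
    and q: "trg C q = Q" "is_cokernel C q j"
    using assms(1) unfolding is_quotient_def hom_iff Bex_def by blast
  have "is_mono C j" using mono_first[of j n] j assms mono_arr by simp
  then show ?thesis using that[of j q] mono_cokernel_ses[OF _ q(2)] j q by simp
qed

lemma is_quotientI: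
  assumes "ses C j q" "is_mono C n" "trg C j = src C n" "n \<cdot> j = m" "trg C q = Q"
  shows "is_quotient C m n Q"
  unfolding is_quotient_def using assms sesD[OF assms(1)] mono_arr[OF assms(2)]
  by (intro bexI[of _ j] bexI[of _ q]) (auto simp: ses_def)

lemma series_of_comp_series:
  assumes "comp_series C X n F" "k \<le> n"
  shows "series C S 0 (src C (F k))"
  using assms(2)
proof (induction k)
  case 0
  then show ?case using assms(1) by (intro series.zero) (simp add: comp_series_def)
next
  case (Suc k)
  then obtain Q where Q: "simple_obj C Q" "is_quotient C (F k) (F (Suc k)) Q"
    using comp_seriesD(4)[OF assms(1), of k] by auto
  have "is_mono C (F k)" "is_mono C (F (Suc k))"
    using comp_seriesD(1)[OF assms(1)] Suc by (simp_all add: subobj_def)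
  then obtain j q where j: "ses C j q" "src C j = src C (F k)" "trg C j = src C (F (Suc k))" "trg C q = Q"
    using is_quotientE[OF Q(2)] by metis
  have "series C S 0 (trg C j)" using Suc j Q by (intro series.step[OF _ j(1)]) simp_all
  then show ?case using j by simp
qed

text \<open>The series of the subobject is composed with its inclusion and the identity is put on top.\<close>

lemma comp_series_of_series:
  assumes "series C S n X"
  shows "X \<in> obj C \<and> (\<exists>l F. comp_series C X l F \<and> n \<le> card {i. i < l \<and> is_quotient C (F i) (F (Suc i)) S})"
proof -
  have ex: "\<exists>l F. comp_series C (trg C i) l F \<and>
      (if trg C q = S then Suc n else n) \<le> card {k. k < l \<and> is_quotient C (F k) (F (Suc k)) S}"
    if IH: "comp_series C (src C i) l F" "n \<le> card {k. k < l \<and> is_quotient C (F k) (F (Suc k)) S}"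
      and s: "ses C i q" "simple_obj C (trg C q)" for n i q l F
  proof -
    note D = sesD[OF s(1)]
    \<comment> \<open>Only \<open>k = l + 1\<close> is relevant in the second case.\<close>
    define G where "G k = (if k \<le> l then i \<cdot> F k else \<one> (trg C i))" for k
    have F: "is_mono C (F k)" "F k \<in> arr C" "trg C (F k) = src C i" if "k \<le> l" for k
      using IH(1) that mono_arr by (auto simp: comp_series_def subobj_def)
    have low: "is_quotient C (G k) (G (Suc k)) Q" if k: "k < l" and Q: "is_quotient C (F k) (F (Suc k)) Q" for k Q
    proof -
      obtain j p where j: "ses C j p" "src C j = src C (F k)" "trg C j = src C (F (Suc k))" "trg C p = Q"
        "F (Suc k) \<cdot> j = F k"
        using is_quotientE[OF Q] F[of k] F[of "Suc k"] k by auto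
      have "is_mono C (i \<cdot> F (Suc k))" using mono_comp[of "F (Suc k)" i] F[of "Suc k"] D k by simp
      then show ?thesis
        using k j F[of k] F[of "Suc k"] D sesD[OF j(1)]
        by (intro is_quotientI[OF j(1)]) (simp_all add: G_def)
    qed
    have Fl: "is_iso C (F l)" using IH(1) by (simp add: comp_series_def)
    have top: "is_quotient C (G l) (G (Suc l)) (trg C q)"
    proof -
      have "is_cokernel C q (i \<cdot> F l)"
      proof (rule cokernelI)
        show "null C (q \<cdot> (i \<cdot> F l))"
          using null_comp(2)[of "F l" "q \<cdot> i"] D F[of l] by simp
        fix h assume h: "h \<in> arr C" "src C h = trg C (i \<cdot> F l)" "null C (h \<cdot> (i \<cdot> F l))"
        then have "null C ((h \<cdot> i) \<cdot> F l)" using D F[of l] by simp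
        then have "null C (h \<cdot> i)"
          using epi_null[of "F l" "h \<cdot> i"] iso_mono_epi(2)[OF Fl] h D F[of l] by simp
        then obtain u where "u \<in> arr C" "src C u = trg C q" "trg C u = trg C h" "u \<cdot> q = h"
          using ses_colift[OF s(1), of h] h D F[of l] by auto
        then show "\<exists>u. u \<in> arr C \<and> trg C u = trg C h \<and> src C u = trg C q \<and> u \<cdot> q = h" by auto
      qed (use D F[of l] in simp_all)
      moreover have "is_mono C (i \<cdot> F l)" using mono_comp[of "F l" i] F[of l] D by simp
      ultimately have "ses C (i \<cdot> F l) q" by (intro mono_cokernel_ses)
      then show ?thesis
        using D F[of l] iso_mono_epi(1)[OF id_iso[of "trg C i"]]
        by (intro is_quotientI[of "i \<cdot> F l" q]) (simp_all add: G_def)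
    qed
    have c: "comp_series C (trg C i) (Suc l) G"
      unfolding comp_series_def
    proof (intro conjI allI impI)
      show "subobj C (trg C i) (G k)" if "k \<le> Suc l" for k
        using that mono_comp[of "F k" i] F[of k] D iso_mono_epi(1)[OF id_iso[of "trg C i"]]
        by (auto simp: subobj_def G_def)
      show "zero_obj C (src C (G 0))" using IH(1) F[of 0] D by (simp add: G_def comp_series_def)
      show "is_iso C (G (Suc l))" using D by (simp add: G_def id_iso)
      show "\<exists>S. simple_obj C S \<and> is_quotient C (G k) (G (Suc k)) S" if "k < Suc l" for k
      proof (cases "k = l")
        case True then show ?thesis using top s by blast
      next
        case False
        then obtain Q where "simple_obj C Q" "is_quotient C (F k) (F (Suc k)) Q"
          using comp_seriesD(4)[OF IH(1), of k] \<open>k < Suc l\<close> less_Suc_eq by blast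
        then show ?thesis using low[of k Q] False that by auto
      qed
    qed
    let ?A = "{k. k < l \<and> is_quotient C (F k) (F (Suc k)) S}"
    let ?B = "{k. k < Suc l \<and> is_quotient C (G k) (G (Suc k)) S}"
    have sub: "?A \<subseteq> ?B" using low by auto
    have fin: "finite ?B" by (rule finite_subset[of _ "{..<Suc l}"]) auto
    have "card ?A \<le> card ?B" using sub fin by (intro card_mono)
    moreover have "Suc (card ?A) \<le> card ?B" if "trg C q = S"
    proof -
      have "insert l ?A \<subseteq> ?B" using sub top that by auto
      then have "card (insert l ?A) \<le> card ?B" using fin by (intro card_mono)
      then show ?thesis by simp
    qed
    ultimately show ?thesis using c IH(2) by (intro exI[of _ "Suc l"] exI[of _ G]) auto
  qed
  show ?thesis
    using assms
  proof induction
    case (zero Z)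
    then have Z: "Z \<in> obj C" by (simp add: zero_obj_iff_null)
    have "comp_series C Z 0 (\<lambda>_. \<one> Z)"
      using Z zero id_iso[OF Z] iso_mono_epi(1)[OF id_iso[OF Z]] by (simp add: comp_series_def subobj_def)
    then show ?case using Z by (auto intro!: exI[of _ 0])
  next
    case (step n i q)
    then obtain l F where "comp_series C (src C i) l F" "n \<le> card {k. k < l \<and> is_quotient C (F k) (F (Suc k)) S}"
      by blast
    from ex[OF this step(2,3)] show ?case using sesD[OF step(2)]
      by (fastforce split: if_splits)
  next
    case (hit n i q)
    then obtain l F where "comp_series C (src C i) l F" "n \<le> card {k. k < l \<and> is_quotient C (F k) (F (Suc k)) S}"
      by blast
    from ex[OF this hit(2,3)] show ?case using sesD[OF hit(2)] hit(4) by simp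
  qed
qed

lemma finite_length_iff: "finite_length C X \<longleftrightarrow> series C S 0 X"
proof
  assume "finite_length C X"
  then obtain n F where X: "X \<in> obj C" and F: "comp_series C X n F" by (auto simp: finite_length_def)
  have "is_iso C (F n)" "trg C (F n) = X" using F by (auto simp: comp_series_def subobj_def)
  then show "series C S 0 X"
    using series_iso[OF series_of_comp_series[OF F order_refl], of X] isomorphicI[of "F n"] by simp
next
  assume "series C S 0 X"
  then show "finite_length C X" using comp_series_of_series[of S 0 X] by (auto simp: finite_length_def)
qed

lemma mult_ge:
  assumes "is_mono C m" "trg C m = M" "series C S n (src C m)"
  shows "enat n \<le> mult C M S"
proof -
  obtain l F where F: "comp_series C (src C m) l F" "n \<le> card {i. i < l \<and> is_quotient C (F i) (F (Suc i)) S}"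
    using comp_series_of_series[OF assms(3)] by blast
  have "enat (card {i. i < l \<and> is_quotient C (F i) (F (Suc i)) S}) \<le> mult C M S"
    unfolding mult_def using F(1) assms(1,2) by (intro Sup_upper) (auto simp: subobj_def)
  then show ?thesis using F(2) by (meson enat_ord_simps(1) order_trans)
qed

lemma has_factor_of_mult:
  assumes "mult C M S \<noteq> 0"
  shows "has_factor C M S"
proof -
  obtain x where x: "x \<in> {enat (card {i. i < n \<and> is_quotient C (F i) (F (Suc i)) S}) | m n F.
     subobj C M m \<and> comp_series C (src C m) n F}" "x \<noteq> 0"
    using assms unfolding mult_def by (metis (no_types, lifting) Sup_eqI bot_enat_def bot.extremum le_zero_eq)
  from x(1) obtain m n F where m: "subobj C M m" "comp_series C (src C m) n F"
    and xe: "x = enat (card {i. i < n \<and> is_quotient C (F i) (F (Suc i)) S})"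
    by blast
  have c: "card {i. i < n \<and> is_quotient C (F i) (F (Suc i)) S} \<noteq> 0"
    using x(2) unfolding xe by (metis zero_enat_def)
  then obtain i where i: "i < n" "is_quotient C (F i) (F (Suc i)) S"
    by (metis (mono_tags, lifting) card.empty empty_Collect_eq)
  have Fi: "is_mono C (F i)" "is_mono C (F (Suc i))" "trg C (F (Suc i)) = src C m"
    using comp_seriesD(1)[OF m(2)] i by (simp_all add: subobj_def)
  obtain j q where "ses C j q" "trg C j = src C (F (Suc i))" "trg C q = S"
    using is_quotientE[OF i(2)] Fi by metis
  then have "has_factor C (src C (F (Suc i))) S"
    using has_factor_of_epi[of q] sesD[of j q] by simp
  then have "has_factor C (src C m) S" using has_factor_sub[of "F (Suc i)"] Fi by simp
  then show ?thesis using has_factor_sub[of m] m by (simp add: subobj_def)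
qed

end

section \<open>Subobjects and lifting\<close>

context abelian_linear_category
begin

lemma sub_leE:
  assumes "sub_le C m n"
  obtains j where "j \<in> arr C" "src C j = src C m" "trg C j = src C n" "n \<cdot> j = m"
  using assms unfolding sub_le_def Bex_def hom_iff by blast

lemma sub_leI: "j \<in> arr C \<Longrightarrow> trg C j = src C n \<Longrightarrow> n \<in> arr C \<Longrightarrow> n \<cdot> j = m \<Longrightarrow> sub_le C m n"
  unfolding sub_le_def Bex_def hom_iff by (intro exI[of _ j]) auto

lemma sub_le_refl: "m \<in> arr C \<Longrightarrow> sub_le C m m"
  by (intro sub_leI[of "\<one> (src C m)"]) simp_all

lemma sub_le_trans:
  assumes "sub_le C a b" "sub_le C b c" "c \<in> arr C"
  shows "sub_le C a c"
proof -
  obtain i where i: "i \<in> arr C" "src C i = src C a" "trg C i = src C b" "b \<cdot> i = a"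
    using assms sub_leE by metis
  obtain j where j: "j \<in> arr C" "src C j = src C b" "trg C j = src C c" "c \<cdot> j = b"
    using assms sub_leE by metis
  show ?thesis
    using comp_reduce[OF j(4), of i] i j assms by (intro sub_leI[of "j \<cdot> i"]) simp_all
qed

lemma is_union_least:
  assumes "is_union C X S u" "is_mono C v" "trg C v = X" "\<And>s. s \<in> S \<Longrightarrow> sub_le C s v"
  shows "sub_le C u v"
  using assms unfolding is_union_def subobj_def by blast

text \<open>If \<open>f\<close> were not epi, its cokernel would have a simple quotient, and some filtered object would map to
  the target of \<open>f\<close> with nonzero image in that quotient. But such a map lifts through \<open>f\<close>.\<close>

lemma epi_if_filtered_lift:
  assumes f: "f \<in> arr C" and fin: "series C S 0 (trg C f)"
    and N: "\<And>D. D \<in> R \<Longrightarrow> ext_vanishes C D (src C f)"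
    and lift: "\<And>D g. D \<in> R \<Longrightarrow> g \<in> hom C D (trg C f) \<Longrightarrow> \<exists>h\<in>hom C D (src C f). f \<cdot> h = g"
    and gen: "\<And>e. is_epi C e \<Longrightarrow> src C e = trg C f \<Longrightarrow> simple_obj C (trg C e) \<Longrightarrow>
      \<exists>P h. filtered_by C R P \<and> h \<in> hom C P (trg C f) \<and> \<not> null C (e \<cdot> h)"
  shows "is_epi C f"
proof -
  obtain q where cq: "is_cokernel C q f"
    and q: "is_epi C q" "q \<in> arr C" "src C q = trg C f" "null C (q \<cdot> f)"
    using cokernelE[OF f] by metis
  have z: "zero_obj C (trg C q)"
  proof (rule ccontr)
    assume nz: "\<not> zero_obj C (trg C q)"
    obtain e where e: "is_epi C e" "src C e = trg C q" "simple_obj C (trg C e)"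
      using finite_simple_quotient[OF series_quotient[OF fin q(1,3)] nz] by metis
    note ea = epi_arr[OF e(1)]
    obtain P h where P: "filtered_by C R P" "h \<in> hom C P (trg C f)" "\<not> null C ((e \<cdot> q) \<cdot> h)"
      using gen[of "e \<cdot> q"] epi_comp[OF q(1) e(1,2)] e ea q by auto
    obtain h' where h': "h' \<in> hom C P (src C f)" "f \<cdot> h' = h"
      using filtered_by_lift(2)[OF P(1) N f lift P(2)] by blast
    have "null C ((q \<cdot> f) \<cdot> h')" using q f h' by - (rule null_comp(2); simp)
    then have "null C (q \<cdot> h)" using q f h' by simp
    then have "null C (e \<cdot> (q \<cdot> h))" using e ea q P by - (rule null_comp(1); simp)
    then show False using P(2,3) e ea q by simp
  qed
  show ?thesis
  proof (rule epiI[OF f])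
    fix h assume h: "h \<in> arr C" "src C h = trg C f" "null C (h \<cdot> f)"
    obtain u where u: "u \<in> arr C" "src C u = trg C q" "u \<cdot> q = h"
      using cokernel_colift[OF cq h] by auto
    have "null C u" using null_of_zero_obj[of u] u z by simp
    then have "null C (u \<cdot> q)" using u q by - (rule null_comp(2); simp)
    then show "null C h" using u by simp
  qed
qed

end

section \<open>Increasing chains in Grothendieck categories\<close>

context grothendieck_category
begin

text \<open>By AB5, \<open>b\<close> is the union of its intersections with the members of a directed family with union \<open>X\<close>.\<close>

lemma sub_le_by_stages:
  assumes S: "directed_subobjs C X S" and U: "is_union C X S (\<one> X)"
    and b: "is_mono C b" "trg C b = X" and v: "is_mono C v" "trg C v = X"
    and st: "\<And>s w. s \<in> S \<Longrightarrow> is_mono C w \<Longrightarrow> trg C w = X \<Longrightarrow> sub_le C w s \<Longrightarrow> sub_le C w b \<Longrightarrow>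
      sub_le C w v"
  shows "sub_le C b v"
proof -
  note ba = mono_arr[OF b(1)]
  have "is_inter C X {\<one> X, b} b"
    unfolding is_inter_def
  proof (intro conjI ballI allI impI)
    show "sub_le C b s" if "s \<in> {\<one> X, b}" for s
      using that ba b sub_le_refl[OF ba] sub_leI[of b "\<one> X" b] by auto
  qed (use b in \<open>auto simp: subobj_def\<close>)
  then have "is_union C X {v. \<exists>s\<in>S. is_inter C X {s, b} v} b"
    using directed_union_inter[OF S U] b by (simp add: subobj_def)
  moreover have "sub_le C w v" if "w \<in> {v. \<exists>s\<in>S. is_inter C X {s, b} v}" for w
    using that st unfolding is_inter_def subobj_def by blast
  ultimately show ?thesis using v unfolding is_union_def subobj_def by blast
qed

lemma incr_chainD:
  assumes "incr_chain C M N F"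
  shows "enat i \<le> N \<Longrightarrow> is_mono C (F i)" "enat i \<le> N \<Longrightarrow> trg C (F i) = M"
    "zero_obj C (src C (F 0))" "enat i < N \<Longrightarrow> sub_le C (F i) (F (Suc i))"
    "is_union C M {F i | i. enat i \<le> N} (\<one> M)"
  using assms unfolding incr_chain_def subobj_def by blast+

lemma incr_chain_le:
  assumes F: "incr_chain C M N F" and ij: "i \<le> j" "enat j \<le> N"
  shows "sub_le C (F i) (F j)"
  using ij
proof (induction j rule: dec_induct)
  case base
  then show ?case using incr_chainD(1)[OF F] mono_arr sub_le_refl by blast
next
  case (step j)
  then have j: "enat j < N" by (metis Suc_ile_eq)
  then have "sub_le C (F i) (F j)" using step by (simp add: order_less_imp_le)
  moreover have "F (Suc j) \<in> arr C" using incr_chainD(1)[OF F step.prems] mono_arr by blast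
  ultimately show ?case using sub_le_trans incr_chainD(4)[OF F j] by blast
qed

lemma incr_chain_directed:
  assumes F: "incr_chain C M N F"
  shows "directed_subobjs C M {F i | i. enat i \<le> N}"
  unfolding directed_subobjs_def
proof (intro conjI ballI)
  show "{F i | i. enat i \<le> N} \<noteq> {}" by (auto intro!: exI[of _ 0] simp: zero_enat_def[symmetric])
  show "subobj C M s" if "s \<in> {F i | i. enat i \<le> N}" for s
    using that incr_chainD(1,2)[OF F] by (auto simp: subobj_def)
  fix s t assume "s \<in> {F i | i. enat i \<le> N}" "t \<in> {F i | i. enat i \<le> N}"
  then obtain i j where ij: "s = F i" "t = F j" "enat i \<le> N" "enat j \<le> N" by blast
  have m: "enat (max i j) \<le> N" using ij by (simp add: max_def)
  have "sub_le C s (F (max i j))" "sub_le C t (F (max i j))"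
    using incr_chain_le[OF F _ m] ij by simp_all
  then show "\<exists>u\<in>{F i | i. enat i \<le> N}. sub_le C s u \<and> sub_le C t u" using m by blast
qed

text \<open>No part of \<open>b\<close> has a nonzero image in a step of the filtration after the first, so the intersections
  of \<open>b\<close> with the stages all lie in the first stage.\<close>

lemma chain_bottom:
  assumes F: "incr_chain C M N F" and N: "1 \<le> N" and b: "is_mono C b" "trg C b = M"
    and Q: "\<And>k. 1 < k \<Longrightarrow> enat k \<le> N \<Longrightarrow> is_quotient C (F (k - 1)) (F k) (Q k)"
    and Z: "\<And>k x y. 1 < k \<Longrightarrow> enat k \<le> N \<Longrightarrow> is_mono C x \<Longrightarrow> trg C x = src C b \<Longrightarrow>
      y \<in> hom C (src C x) (Q k) \<Longrightarrow> null C y"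
  shows "sub_le C b (F 1)"
proof -
  note ba = mono_arr[OF b(1)]
  have F1: "is_mono C (F 1)" "trg C (F 1) = M" "F 1 \<in> arr C"
    using incr_chainD(1,2)[OF F, of 1] N mono_arr by (auto simp: one_enat_def)
  have stage: "sub_le C w (F 1)"
    if "enat k \<le> N" "is_mono C w" "trg C w = M" "sub_le C w (F k)" "sub_le C w b" for k w
    using that
  proof (induction k)
    case 0
    have "sub_le C (F 0) (F 1)" using incr_chain_le[OF F, of 0 1] N by (simp add: one_enat_def)
    then show ?case by (rule sub_le_trans[OF 0(4) _ F1(3)])
  next
    case (Suc k)
    show ?case
    proof (cases "k = 0")
      case True then show ?thesis using Suc by simp
    next
      case False
      have k: "enat k \<le> N" using Suc.prems(1) by (meson Suc_ile_eq order_less_imp_le)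
      have qk: "is_quotient C (F k) (F (Suc k)) (Q (Suc k))"
        using Q[of "Suc k"] False Suc by simp
      obtain j q where j: "ses C j q" "src C j = src C (F k)" "trg C j = src C (F (Suc k))"
        "trg C q = Q (Suc k)" "F (Suc k) \<cdot> j = F k"
        using is_quotientE[OF qk] incr_chainD(1)[OF F] k Suc by metis
      note D = sesD[OF j(1)]
      have Fk: "F (Suc k) \<in> arr C" using incr_chainD(1)[OF F] Suc mono_arr by blast
      obtain u where u: "u \<in> arr C" "src C u = src C w" "trg C u = src C (F (Suc k))" "F (Suc k) \<cdot> u = w"
        using Suc sub_leE by metis
      obtain x where x: "x \<in> arr C" "src C x = src C w" "trg C x = src C b" "b \<cdot> x = w"
        using Suc sub_leE by metis
      have "is_mono C x" using mono_first[of x b] x Suc ba by simp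
      then have "null C (q \<cdot> u)"
        using Z[of "Suc k" x "q \<cdot> u"] False Suc u x j D by simp
      then obtain v where v: "v \<in> arr C" "src C v = src C u" "trg C v = src C j" "j \<cdot> v = u"
        using ses_lift[OF j(1), of u] u j by auto
      have "F k \<cdot> v = w" using comp_reduce[OF j(5), of v] v u j D Fk by simp
      then have "sub_le C w (F k)"
        using v j mono_arr[OF incr_chainD(1)[OF F k]] by (intro sub_leI[of v]) simp_all
      then show ?thesis using Suc k by simp
    qed
  qed
  show ?thesis
    by (rule sub_le_by_stages[OF incr_chain_directed[OF F] incr_chainD(5)[OF F] b F1(1,2)])
      (use stage in blast)
qed

text \<open>Objects of finite length are noetherian. In the induction, \<open>b i\<close> has simple quotient in \<open>b\<close> and lies in
  a stage. If \<open>b\<close> is in no stage, then each of its intersections with a stage is already in \<open>b i\<close>: otherwise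
  it spans \<open>b\<close> together with \<open>b i\<close>, and a later stage contains both. So \<open>b\<close> lies in \<open>b i\<close> by AB5, which is
  absurd.\<close>

lemma finite_in_stage:
  assumes F: "incr_chain C M N F" and fin: "series C S n B" and b: "is_mono C b" "trg C b = M" "src C b = B"
  shows "\<exists>k. enat k \<le> N \<and> sub_le C b (F k)"
proof -
  have st: "\<exists>k. enat k \<le> N \<and> sub_le C b (F k)"
    if IH: "\<And>b. is_mono C b \<Longrightarrow> trg C b = M \<Longrightarrow> src C b = src C i \<Longrightarrow> \<exists>k. enat k \<le> N \<and> sub_le C b (F k)"
      and s: "ses C i q" "simple_obj C (trg C q)"
      and b: "is_mono C b" "trg C b = M" "src C b = trg C i" for i q b
  proof (rule ccontr)
    assume no: "\<nexists>k. enat k \<le> N \<and> sub_le C b (F k)"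
    note D = sesD[OF s(1)] and ba = mono_arr[OF b(1)]
    have bi: "is_mono C (b \<cdot> i)" "trg C (b \<cdot> i) = M" "src C (b \<cdot> i) = src C i" "b \<cdot> i \<in> arr C"
      using mono_comp[of i b] D ba b by simp_all
    obtain l where l: "enat l \<le> N" "sub_le C (b \<cdot> i) (F l)" using IH bi by blast
    have "sub_le C b (b \<cdot> i)"
    proof (rule sub_le_by_stages[OF incr_chain_directed[OF F] incr_chainD(5)[OF F] b(1,2) bi(1,2)])
      fix s w assume "s \<in> {F i | i. enat i \<le> N}"
        and w: "is_mono C w" "trg C w = M" "sub_le C w s" "sub_le C w b"
      then obtain k where k: "s = F k" "enat k \<le> N" by blast
      obtain x where x: "x \<in> arr C" "src C x = src C w" "trg C x = src C b" "b \<cdot> x = w"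
        using w sub_leE by metis
      let ?m = "max k l"
      have m: "enat ?m \<le> N" using k l by (simp add: max_def)
      have Fm: "is_mono C (F ?m)" "trg C (F ?m) = M" "F ?m \<in> arr C"
        using incr_chainD(1,2)[OF F m] mono_arr by blast+
      have wm: "sub_le C w (F ?m)"
        using sub_le_trans[OF w(3), of "F ?m"] incr_chain_le[OF F _ m, of k] k Fm by simp
      have im: "sub_le C (b \<cdot> i) (F ?m)"
        using sub_le_trans[OF l(2), of "F ?m"] incr_chain_le[OF F _ m, of l] Fm by simp
      obtain c where c: "ses C (F ?m) c" using mono_ses Fm by blast
      note cD = sesD[OF c]
      have kill: "null C (c \<cdot> y)" if ym: "sub_le C y (F ?m)" for y
      proof -
        obtain z where z: "z \<in> arr C" "src C z = src C y" "trg C z = src C (F ?m)" "F ?m \<cdot> z = y"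
          by (rule sub_leE[OF ym])
        have "null C ((c \<cdot> F ?m) \<cdot> z)" using cD z by - (rule null_comp(2); simp)
        then show ?thesis using cD z by simp
      qed
      have "null C (q \<cdot> x)"
      proof (rule ccontr)
        assume "\<not> null C (q \<cdot> x)"
        then have qx: "is_epi C (q \<cdot> x)" using simple_epi[of "q \<cdot> x"] s D x b by simp
        have "null C ((c \<cdot> b) \<cdot> i)" using kill[OF im] cD ba b D Fm by simp
        then obtain z where z: "z \<in> arr C" "src C z = trg C q" "trg C z = trg C (c \<cdot> b)" "z \<cdot> q = c \<cdot> b"
          using ses_colift[OF s(1), of "c \<cdot> b"] cD ba b D Fm by auto
        have "null C (c \<cdot> (b \<cdot> x))" using kill[OF wm] x by simp
        then have "null C (z \<cdot> (q \<cdot> x))"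
          using comp_reduce[OF z(4), of x] z D x b cD ba Fm by simp
        then have "null C z" using epi_null[OF qx, of z] z D x b by simp
        then have "null C (z \<cdot> q)" using z D by - (rule null_comp(2); simp)
        then have "null C (c \<cdot> b)" using z by simp
        then obtain v where v: "v \<in> arr C" "src C v = src C b" "trg C v = src C (F ?m)" "F ?m \<cdot> v = b"
          using ses_lift[OF c, of b] ba b Fm by auto
        then have "sub_le C b (F ?m)" using Fm by (intro sub_leI[of v]) simp_all
        then show False using no m by blast
      qed
      then obtain y where y: "y \<in> arr C" "src C y = src C x" "trg C y = src C i" "i \<cdot> y = x"
        using ses_lift[OF s(1), of x] x b by auto
      then show "sub_le C w (b \<cdot> i)"
        using x D ba b by (intro sub_leI[of y]) simp_all
    qed
    then obtain u where u: "u \<in> arr C" "src C u = src C b" "trg C u = src C i" "(b \<cdot> i) \<cdot> u = b"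
      using sub_leE bi by metis
    have "b \<cdot> (i \<cdot> u) = b \<cdot> \<one> (src C b)" using u D ba b by simp
    then have iu: "i \<cdot> u = \<one> (src C b)" using u D ba b by - (rule mono_cancel[of b]; simp)
    have "null C ((q \<cdot> i) \<cdot> u)" using D u by - (rule null_comp(2); simp)
    then have "null C q" using iu D u b by simp
    then show False using simple_epi_nonzero[of q] s D by simp
  qed
  show ?thesis
    using fin b
  proof (induction arbitrary: b)
    case (zero Z)
    have F0: "is_mono C (F 0)" "trg C (F 0) = M" "F 0 \<in> arr C"
      using incr_chainD(1,2)[OF F, of 0] mono_arr by (auto simp: zero_enat_def[symmetric])
    note ba = mono_arr[OF zero(2)]
    let ?z = "hzero C (src C b) (src C (F 0))"
    have z: "?z \<in> arr C" "src C ?z = src C b" "trg C ?z = src C (F 0)" "null C ?z"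
      using ba F0 by simp_all
    have n: "null C (F 0 \<cdot> ?z)" using z F0 by - (rule null_comp(1); simp)
    have nb: "null C b" using null_of_zero_obj[of b] ba zero by simp
    have "F 0 \<cdot> ?z = b" using n nb z F0 zero by - (rule null_eq; simp)
    then have "sub_le C b (F 0)" using z F0 by (intro sub_leI[of ?z]) simp_all
    then show ?case by (intro exI[of _ 0]) (simp add: zero_enat_def[symmetric])
  qed (use st in blast)+
qed

end

section \<open>Locally artinian categories\<close>

text \<open>A witness for the multiplicity of \<open>S\<close> in \<open>X\<close> being at least \<open>n\<close>. Multiplicities along a filtration are
  compared through such witnesses rather than through the supremum.\<close>

definition mult_at_least :: "('o, 'a, 'k, 'm) lincat_scheme \<Rightarrow> 'o \<Rightarrow> 'o \<Rightarrow> nat \<Rightarrow> bool" where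
  "mult_at_least C S X n \<longleftrightarrow> (\<exists>e. is_mono C e \<and> trg C e = X \<and> series C S n (src C e))"

context abelian_linear_category
begin

lemma mult_at_least_sub:
  assumes "is_mono C m" "mult_at_least C S (src C m) n"
  shows "mult_at_least C S (trg C m) n"
proof -
  obtain e where "is_mono C e" "trg C e = src C m" "series C S n (src C e)"
    using assms by (auto simp: mult_at_least_def)
  then show ?thesis
    unfolding mult_at_least_def using assms mono_comp[of e m] mono_arr by (intro exI[of _ "m \<cdot> e"]) auto
qed

lemma mult_at_least_le_mult: "mult_at_least C S M n \<Longrightarrow> enat n \<le> mult C M S"
  using mult_ge by (auto simp: mult_at_least_def)

lemma mult_at_least_zero: "X \<in> obj C \<Longrightarrow> mult_at_least C S X 0"
proof -
  assume "X \<in> obj C"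
  then obtain z where z: "ses C z (\<one> X)" "zero_obj C (src C z)" using zero_ses by blast
  show ?thesis
    unfolding mult_at_least_def using sesD[OF z(1)] z series.zero[OF z(2)] \<open>X \<in> obj C\<close> by (intro exI[of _ z]) simp
qed

end

context locally_artinian_category
begin

text \<open>The object is the union of its subobjects of finite length, so a kernel containing these is everything.\<close>

lemma null_if_null_on_finite:
  assumes f: "f \<in> arr C"
    and fin: "\<And>m. is_mono C m \<Longrightarrow> trg C m = src C f \<Longrightarrow> series C S 0 (src C m) \<Longrightarrow> null C (f \<cdot> m)"
  shows "null C f"
proof -
  let ?X = "src C f"
  obtain k where kk: "is_kernel C k f"
    and k: "is_mono C k" "k \<in> arr C" "trg C k = ?X" "null C (f \<cdot> k)"
    using kernelE[OF f] by metis
  have U: "is_union C ?X {m. subobj C ?X m \<and> finite_length C (src C m)} (\<one> ?X)"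
    using union_of_finite f by simp
  have "sub_le C m k" if "m \<in> {m. subobj C ?X m \<and> finite_length C (src C m)}" for m
  proof -
    have m: "is_mono C m" "trg C m = ?X" "series C S 0 (src C m)"
      using that finite_length_iff[of "src C m" S] by (auto simp: subobj_def)
    then obtain u where "u \<in> arr C" "src C u = src C m" "trg C u = src C k" "k \<cdot> u = m"
      using kernel_lift[OF kk mono_arr[OF m(1)] m(2) fin] by blast
    then show ?thesis using k by (intro sub_leI[of u]) simp_all
  qed
  then have "sub_le C (\<one> ?X) k"
    using is_union_least[OF U] k by simp
  then obtain u where u: "u \<in> arr C" "src C u = ?X" "trg C u = src C k" "k \<cdot> u = \<one> ?X"
    using sub_leE f by (metis id_arr(2) src_obj)
  have "null C ((f \<cdot> k) \<cdot> u)" using k u f by - (rule null_comp(2); simp)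
  then show ?thesis using u k f by simp
qed

lemma finite_sub_onto_simple:
  assumes q: "is_epi C q" and S: "simple_obj C (trg C q)"
  obtains m where "is_mono C m" "trg C m = src C q" "series C S' 0 (src C m)" "is_epi C (q \<cdot> m)"
proof -
  note qa = epi_arr[OF q]
  obtain m where m: "is_mono C m" "trg C m = src C q" "series C S' 0 (src C m)" "\<not> null C (q \<cdot> m)"
    using null_if_null_on_finite[OF qa, of S'] simple_epi_nonzero[OF S q] by blast
  then show ?thesis using that[of m] simple_epi[of "q \<cdot> m"] qa mono_arr[OF m(1)] S by simp
qed

lemma has_factor_finite:
  assumes "has_factor C X S" "simple_obj C S"
  obtains m e where "is_mono C m" "trg C m = X" "series C S' 0 (src C m)" "is_epi C e" "src C e = src C m"
    "trg C e = S"
proof -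
  obtain m e where m: "is_mono C m" "is_epi C e" "trg C m = X" "src C m = src C e" "trg C e = S"
    using assms by (auto simp: has_factor_def)
  obtain n where n: "is_mono C n" "trg C n = src C e" "series C S' 0 (src C n)" "is_epi C (e \<cdot> n)"
    using finite_sub_onto_simple[of e S'] m assms by metis
  show ?thesis
    using that[of "m \<cdot> n" "e \<cdot> n"] mono_comp[of n m] m n mono_arr[of n] mono_arr[of m] epi_arr[of e] by simp
qed

lemma mult_nonzero_iff:
  assumes "simple_obj C S"
  shows "mult C X S \<noteq> 0 \<longleftrightarrow> has_factor C X S"
proof
  assume "has_factor C X S"
  then obtain m e where m: "is_mono C m" "trg C m = X" "series C S 0 (src C m)" "is_epi C e"
    "src C e = src C m" "trg C e = S"
    using has_factor_finite assms by metis
  have "series C S 1 (src C m)" using series_epi_simple[OF m(3,4)] m assms by simp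
  then have "enat 1 \<le> mult C X S" using mult_ge m by blast
  then show "mult C X S \<noteq> 0" by (auto simp: zero_enat_def)
qed (rule has_factor_of_mult)

lemma nonzero_has_simple_factor:
  assumes X: "X \<in> obj C" "\<not> zero_obj C X"
  obtains S where "simple_obj C S" "has_factor C X S"
proof -
  have "\<not> null C (\<one> X)" using X by (simp add: zero_obj_iff_null)
  then obtain m where m: "is_mono C m" "trg C m = X" "series C X 0 (src C m)" "\<not> null C (\<one> X \<cdot> m)"
    using null_if_null_on_finite[of "\<one> X" X] X by auto
  then have "\<not> zero_obj C (src C m)"
    using null_of_zero_obj[of m] mono_arr[OF m(1)] by auto
  then obtain q where q: "is_epi C q" "src C q = src C m" "simple_obj C (trg C q)"
    using finite_simple_quotient[OF m(3)] by metis
  then show ?thesis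
    using that[of "trg C q"] m unfolding has_factor_def by metis
qed

text \<open>Take a subobject of finite length of \<open>src C j\<close> that realizes the bound, embedded as \<open>j d\<close>, and a
  subobject \<open>y\<close> of finite length of \<open>trg C j\<close> which has the factor \<open>S\<close> modulo \<open>src C j\<close>. Their sum is built as
  the preimage \<open>w\<close> of the image \<open>n'\<close> of \<open>y\<close> in the quotient by \<open>j d\<close>. It has finite length, and its quotient by
  \<open>j d\<close> still maps onto \<open>S\<close>.\<close>

lemma mult_at_least_extension:
  assumes e: "ses C j q" and S: "simple_obj C S" and F: "has_factor C (trg C q) S"
    and c: "mult_at_least C S (src C j) n"
  shows "mult_at_least C S (trg C j) (Suc n)"
proof -
  note D = sesD[OF e]
  obtain d where d: "is_mono C d" "trg C d = src C j" "series C S n (src C d)"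
    using c by (auto simp: mult_at_least_def)
  note da = mono_arr[OF d(1)]
  obtain m p where m: "is_mono C m" "is_epi C p" "trg C m = trg C q" "src C m = src C p" "trg C p = S"
    using F by (auto simp: has_factor_def)
  note ma = mono_arr[OF m(1)] epi_arr[OF m(2)]
  obtain p1 p2 where p: "is_epi C p1" "p1 \<in> arr C" "p2 \<in> arr C" "trg C p1 = src C m"
    "src C p1 = src C p2" "trg C p2 = src C q" "m \<cdot> p1 = q \<cdot> p2" "is_mono C m \<Longrightarrow> is_mono C p2"
    using epi_lift[OF D(5) ma(1) m(3)] by metis
  have pp1: "is_epi C (p \<cdot> p1)" using epi_comp[of p1 p] m p by simp
  obtain x where x: "is_mono C x" "trg C x = src C p1" "series C S 0 (src C x)" "is_epi C ((p \<cdot> p1) \<cdot> x)"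
    using finite_sub_onto_simple[OF pp1, of S] S m p ma by auto
  note xa = mono_arr[OF x(1)]
  let ?y = "p2 \<cdot> x"
  have y: "?y \<in> arr C" "src C ?y = src C x" "trg C ?y = trg C j" using p xa x D by simp_all
  have jd: "is_mono C (j \<cdot> d)" "j \<cdot> d \<in> arr C" "src C (j \<cdot> d) = src C d" "trg C (j \<cdot> d) = trg C j"
    using mono_comp[of d j] d da D by simp_all
  obtain u where u: "ses C (j \<cdot> d) u" using mono_ses jd by blast
  note uD = sesD[OF u]
  obtain n' e2 where im: "is_mono C n'" "is_epi C e2" "n' \<in> arr C" "e2 \<in> arr C" "trg C n' = trg C (u \<cdot> ?y)"
    "src C e2 = src C (u \<cdot> ?y)" "src C n' = trg C e2" "n' \<cdot> e2 = u \<cdot> ?y"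
    using image[of "u \<cdot> ?y"] uD y jd by auto
  have im': "trg C n' = trg C u" "src C e2 = src C x" using im uD y jd by simp_all
  have "null C ((q \<cdot> j) \<cdot> d)" using D da d by - (rule null_comp(2); simp)
  then have "null C (q \<cdot> (j \<cdot> d))" using D da d by simp
  then obtain q' where q': "q' \<in> arr C" "src C q' = trg C u" "trg C q' = trg C q" "q' \<cdot> u = q"
    using ses_colift[OF u, of q] D uD jd by auto
  obtain cm where cm: "ses C m cm" using mono_ses m by blast
  note cmD = sesD[OF cm]
  have A: "q' \<cdot> (n' \<cdot> e2) = m \<cdot> (p1 \<cdot> x)"
  proof -
    have "q' \<cdot> (u \<cdot> ?y) = q \<cdot> ?y" using comp_reduce[OF q'(4), of ?y] q' uD y jd by simp
    also have "\<dots> = m \<cdot> (p1 \<cdot> x)"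
      using assoc[of x p2 q] assoc[of x p1 m] p xa x D ma by simp
    finally show ?thesis using im by simp
  qed
  have "null C ((cm \<cdot> m) \<cdot> (p1 \<cdot> x))" using cmD p xa x by - (rule null_comp(2); simp)
  then have "null C (cm \<cdot> (m \<cdot> (p1 \<cdot> x)))" using cmD p xa x by simp
  then have "null C (cm \<cdot> (q' \<cdot> (n' \<cdot> e2)))" using A by simp
  then have "null C ((cm \<cdot> (q' \<cdot> n')) \<cdot> e2)" using cmD q' im im' m by simp
  then have "null C (cm \<cdot> (q' \<cdot> n'))"
    using epi_null[OF im(2), of "cm \<cdot> (q' \<cdot> n')"] cmD q' im im' m by simp
  then obtain r where r: "r \<in> arr C" "src C r = src C n'" "trg C r = src C m" "m \<cdot> r = q' \<cdot> n'"
    using ses_lift[OF cm, of "q' \<cdot> n'"] q' im im' m by auto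
  have "m \<cdot> (r \<cdot> e2) = m \<cdot> (p1 \<cdot> x)"
    using comp_reduce[OF r(4), of e2] A r im im' ma q' by simp
  then have re: "r \<cdot> e2 = p1 \<cdot> x"
    using r im im' p xa x ma by - (rule mono_cancel[OF m(1)]; simp)
  have "p \<cdot> (r \<cdot> e2) = (p \<cdot> p1) \<cdot> x" using re p xa x ma m by simp
  then have "is_epi C ((p \<cdot> r) \<cdot> e2)" using x(4) r im ma m by simp
  then have pr: "is_epi C (p \<cdot> r)" using epi_second[of e2 "p \<cdot> r"] r im ma m by simp
  have "series C S 0 (src C n')" using series_quotient[OF x(3) im(2)] im im' by simp
  then have I1: "series C S 1 (src C n')"
    using series_epi_simple[OF _ pr] r ma m S by simp
  obtain k' pp w where W: "ses C k' pp" "src C k' = src C (j \<cdot> d)" "trg C pp = src C n'"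
    "w \<in> arr C" "src C w = trg C k'" "trg C w = trg C (j \<cdot> d)" "is_mono C n' \<Longrightarrow> is_mono C w"
    using pullback_extension[OF u im(3) im'(1)] by metis
  have "series C S (n + 1) (trg C k')"
    using series_extension[OF I1 W(1,3)] W d jd by simp
  then show ?thesis
    unfolding mult_at_least_def using W im jd by (intro exI[of _ w]) simp
qed

end

section \<open>Costandard objects\<close>

context highest_weight_category
begin

text \<open>The objects of \<open>C[\<Gamma>]\<close> have this property when \<open>\<mu>\<close> is maximal in \<open>\<Gamma>\<close>; it is what keeps maps to \<open>I(\<mu>)\<close>
  inside \<open>\<nabla>(\<mu>)\<close>.\<close>

definition no_factor_above :: "'l \<Rightarrow> 'o \<Rightarrow> bool" where
  "no_factor_above \<mu> X \<longleftrightarrow> (\<forall>\<kappa>\<in>\<Lambda>. \<mu> < \<kappa> \<longrightarrow> \<not> has_factor C X (L \<kappa>))"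

lemma no_factor_above_sub: "no_factor_above \<mu> (trg C m) \<Longrightarrow> is_mono C m \<Longrightarrow> no_factor_above \<mu> (src C m)"
  using has_factor_sub by (auto simp: no_factor_above_def)

lemma no_factor_above_quotient:
  "no_factor_above \<mu> (src C q) \<Longrightarrow> is_epi C q \<Longrightarrow> no_factor_above \<mu> (trg C q)"
  using has_factor_quotient by (auto simp: no_factor_above_def)

lemma in_truncD: "in_trunc C \<Lambda> L \<Gamma> X \<Longrightarrow> \<kappa> \<in> \<Lambda> \<Longrightarrow> has_factor C X (L \<kappa>) \<Longrightarrow> \<kappa> \<in> \<Gamma>"
  using mult_nonzero_iff[OF simple_L] by (auto simp: in_trunc_def)

lemma in_truncI:
  "X \<in> obj C \<Longrightarrow> (\<And>\<kappa>. \<kappa> \<in> \<Lambda> \<Longrightarrow> has_factor C X (L \<kappa>) \<Longrightarrow> \<kappa> \<in> \<Gamma>) \<Longrightarrow> in_trunc C \<Lambda> L \<Gamma> X"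
  using mult_nonzero_iff[OF simple_L] by (auto simp: in_trunc_def)

lemma envelopeD:
  assumes "\<mu> \<in> \<Lambda>"
  shows "is_mono C (\<iota> \<mu>)" "\<iota> \<mu> \<in> arr C" "src C (\<iota> \<mu>) = L \<mu>" "injective_obj C (trg C (\<iota> \<mu>))"
    "essential C (\<iota> \<mu>)"
  using envelope[OF assms] mono_arr by (auto simp: injective_envelope_def essential_def)

lemma costandardD:
  assumes "\<mu> \<in> \<Lambda>"
  shows "is_mono C (\<nu> \<mu>)" "\<nu> \<mu> \<in> arr C" "src C (\<nu> \<mu>) = costandard C \<nu> \<mu>"
    "trg C (\<nu> \<mu>) = trg C (\<iota> \<mu>)" "costandard C \<nu> \<mu> \<in> obj C"
  using costandard_sub[OF assms] mono_arr by (auto simp: subobj_def costandard_def)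

lemma costandard_factor:
  assumes "\<mu> \<in> \<Lambda>" "\<kappa> \<in> \<Lambda>" "has_factor C (costandard C \<nu> \<mu>) (L \<kappa>)"
  shows "\<kappa> \<le> \<mu>"
  using in_truncD[OF costandard_trunc[OF assms(1)] assms(2,3)] by simp

text \<open>The intersection of a nonzero subobject with the simple object is nonzero by essentiality, hence all of it.\<close>

lemma envelope_least:
  assumes \<mu>: "\<mu> \<in> \<Lambda>" and n: "is_mono C n" "trg C n = trg C (\<iota> \<mu>)" "\<not> zero_obj C (src C n)"
  shows "sub_le C (\<iota> \<mu>) n"
proof -
  note i = envelopeD[OF \<mu>] and na = mono_arr[OF n(1)]
  obtain p q where pb: "is_pullback n (\<iota> \<mu>) p q" and "is_mono C n \<Longrightarrow> is_mono C q"
    using pullback[OF na i(2) n(2)] by metis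
  then have qm: "is_mono C q" using n by simp
  note D = is_pullbackD[OF pb]
  let ?w = "\<iota> \<mu> \<cdot> q"
  have "is_inter C (trg C (\<iota> \<mu>)) {\<iota> \<mu>, n} ?w"
    unfolding is_inter_def
  proof (intro conjI ballI allI impI)
    show "subobj C (trg C (\<iota> \<mu>)) ?w" using mono_comp[OF qm i(1)] D i by (simp add: subobj_def)
    show "sub_le C ?w x" if "x \<in> {\<iota> \<mu>, n}" for x
      using that sub_leI[of q "\<iota> \<mu>" ?w] sub_leI[of p n ?w] D i na by auto
    fix v assume v: "subobj C (trg C (\<iota> \<mu>)) v \<and> (\<forall>s\<in>{\<iota> \<mu>, n}. sub_le C v s)"
    then have "sub_le C v (\<iota> \<mu>)" "sub_le C v n" by auto
    obtain a where a: "a \<in> arr C" "src C a = src C v" "trg C a = src C n" "n \<cdot> a = v"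
      by (rule sub_leE[OF \<open>sub_le C v n\<close>])
    obtain b where b: "b \<in> arr C" "src C b = src C v" "trg C b = src C (\<iota> \<mu>)" "\<iota> \<mu> \<cdot> b = v"
      by (rule sub_leE[OF \<open>sub_le C v (\<iota> \<mu>)\<close>])
    obtain u where "u \<in> arr C" "src C u = src C a" "trg C u = src C p" "p \<cdot> u = a" "q \<cdot> u = b"
      using is_pullback_lift[OF pb, of a b] a b by auto
    then show "sub_le C v ?w" using a b D i by (intro sub_leI[of u]) simp_all
  qed
  then have "\<not> zero_obj C (src C ?w)"
    using i(5) n unfolding essential_def subobj_def by blast
  then have "\<not> zero_obj C (src C q)" using D i by simp
  then have "is_iso C q"
    using simple_L[OF \<mu>] qm D i by (auto simp: simple_obj_def subobj_def)
  then obtain g where g: "g \<in> arr C" "src C g = trg C q" "trg C g = src C q" "q \<cdot> g = \<one> (trg C q)"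
    using isoE by metis
  have "n \<cdot> (p \<cdot> g) = (\<iota> \<mu> \<cdot> q) \<cdot> g" using comp_reduce[OF D(6), of g] D g na by simp
  also have "\<dots> = \<iota> \<mu>" using g D i by simp
  finally show ?thesis using D g na by (intro sub_leI[of "p \<cdot> g"]) simp_all
qed

text \<open>The simple object has only itself as factor, so it lies in the largest subobject with factors \<open>L \<kappa>\<close>, \<open>\<kappa> \<le> \<mu>\<close>.\<close>

lemma socle:
  assumes \<mu>: "\<mu> \<in> \<Lambda>"
  obtains l where "is_mono C l" "l \<in> arr C" "src C l = L \<mu>" "trg C l = costandard C \<nu> \<mu>" "\<nu> \<mu> \<cdot> l = \<iota> \<mu>"
proof -
  note i = envelopeD[OF \<mu>] and c = costandardD[OF \<mu>]
  have "\<kappa> \<le> \<mu>" if "\<kappa> \<in> \<Lambda>" "has_factor C (L \<mu>) (L \<kappa>)" for \<kappa>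
    using has_factor_simple[OF simple_L[OF \<mu>] simple_L[OF that(1)] that(2)] L_nonisomorphic \<mu> that by blast
  then have "in_trunc C \<Lambda> L {\<kappa>. \<kappa> \<le> \<mu>} (src C (\<iota> \<mu>))"
    using i simple_obj[OF simple_L[OF \<mu>]] by (intro in_truncI) simp_all
  then have "sub_le C (\<iota> \<mu>) (\<nu> \<mu>)"
    using costandard_largest[OF \<mu>] i by (simp add: subobj_def)
  then obtain l where l: "l \<in> arr C" "src C l = L \<mu>" "trg C l = costandard C \<nu> \<mu>" "\<nu> \<mu> \<cdot> l = \<iota> \<mu>"
    using sub_leE[of "\<iota> \<mu>" "\<nu> \<mu>"] i c by metis
  then show ?thesis using that[of l] mono_first[of l "\<nu> \<mu>"] i c by simp
qed

lemma socle_quotient_factor: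
  assumes \<mu>: "\<mu> \<in> \<Lambda>" and l: "\<nu> \<mu> \<cdot> l = \<iota> \<mu>" "ses C l c" "trg C l = costandard C \<nu> \<mu>"
    and \<kappa>: "\<kappa> \<in> \<Lambda>" "has_factor C (trg C c) (L \<kappa>)"
  shows "\<kappa> < \<mu>"
proof -
  have "is_quotient C (\<iota> \<mu>) (\<nu> \<mu>) (trg C c)"
    using costandardD[OF \<mu>] l by (intro is_quotientI[OF l(2)]) simp_all
  then have "in_trunc C \<Lambda> L {\<kappa>. \<kappa> < \<mu>} (trg C c)"
    by (rule costandard_quotient[OF \<mu>])
  then show ?thesis using in_truncD \<kappa> by blast
qed

text \<open>The socle inclusion \<open>l\<close> factors through every nonzero subobject because \<open>\<iota>\<close> does. An arbitrary nonzero
  \<open>a\<close> is itself such a subobject, so it differs from \<open>l\<close> by an automorphism of the simple object.\<close>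

lemma costandard_sub_least:
  assumes \<mu>: "\<mu> \<in> \<Lambda>" and y: "is_mono C y" "trg C y = costandard C \<nu> \<mu>" "\<not> zero_obj C (src C y)"
    and a: "a \<in> hom C (L \<mu>) (costandard C \<nu> \<mu>)"
  shows "sub_le C a y"
proof -
  note i = envelopeD[OF \<mu>] and c = costandardD[OF \<mu>]
  obtain l where l: "is_mono C l" "l \<in> arr C" "src C l = L \<mu>" "trg C l = costandard C \<nu> \<mu>" "\<nu> \<mu> \<cdot> l = \<iota> \<mu>"
    using socle[OF \<mu>] by metis
  have least: "\<exists>r. r \<in> arr C \<and> src C r = L \<mu> \<and> trg C r = src C z \<and> z \<cdot> r = l"
    if z: "is_mono C z" "trg C z = costandard C \<nu> \<mu>" "\<not> zero_obj C (src C z)" for z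
  proof -
    note za = mono_arr[OF z(1)]
    have "sub_le C (\<iota> \<mu>) (\<nu> \<mu> \<cdot> z)"
      using envelope_least[OF \<mu>, of "\<nu> \<mu> \<cdot> z"] mono_comp[OF z(1) c(1)] z c za by simp
    then obtain r where r: "r \<in> arr C" "src C r = L \<mu>" "trg C r = src C z" "(\<nu> \<mu> \<cdot> z) \<cdot> r = \<iota> \<mu>"
      using sub_leE[of "\<iota> \<mu>" "\<nu> \<mu> \<cdot> z"] i c z za by (metis comp_arr(2))
    have "\<nu> \<mu> \<cdot> (z \<cdot> r) = \<nu> \<mu> \<cdot> l" using r l za z c by simp
    then have "z \<cdot> r = l" using r l za z c by - (rule mono_cancel[OF c(1)]; simp)
    then show ?thesis using r by blast
  qed
  obtain r where r: "r \<in> arr C" "src C r = L \<mu>" "trg C r = src C y" "y \<cdot> r = l"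
    using least[OF y] by blast
  note ya = mono_arr[OF y(1)]
  show ?thesis
  proof (cases "null C a")
    case True
    let ?z = "hzero C (L \<mu>) (src C y)"
    have z: "?z \<in> arr C" "src C ?z = L \<mu>" "trg C ?z = src C y" "null C ?z"
      using ya simple_obj[OF simple_L[OF \<mu>]] by simp_all
    have "null C (y \<cdot> ?z)" using z ya by - (rule null_comp(1); simp)
    then have "y \<cdot> ?z = a" using True z ya a y by - (rule null_eq; simp)
    then show ?thesis using z ya by (intro sub_leI[of ?z]) simp_all
  next
    case False
    then have am: "is_mono C a" using simple_mono[of a] a simple_L[OF \<mu>] by simp
    have "\<not> zero_obj C (src C a)" using mono_null_src[OF am] False by simp
    then obtain r2 where r2: "r2 \<in> arr C" "src C r2 = L \<mu>" "trg C r2 = L \<mu>" "a \<cdot> r2 = l"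
      using least[of a] am a by auto
    have "\<not> null C (a \<cdot> r2)" using simple_mono_nonzero[of l] l r2 simple_L[OF \<mu>] by simp
    then have "\<not> null C r2" using nonzero_image[of a r2] a r2 by simp
    then have "is_iso C r2" using simple_nonzero_iso[of r2] r2 simple_L[OF \<mu>] by simp
    then obtain g where g: "g \<in> arr C" "src C g = L \<mu>" "trg C g = L \<mu>" "r2 \<cdot> g = \<one> (L \<mu>)"
      using isoE[of r2] r2 by metis
    have "y \<cdot> (r \<cdot> g) = l \<cdot> g" using comp_reduce[OF r(4), of g] r g ya by simp
    also have "\<dots> = a \<cdot> (r2 \<cdot> g)" using comp_reduce[OF r2(4), of g] r2 g a by simp
    also have "\<dots> = a" using g a by simp
    finally show ?thesis using r g ya by (intro sub_leI[of "r \<cdot> g"]) simp_all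
  qed
qed

lemma costandard_sub_factor:
  assumes \<mu>: "\<mu> \<in> \<Lambda>" and y: "is_mono C y" "trg C y = costandard C \<nu> \<mu>" "\<not> zero_obj C (src C y)"
  shows "has_factor C (src C y) (L \<mu>)"
proof -
  obtain l where l: "is_mono C l" "l \<in> arr C" "src C l = L \<mu>" "trg C l = costandard C \<nu> \<mu>"
    using socle[OF \<mu>] by metis
  then have "sub_le C l y" using costandard_sub_least[OF \<mu> y] by simp
  then obtain r where r: "r \<in> arr C" "src C r = L \<mu>" "trg C r = src C y" "y \<cdot> r = l"
    using sub_leE l by metis
  then have "is_mono C r" using mono_first[of r y] l mono_arr[OF y(1)] by simp
  then show ?thesis using has_factor_of_mono[of r] r by simp
qed

text \<open>\<open>J\<close> is the first stage of the filtration of the injective envelope. The later steps are costandard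
  objects with socle above \<open>\<mu>\<close>, so an object without factors above \<open>\<mu>\<close> cannot reach into them.\<close>

lemma costandard_bottom:
  assumes \<mu>: "\<mu> \<in> \<Lambda>"
  obtains J where "is_mono C J" "J \<in> arr C" "src C J = costandard C \<nu> \<mu>" "trg C J = trg C (\<iota> \<mu>)"
    "\<And>b. is_mono C b \<Longrightarrow> trg C b = trg C (\<iota> \<mu>) \<Longrightarrow> no_factor_above \<mu> (src C b) \<Longrightarrow> sub_le C b J"
proof -
  obtain N F w where F: "incr_chain C (trg C (\<iota> \<mu>)) N F" and N: "1 \<le> N"
    and iso: "isomorphic C (src C (F 1)) (costandard C \<nu> \<mu>)"
    and w: "\<forall>k. 1 < k \<and> enat k \<le> N \<longrightarrow> w k \<in> \<Lambda> \<and> \<mu> < w k \<and>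
           is_quotient C (F (k - 1)) (F k) (costandard C \<nu> (w k))"
    using envelope_filtration[OF \<mu>] by (elim exE conjE) (rule that; assumption)
  have F1: "is_mono C (F 1)" "trg C (F 1) = trg C (\<iota> \<mu>)" "F 1 \<in> arr C"
    using incr_chainD(1,2)[OF F, of 1] N mono_arr by (auto simp: one_enat_def)
  obtain f where f: "is_iso C f" "f \<in> arr C" "src C f = src C (F 1)" "trg C f = costandard C \<nu> \<mu>"
    using iso isomorphicE by metis
  obtain g where g: "g \<in> arr C" "src C g = costandard C \<nu> \<mu>" "trg C g = src C (F 1)"
    "g \<cdot> f = \<one> (src C (F 1))" "is_iso C g"
    using isoE[OF f(1)] f by metis
  have le: "sub_le C (F 1) (F 1 \<cdot> g)"
    using f g F1 by (intro sub_leI[of f]) simp_all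
  show ?thesis
  proof (rule that[of "F 1 \<cdot> g"])
    show "is_mono C (F 1 \<cdot> g)" using mono_comp[of g "F 1"] iso_mono_epi(1)[OF g(5)] F1 g by simp
    fix b assume b: "is_mono C b" "trg C b = trg C (\<iota> \<mu>)" "no_factor_above \<mu> (src C b)"
    have "sub_le C b (F 1)"
    proof (rule chain_bottom[OF F N b(1,2), where Q = "\<lambda>k. costandard C \<nu> (w k)"])
      fix k x y assume k: "1 < k" "enat k \<le> N" and x: "is_mono C x" "trg C x = src C b"
        and y: "y \<in> hom C (src C x) (costandard C \<nu> (w k))"
      have wk: "w k \<in> \<Lambda>" "\<mu> < w k" using w k by auto
      show "null C y"
      proof (rule ccontr)
        assume ny: "\<not> null C y"
        obtain m e where m: "is_mono C m" "is_epi C e" "m \<in> arr C" "e \<in> arr C" "trg C m = trg C y"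
          "src C e = src C y" "src C m = trg C e" "m \<cdot> e = y"
          using image[of y] y by auto
        have "\<not> null C m" using nonzero_image(1)[of m e] m ny by simp
        then have "has_factor C (src C m) (L (w k))"
          using costandard_sub_factor[OF wk(1) m(1)] m y mono_null_src[OF m(1)] by simp
        then have "has_factor C (src C x) (L (w k))" using has_factor_quotient[OF m(2)] m y by simp
        then have "has_factor C (src C b) (L (w k))" using has_factor_sub[OF x(1)] x by simp
        then show False using b(3) wk by (auto simp: no_factor_above_def)
      qed
    qed (use w in blast)
    then show "sub_le C b (F 1 \<cdot> g)"
      using sub_le_trans[OF _ le] F1 g by simp
  qed (use F1 g in simp_all)
qed

text \<open>Extend into the injective envelope; the image has no factors above \<open>\<mu>\<close> and lies in the bottom stage.\<close>

lemma costandard_relatively_injective: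
  assumes \<mu>: "\<mu> \<in> \<Lambda>" and i: "is_mono C i" and Y: "no_factor_above \<mu> (trg C i)"
    and g: "g \<in> hom C (src C i) (costandard C \<nu> \<mu>)"
  shows "\<exists>h\<in>hom C (trg C i) (costandard C \<nu> \<mu>). h \<cdot> i = g"
proof -
  note ia = mono_arr[OF i]
  obtain J where J: "is_mono C J" "J \<in> arr C" "src C J = costandard C \<nu> \<mu>" "trg C J = trg C (\<iota> \<mu>)"
    and Jb: "\<And>b. is_mono C b \<Longrightarrow> trg C b = trg C (\<iota> \<mu>) \<Longrightarrow> no_factor_above \<mu> (src C b) \<Longrightarrow> sub_le C b J"
    using costandard_bottom[OF \<mu>] by metis
  have "J \<cdot> g \<in> hom C (src C i) (trg C (\<iota> \<mu>))" using J g by simp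
  then obtain h' where h': "h' \<in> arr C" "src C h' = trg C i" "trg C h' = trg C (\<iota> \<mu>)" "h' \<cdot> i = J \<cdot> g"
    using envelopeD(4)[OF \<mu>] i unfolding injective_obj_def Bex_def hom_iff by metis
  obtain m e where m: "is_mono C m" "is_epi C e" "m \<in> arr C" "e \<in> arr C" "trg C m = trg C h'"
    "src C e = src C h'" "src C m = trg C e" "m \<cdot> e = h'"
    using image[OF h'(1)] by metis
  have "no_factor_above \<mu> (src C m)" using no_factor_above_quotient[of \<mu> e] Y m h' by simp
  then have "sub_le C m J" using Jb[OF m(1)] m h' by simp
  then obtain u where u: "u \<in> arr C" "src C u = src C m" "trg C u = src C J" "J \<cdot> u = m"
    using sub_leE by metis
  have "J \<cdot> ((u \<cdot> e) \<cdot> i) = J \<cdot> g"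
    using comp_reduce[OF u(4), of "e \<cdot> i"] comp_reduce[OF m(8), of i] u m h' ia J by simp
  then have "(u \<cdot> e) \<cdot> i = g"
    using u m h' ia J g by - (rule mono_cancel[OF J(1)]; simp)
  then show ?thesis using u m h' J by (intro bexI[of _ "u \<cdot> e"]) simp_all
qed

end

context standing_highest_weight_category
begin

abbreviation costandards :: "'o set" where "costandards \<equiv> costandard C \<nu> ` \<Lambda>"

text \<open>Extend the inclusion of \<open>L \<mu>\<close> into its envelope to an object of finite length; the image lies in some
  stage of the filtration. This stage is a finite stand-in for the envelope, and it can be dualized.\<close>

lemma finite_costandard_target:
  assumes \<mu>: "\<mu> \<in> \<Lambda>" and E: "series C S 0 (trg C a)" and a: "is_mono C a" "src C a = L \<mu>"
  obtains G h where "filtered_by (opp C) costandards G" "series C S 0 G" "h \<in> hom C (trg C a) G"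
    "\<not> null C (h \<cdot> a)"
proof -
  note i = envelopeD[OF \<mu>] and aa = mono_arr[OF a(1)]
  obtain N F w where F: "incr_chain C (trg C (\<iota> \<mu>)) N F" and N: "1 \<le> N"
    and iso: "isomorphic C (src C (F 1)) (costandard C \<nu> \<mu>)"
    and w: "\<forall>k. 1 < k \<and> enat k \<le> N \<longrightarrow> w k \<in> \<Lambda> \<and> \<mu> < w k \<and>
           is_quotient C (F (k - 1)) (F k) (costandard C \<nu> (w k))"
    using envelope_filtration[OF \<mu>] by (elim exE conjE) (rule that; assumption)
  have costd_fin: "series C S 0 (costandard C \<nu> \<kappa>)" if "\<kappa> \<in> \<Lambda>" for \<kappa>
    using costandard_finite[OF that] finite_length_iff by blast
  have G: "filtered_by (opp C) costandards (src C (F k)) \<and> series C S 0 (src C (F k))" if "enat k \<le> N" for k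
    using that
  proof (induction k)
    case 0
    have "zero_obj C (src C (F 0))" by (rule incr_chainD(3)[OF F])
    then show ?case by (simp add: filtered_by.zero series.zero)
  next
    case (Suc k)
    show ?case
    proof (cases "k = 0")
      case True
      obtain f where f: "is_iso C f" "f \<in> arr C" "src C f = src C (F 1)" "trg C f = costandard C \<nu> \<mu>"
        using iso isomorphicE by metis
      obtain z where z: "ses C z f" using epi_ses iso_mono_epi(2)[OF f(1)] by blast
      note D = sesD[OF z]
      have "null C z" using D mono_null[OF iso_mono_epi(1)[OF f(1)], of z] by simp
      then have "zero_obj C (src C z)" using mono_null_src[of z] D by simp
      then have "filtered_by (opp C) costandards (trg (opp C) z)" by (simp add: filtered_by.zero)
      then have "filtered_by (opp C) costandards (trg (opp C) f)"
        using z f \<mu> by (intro filtered_by.ext[of _ _ z f]) simp_all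
      moreover have "series C S 0 (src C (F 1))"
        using series_iso[OF costd_fin[OF \<mu>] isomorphic_sym[OF iso]] .
      ultimately show ?thesis using True f by simp
    next
      case False
      have k: "enat k \<le> N" using Suc.prems(1) by (meson Suc_ile_eq order_less_imp_le)
      have wk: "w (Suc k) \<in> \<Lambda>" and qk: "is_quotient C (F k) (F (Suc k)) (costandard C \<nu> (w (Suc k)))"
        using w[rule_format, of "Suc k"] False Suc by simp_all
      obtain j q where j: "ses C j q" "src C j = src C (F k)" "trg C j = src C (F (Suc k))"
        "trg C q = costandard C \<nu> (w (Suc k))"
        using is_quotientE[OF qk] incr_chainD(1)[OF F] k Suc by metis
      have IH: "filtered_by (opp C) costandards (src C (F k))" "series C S 0 (src C (F k))" using Suc k by simp_all
      have "filtered_by (opp C) costandards (trg (opp C) q)"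
        using j IH wk by (intro filtered_by.ext[of _ _ j q]) simp_all
      moreover have "series C S (0 + 0) (trg C j)"
        using j IH costd_fin[OF wk] by (intro series_extension[OF _ j(1)]) simp_all
      ultimately show ?thesis using j sesD[OF j(1)] by simp
    qed
  qed
  have "\<iota> \<mu> \<in> hom C (src C a) (trg C (\<iota> \<mu>))" using i a by simp
  then obtain h' where h': "h' \<in> arr C" "src C h' = trg C a" "trg C h' = trg C (\<iota> \<mu>)" "h' \<cdot> a = \<iota> \<mu>"
    using i(4) a unfolding injective_obj_def Bex_def hom_iff by metis
  obtain m e where m: "is_mono C m" "is_epi C e" "m \<in> arr C" "e \<in> arr C" "trg C m = trg C h'"
    "src C e = src C h'" "src C m = trg C e" "m \<cdot> e = h'"
    using image[OF h'(1)] by metis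
  have "series C S 0 (src C m)" using series_quotient[OF E m(2)] m h' by simp
  then obtain k where k: "enat k \<le> N" "sub_le C m (F k)"
    using finite_in_stage[OF F _ m(1)] m h' by metis
  obtain u where u: "u \<in> arr C" "src C u = src C m" "trg C u = src C (F k)" "F k \<cdot> u = m"
    by (rule sub_leE[OF k(2)])
  have Fk: "F k \<in> arr C" using incr_chainD(1)[OF F k(1)] mono_arr by blast
  have "F k \<cdot> ((u \<cdot> e) \<cdot> a) = \<iota> \<mu>"
    using comp_reduce[OF u(4), of "e \<cdot> a"] comp_reduce[OF m(8), of a] u m h' aa Fk by simp
  moreover have "\<not> null C (\<iota> \<mu>)" using simple_mono_nonzero[of "\<iota> \<mu>"] i simple_L[OF \<mu>] by simp
  ultimately have "\<not> null C ((u \<cdot> e) \<cdot> a)"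
    using nonzero_image(2)[of "F k" "(u \<cdot> e) \<cdot> a"] u m h' aa Fk by simp
  then show ?thesis
    using that[of "src C (F k)" "u \<cdot> e"] G[OF k(1)] u m h' by simp
qed

end

section \<open>Dualities on objects of finite length\<close>

text \<open>A contravariant self-equivalence \<open>T\<close> with quasi-inverse \<open>S\<close>. The roles can be exchanged, so each lemma
  also holds for \<open>S\<close>.\<close>

locale finite_duality = abelian_linear_category C
  for C :: "('o, 'a, 'k::field) lincat" (structure) +
  fixes T :: "'o \<Rightarrow> 'o" and t :: "'a \<Rightarrow> 'a" and S :: "'o \<Rightarrow> 'o" and s :: "'a \<Rightarrow> 'a"
  assumes T: "contra_functor C {X. finite_length C X} T t"
    and S: "contra_functor C {X. finite_length C X} S s"
    and ST: "nat_iso_to_identity C {X. finite_length C X} (S \<circ> T) (s \<circ> t)"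
    and TS: "nat_iso_to_identity C {X. finite_length C X} (T \<circ> S) (t \<circ> s)"
begin

abbreviation fin :: "'o \<Rightarrow> bool" where "fin \<equiv> finite_length C"

lemma swap: "finite_duality C S s T t"
  using T S ST TS by unfold_locales

lemma fin_sub: "is_mono C m \<Longrightarrow> fin (trg C m) \<Longrightarrow> fin (src C m)"
  using series_sub[of undefined 0 "trg C m" m] finite_length_iff by blast

lemma fin_quotient: "is_epi C e \<Longrightarrow> fin (src C e) \<Longrightarrow> fin (trg C e)"
  using series_quotient[of undefined 0 "src C e" e] finite_length_iff by blast

lemma fin_iso: "isomorphic C X Y \<Longrightarrow> fin X \<Longrightarrow> fin Y"
  using series_iso[of undefined 0 X Y] finite_length_iff by blast

lemma fin_T: "fin X \<Longrightarrow> fin (T X)"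
  using T by (simp add: contra_functor_def)

lemma fin_S: "fin X \<Longrightarrow> fin (S X)"
  using S by (simp add: contra_functor_def)

lemma t_arr:
  assumes "f \<in> arr C" "fin (src C f)" "fin (trg C f)"
  shows "t f \<in> arr C" "src C (t f) = T (trg C f)" "trg C (t f) = T (src C f)"
proof -
  have "t f \<in> hom C (T (trg C f)) (T (src C f))"
    using T assms unfolding contra_functor_def by (metis hom_iff mem_Collect_eq)
  then show "t f \<in> arr C" "src C (t f) = T (trg C f)" "trg C (t f) = T (src C f)" by simp_all
qed

lemma t_id: "fin X \<Longrightarrow> t (\<one> X) = \<one> (T X)"
  using T by (simp add: contra_functor_def)

lemma t_comp:
  assumes "f \<in> arr C" "g \<in> arr C" "src C g = trg C f" "fin (src C f)" "fin (trg C f)" "fin (trg C g)"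
  shows "t (g \<cdot> f) = t f \<cdot> t g"
proof -
  have "\<forall>X\<in>{X. fin X}. \<forall>Y\<in>{X. fin X}. \<forall>Z\<in>{X. fin X}. \<forall>f\<in>hom C X Y. \<forall>g\<in>hom C Y Z. t (g \<cdot> f) = t f \<cdot> t g"
    using T unfolding contra_functor_def by blast
  then show ?thesis using assms by simp
qed

lemma unit:
  obtains \<eta> where "\<forall>X. fin X \<longrightarrow> is_iso C (\<eta> X) \<and> \<eta> X \<in> hom C X (S (T X))"
    "\<forall>f. f \<in> arr C \<and> fin (src C f) \<and> fin (trg C f) \<longrightarrow> s (t f) \<cdot> \<eta> (src C f) = \<eta> (trg C f) \<cdot> f"
proof -
  obtain \<eta> where e: "\<forall>X\<in>{X. fin X}. \<eta> X \<in> hom C X ((S \<circ> T) X) \<and> is_iso C (\<eta> X)"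
    and n: "\<forall>X\<in>{X. fin X}. \<forall>Y\<in>{X. fin X}. \<forall>f\<in>hom C X Y. (s \<circ> t) f \<cdot> \<eta> X = \<eta> Y \<cdot> f"
    using ST unfolding nat_iso_to_identity_def by blast
  show ?thesis
    by (rule that[of \<eta>]) (use e n in simp_all)
qed

lemma faithful:
  assumes "f \<in> arr C" "g \<in> arr C" "src C f = src C g" "trg C f = trg C g" "fin (src C g)" "fin (trg C g)"
    "t f = t g"
  shows "f = g"
proof -
  obtain \<eta> where e: "\<forall>X. fin X \<longrightarrow> is_iso C (\<eta> X) \<and> \<eta> X \<in> hom C X (S (T X))"
    and n: "\<forall>f. f \<in> arr C \<and> fin (src C f) \<and> fin (trg C f) \<longrightarrow> s (t f) \<cdot> \<eta> (src C f) = \<eta> (trg C f) \<cdot> f"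
    by (rule unit)
  have iso: "is_iso C (\<eta> X)" and h: "\<eta> X \<in> hom C X (S (T X))" if "fin X" for X
    using e that by blast+
  have nat: "s (t f) \<cdot> \<eta> (src C f) = \<eta> (trg C f) \<cdot> f"
    if "f \<in> arr C" "fin (src C f)" "fin (trg C f)" for f
    using n that by blast
  have "\<eta> (trg C g) \<cdot> f = \<eta> (trg C g) \<cdot> g"
    using nat[of f] nat[of g] assms by simp
  then show ?thesis
    using assms h[of "trg C g"] by - (rule mono_cancel[OF iso_mono_epi(1)[OF iso[of "trg C g"]]]; simp)
qed

lemma unit_obj:
  assumes "fin X"
  obtains e where "is_iso C e" "e \<in> arr C" "src C e = X" "trg C e = S (T X)"
  using unit assms by (metis hom_iff)

text \<open>Conjugate \<open>s h\<close> with the unit; that \<open>t\<close> maps the result to \<open>h\<close> follows from faithfulness of \<open>s\<close>.\<close>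

lemma full:
  assumes XY: "fin X" "fin Y" and h: "h \<in> arr C" "src C h = T Y" "trg C h = T X"
  obtains f where "f \<in> arr C" "src C f = X" "trg C f = Y" "t f = h"
proof -
  interpret o: finite_duality C S s T t by (rule swap)
  obtain \<eta> where e: "\<forall>X. fin X \<longrightarrow> is_iso C (\<eta> X) \<and> \<eta> X \<in> hom C X (S (T X))"
    and n: "\<forall>f. f \<in> arr C \<and> fin (src C f) \<and> fin (trg C f) \<longrightarrow> s (t f) \<cdot> \<eta> (src C f) = \<eta> (trg C f) \<cdot> f"
    by (rule unit)
  have iso: "is_iso C (\<eta> X)" and et: "\<eta> X \<in> hom C X (S (T X))" if "fin X" for X
    using e that by blast+
  have nat: "s (t f) \<cdot> \<eta> (src C f) = \<eta> (trg C f) \<cdot> f"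
    if "f \<in> arr C" "fin (src C f)" "fin (trg C f)" for f
    using n that by blast
  have sh: "s h \<in> arr C" "src C (s h) = S (T X)" "trg C (s h) = S (T Y)"
    using o.t_arr[OF h(1)] h fin_T XY by simp_all
  have X: "\<eta> X \<in> arr C" "src C (\<eta> X) = X" "trg C (\<eta> X) = S (T X)" "is_iso C (\<eta> X)"
    and Y: "\<eta> Y \<in> arr C" "src C (\<eta> Y) = Y" "trg C (\<eta> Y) = S (T Y)" "is_iso C (\<eta> Y)"
    using et iso XY by simp_all
  obtain g where g: "g \<in> arr C" "src C g = S (T Y)" "trg C g = Y" "\<eta> Y \<cdot> g = \<one> (S (T Y))"
    using isoE[OF Y(4)] Y by metis
  let ?f = "g \<cdot> (s h \<cdot> \<eta> X)"
  have f: "?f \<in> arr C" "src C ?f = X" "trg C ?f = Y" using g sh X by simp_all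
  have "s (t ?f) \<cdot> \<eta> X = \<eta> Y \<cdot> ?f" using nat[OF f(1)] f XY by simp
  also have "\<dots> = s h \<cdot> \<eta> X"
    using comp_reduce[OF g(4), of "s h \<cdot> \<eta> X"] g sh X Y by simp
  finally have e: "s (t ?f) \<cdot> \<eta> X = s h \<cdot> \<eta> X" .
  have tf: "t ?f \<in> arr C" "src C (t ?f) = T Y" "trg C (t ?f) = T X" using t_arr[OF f(1)] f XY by simp_all
  have stf: "s (t ?f) \<in> arr C" "src C (s (t ?f)) = S (T X)" "trg C (s (t ?f)) = S (T Y)"
    using o.t_arr[OF tf(1)] tf XY fin_T by simp_all
  have "s (t ?f) = s h"
    using e stf sh X by - (rule epi_cancel[OF iso_mono_epi(2)[OF X(4)]]; simp)
  then have "t ?f = h"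
    using tf h XY fin_T by - (rule o.faithful; simp)
  then show ?thesis using that[of ?f] f by simp
qed

lemma zero_fin: "zero_obj C Z \<Longrightarrow> fin Z"
  using series.zero[of C Z undefined] finite_length_iff by blast

text \<open>The functor is not known to be additive, so zero arrows are recognized through the zero object: the zero
  endomorphism of \<open>T Z\<close> comes from the only endomorphism of \<open>Z\<close>, the identity.\<close>

lemma t_zero_obj:
  assumes Z: "zero_obj C Z"
  shows "zero_obj C (T Z)"
proof -
  have fz: "fin Z" "fin (T Z)" and Zo: "Z \<in> obj C" using zero_fin[OF Z] fin_T Z by (simp_all add: zero_obj_iff_null)
  have TZ: "T Z \<in> obj C" using fz by (simp add: finite_length_def)
  let ?h = "hzero C (T Z) (T Z)"
  obtain f where f: "f \<in> arr C" "src C f = Z" "trg C f = Z" "t f = ?h"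
    using full[of Z Z ?h] fz TZ by auto
  have "null C f" "null C (\<one> Z)" using null_of_zero_obj[of f] f Z by (simp_all add: zero_obj_iff_null)
  then have "f = \<one> Z" using f Zo by - (rule null_eq; simp)
  then have "\<one> (T Z) = ?h" using f t_id fz by simp
  then have "null C (\<one> (T Z))" using null_zero[OF TZ TZ] by metis
  then show ?thesis using TZ by (simp add: zero_obj_iff_null)
qed

lemma t_null:
  assumes f: "f \<in> arr C" "fin (src C f)" "fin (trg C f)"
  shows "null C (t f) \<longleftrightarrow> null C f"
proof -
  have A: "null C (t g)" if g: "g \<in> arr C" "fin (src C g)" "fin (trg C g)" "null C g" for g
  proof -
    obtain Z where Z: "zero_obj C Z" using ex_zero by blast
    then have Zo: "Z \<in> obj C" "fin Z" using zero_fin by (simp_all add: zero_obj_iff_null)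
    let ?a = "hzero C (src C g) Z" and ?b = "hzero C Z (trg C g)"
    have ab: "?a \<in> arr C" "?b \<in> arr C" "src C ?a = src C g" "trg C ?a = Z" "src C ?b = Z"
      "trg C ?b = trg C g" using g Zo by simp_all
    have "null C (?b \<cdot> ?a)" using ab Zo g by - (rule null_comp(2); simp)
    then have "g = ?b \<cdot> ?a" using ab g by - (rule null_eq; simp)
    then have tg: "t g = t ?a \<cdot> t ?b" using t_comp[OF ab(1,2)] ab g Zo by simp
    have ta: "t ?a \<in> arr C" "src C (t ?a) = T Z" "t ?b \<in> arr C" "trg C (t ?b) = T Z"
      using t_arr[OF ab(1)] t_arr[OF ab(2)] ab g Zo by simp_all
    then have "null C (t ?a)" using null_of_zero_obj[of "t ?a"] t_zero_obj[OF Z] by simp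
    then show ?thesis unfolding tg using ta by - (rule null_comp(2); simp)
  qed
  show ?thesis
  proof
    assume n: "null C (t f)"
    let ?z = "hzero C (src C f) (trg C f)"
    have z: "?z \<in> arr C" "src C ?z = src C f" "trg C ?z = trg C f" "null C ?z" using f by simp_all
    have "null C (t ?z)" using A[of ?z] z f by simp
    then have "t f = t ?z" using n t_arr[OF f] t_arr[of ?z] z f by - (rule null_eq; simp)
    then have "f = ?z" using z f by - (rule faithful; simp)
    then show "null C f" using z by metis
  qed (use A f in blast)
qed

text \<open>A kernel formed in the whole category has finite length, so up to isomorphism it is in the image of the
  functor. This and its dual \<open>from_T\<close> reduce exactness properties of \<open>t\<close>, tested against all objects, to
  properties of arrows between objects of finite length.\<close>

lemma into_T:
  assumes X: "fin X" and k: "k \<in> arr C" "trg C k = T X" "fin (src C k)"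
  obtains Y f e where "fin Y" "f \<in> arr C" "src C f = X" "trg C f = Y" "is_iso C e" "e \<in> arr C"
    "src C e = src C k" "trg C e = T Y" "k = t f \<cdot> e" "t f \<in> arr C" "src C (t f) = T Y" "trg C (t f) = T X"
proof -
  interpret o: finite_duality C S s T t by (rule swap)
  obtain e where e: "is_iso C e" "e \<in> arr C" "src C e = src C k" "trg C e = T (S (src C k))"
    using o.unit_obj[OF k(3)] by metis
  obtain g where g: "g \<in> arr C" "src C g = trg C e" "trg C g = src C e" "g \<cdot> e = \<one> (src C e)"
    using isoE[OF e(1)] by metis
  obtain f where f: "f \<in> arr C" "src C f = X" "trg C f = S (src C k)" "t f = k \<cdot> g"
    using full[of X "S (src C k)" "k \<cdot> g"] X fin_S k g e by auto
  have "k = (k \<cdot> g) \<cdot> e" using g e k by simp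
  then have kf: "k = t f \<cdot> e" by (simp only: f)
  have "t f \<in> arr C" "src C (t f) = T (S (src C k))" "trg C (t f) = T X"
    using t_arr[OF f(1)] f(2,3) X fin_S[OF k(3)] by simp_all
  then show ?thesis
    by (rule that[OF fin_S[OF k(3)] f(1-3) e kf])
qed

lemma from_T:
  assumes X: "fin X" and k: "k \<in> arr C" "src C k = T X" "fin (trg C k)"
  obtains Y f e where "fin Y" "f \<in> arr C" "trg C f = X" "src C f = Y" "is_iso C e" "e \<in> arr C"
    "trg C e = trg C k" "src C e = T Y" "k = e \<cdot> t f" "t f \<in> arr C" "src C (t f) = T X" "trg C (t f) = T Y"
proof -
  interpret o: finite_duality C S s T t by (rule swap)
  obtain e where e: "is_iso C e" "e \<in> arr C" "src C e = trg C k" "trg C e = T (S (trg C k))"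
    using o.unit_obj[OF k(3)] by metis
  obtain g where g: "g \<in> arr C" "src C g = trg C e" "trg C g = src C e" "g \<cdot> e = \<one> (src C e)" "is_iso C g"
    using isoE[OF e(1)] by metis
  have ek: "e \<cdot> k \<in> arr C" "src C (e \<cdot> k) = T X" "trg C (e \<cdot> k) = T (S (trg C k))" using e k by simp_all
  obtain f where f: "f \<in> arr C" "src C f = S (trg C k)" "trg C f = X" "t f = e \<cdot> k"
    by (rule full[OF fin_S[OF k(3)] X ek])
  have "g \<cdot> (e \<cdot> k) = (g \<cdot> e) \<cdot> k" using g(1,2) e(2,3) k(1) by simp
  also have "\<dots> = k" unfolding g(4) using e(3) k(1) by simp
  finally have "g \<cdot> (e \<cdot> k) = k" .
  then have kf: "k = g \<cdot> t f" by (simp only: f)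
  have gk: "trg C g = trg C k" "src C g = T (S (trg C k))" using g e by simp_all
  have "t f \<in> arr C" "src C (t f) = T X" "trg C (t f) = T (S (trg C k))"
    using t_arr[OF f(1)] f(2,3) X fin_S[OF k(3)] by simp_all
  then show ?thesis
    by (rule that[OF fin_S[OF k(3)] f(1,3,2) g(5,1) gk kf])
qed

lemma t_epi:
  assumes q: "is_epi C q" "fin (src C q)"
  shows "is_mono C (t q)"
proof -
  note qa = epi_arr[OF q(1)]
  have f: "fin (trg C q)" using fin_quotient q by blast
  note tq = t_arr[OF qa q(2) f]
  obtain k where kk: "is_kernel C k (t q)" and k: "is_mono C k" "k \<in> arr C" "trg C k = src C (t q)"
    "null C (t q \<cdot> k)"
    using kernelE[OF tq(1)] by metis
  have fk: "fin (src C k)" using fin_sub[OF k(1)] k tq f fin_T by simp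
  have k3: "trg C k = T (trg C q)" using k tq by simp
  obtain Y g e where g: "fin Y" "g \<in> arr C" "src C g = trg C q" "trg C g = Y" "is_iso C e" "e \<in> arr C"
    "src C e = src C k" "trg C e = T Y" "k = t g \<cdot> e" "t g \<in> arr C" "src C (t g) = T Y" "trg C (t g) = T (trg C q)"
    by (rule into_T[OF f k(2) k3 fk])
  have "null C ((t q \<cdot> t g) \<cdot> e)" using k g tq by simp
  then have "null C (t q \<cdot> t g)"
    using epi_null[OF iso_mono_epi(2)[OF g(5)], of "t q \<cdot> t g"] g tq by simp
  then have "null C (t (g \<cdot> q))" using t_comp[OF qa g(2)] g q f by simp
  then have "null C (g \<cdot> q)" using t_null[of "g \<cdot> q"] g qa q by simp
  then have "null C g" using epi_null[OF q(1), of g] g by simp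
  then have "null C (t g)" using t_null[of g] g f by simp
  then have nk: "null C k" unfolding g(9) using g by - (rule null_comp(2); simp)
  show ?thesis
  proof (rule monoI[OF tq(1)])
    fix h assume h: "h \<in> arr C" "trg C h = src C (t q)" "null C (t q \<cdot> h)"
    obtain u where u: "u \<in> arr C" "src C u = src C h" "trg C u = src C k" "k \<cdot> u = h"
      using kernel_lift[OF kk h] by blast
    have "null C (k \<cdot> u)" using nk u k by - (rule null_comp(2); simp)
    then show "null C h" using u by simp
  qed
qed

lemma t_mono:
  assumes i: "is_mono C i" "fin (trg C i)"
  shows "is_epi C (t i)"
proof -
  note ia = mono_arr[OF i(1)]
  have f: "fin (src C i)" using fin_sub i by blast
  note ti = t_arr[OF ia f i(2)]
  obtain k where kk: "is_cokernel C k (t i)" and k: "is_epi C k" "k \<in> arr C" "src C k = trg C (t i)"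
    "null C (k \<cdot> t i)"
    using cokernelE[OF ti(1)] by metis
  have fk: "fin (trg C k)" using fin_quotient[OF k(1)] k ti f fin_T by simp
  have k3: "src C k = T (src C i)" using k ti by simp
  obtain Y g e where g: "fin Y" "g \<in> arr C" "trg C g = src C i" "src C g = Y" "is_iso C e" "e \<in> arr C"
    "trg C e = trg C k" "src C e = T Y" "k = e \<cdot> t g" "t g \<in> arr C" "src C (t g) = T (src C i)" "trg C (t g) = T Y"
    by (rule from_T[OF f k(2) k3 fk])
  have "null C (e \<cdot> (t g \<cdot> t i))" using k g ti by simp
  then have "null C (t g \<cdot> t i)"
    using mono_null[OF iso_mono_epi(1)[OF g(5)], of "t g \<cdot> t i"] g ti by simp
  then have "null C (t (i \<cdot> g))" using t_comp[OF g(2) ia] g i f by simp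
  then have "null C (i \<cdot> g)" using t_null[of "i \<cdot> g"] g ia i by simp
  then have "null C g" using mono_null[OF i(1), of g] g by simp
  then have "null C (t g)" using t_null[of g] g f by simp
  then have nk: "null C k" unfolding g(9) using g by - (rule null_comp(1); simp)
  show ?thesis
  proof (rule epiI[OF ti(1)])
    fix h assume h: "h \<in> arr C" "src C h = trg C (t i)" "null C (h \<cdot> t i)"
    obtain u where u: "u \<in> arr C" "trg C u = trg C h" "src C u = trg C k" "u \<cdot> k = h"
      using cokernel_colift[OF kk h] by blast
    have "null C (u \<cdot> k)" using nk u k by - (rule null_comp(1); simp)
    then show "null C h" using u by simp
  qed
qed

lemma t_ses:
  assumes e: "ses C i q" and fY: "fin (trg C i)"
  shows "ses C (t q) (t i)"
proof -
  note D = sesD[OF e]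
  have f: "fin (src C i)" "fin (src C q)" "fin (trg C q)"
    using fin_sub[of i] fin_quotient[of q] D fY by simp_all
  note ti = t_arr[OF D(1) f(1) fY] and tq = t_arr[OF D(2) f(2,3)]
  have "is_kernel C (t q) (t i)"
  proof (rule kernelI)
    show "is_mono C (t q)" using t_epi D f by blast
    show "null C (t i \<cdot> t q)"
      using t_comp[OF D(1,2,3)] t_null[of "q \<cdot> i"] D f fY by simp
    fix h assume h: "h \<in> arr C" "trg C h = src C (t i)" "null C (t i \<cdot> h)"
    obtain k where kk: "is_kernel C k (t i)" and k: "is_mono C k" "k \<in> arr C" "trg C k = src C (t i)"
      "null C (t i \<cdot> k)"
      using kernelE[OF ti(1)] by metis
    have fk: "fin (src C k)" using fin_sub[OF k(1)] k ti fY fin_T by simp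
    have k3: "trg C k = T (trg C i)" using k ti by simp
    obtain Y g e' where g: "fin Y" "g \<in> arr C" "src C g = trg C i" "trg C g = Y" "is_iso C e'" "e' \<in> arr C"
      "src C e' = src C k" "trg C e' = T Y" "k = t g \<cdot> e'" "t g \<in> arr C" "src C (t g) = T Y" "trg C (t g) = T (trg C i)"
      by (rule into_T[OF fY k(2) k3 fk])
    have "null C ((t i \<cdot> t g) \<cdot> e')" using k g ti by simp
    then have "null C (t i \<cdot> t g)"
      using epi_null[OF iso_mono_epi(2)[OF g(5)], of "t i \<cdot> t g"] g ti by simp
    then have "null C (t (g \<cdot> i))" using t_comp[OF D(1) g(2)] g f fY by simp
    then have "null C (g \<cdot> i)" using t_null[of "g \<cdot> i"] g D f by simp
    then obtain u where u: "u \<in> arr C" "src C u = trg C q" "trg C u = trg C g" "u \<cdot> q = g"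
      using ses_colift[OF e g(2)] g(3) D by metis
    have tu: "t u \<in> arr C" "src C (t u) = T Y" "trg C (t u) = T (trg C q)"
      using t_arr[OF u(1)] u g f by simp_all
    have tg: "t g = t q \<cdot> t u" using t_comp[OF D(2) u(1)] u g f by simp
    obtain v where v: "v \<in> arr C" "src C v = src C h" "trg C v = src C k" "k \<cdot> v = h"
      using kernel_lift[OF kk h] by blast
    have "t q \<cdot> (t u \<cdot> (e' \<cdot> v)) = t g \<cdot> (e' \<cdot> v)"
      using comp_reduce[OF tg[symmetric], of "e' \<cdot> v"] v(1-3) g(6-8) tu tq f by simp
    also have "\<dots> = k \<cdot> v"
      using comp_reduce[OF g(9)[symmetric], of v] v(1-3) g(6-8,10-12) by simp
    finally have "t q \<cdot> (t u \<cdot> (e' \<cdot> v)) = h" using v(4) by simp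
    then show "\<exists>u. u \<in> arr C \<and> src C u = src C h \<and> trg C u = src C (t q) \<and> t q \<cdot> u = h"
      using v(1-3) g(6-8) tu tq f by (intro exI[of _ "t u \<cdot> (e' \<cdot> v)"]) simp
  qed (use ti tq D in simp_all)
  then show ?thesis using t_mono D fY by (intro epi_kernel_ses) simp_all
qed

lemma t_iso:
  assumes "isomorphic C X Y" "fin X"
  shows "isomorphic C (T Y) (T X)"
proof -
  obtain f where f: "is_iso C f" "f \<in> arr C" "src C f = X" "trg C f = Y"
    using assms isomorphicE by metis
  have Y: "fin Y" using fin_iso assms by blast
  have "is_mono C (t f)" "is_epi C (t f)"
    using t_epi[of f] t_mono[of f] iso_mono_epi[OF f(1)] f assms Y by simp_all
  then have "is_iso C (t f)" by (rule mono_epi_iso)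
  then show ?thesis using isomorphicI[of "t f"] t_arr[OF f(2)] f assms Y by simp
qed

lemma t_has_factor:
  assumes "fin X" "has_factor C X Q"
  shows "has_factor C (T X) (T Q)"
proof -
  obtain m e where m: "is_mono C m" "is_epi C e" "trg C m = X" "src C m = src C e" "trg C e = Q"
    using assms by (auto simp: has_factor_def)
  note a = mono_arr[OF m(1)] epi_arr[OF m(2)]
  have f: "fin (src C m)" "fin Q" using fin_sub[OF m(1)] fin_quotient[OF m(2)] m assms by simp_all
  have tm: "is_epi C (t m)" "src C (t m) = T X" "trg C (t m) = T (src C m)"
    and te: "is_mono C (t e)" "src C (t e) = T Q" "trg C (t e) = T (src C m)"
    using t_mono[OF m(1)] t_epi[OF m(2)] t_arr[OF a(1)] t_arr[OF a(2)] m f assms by simp_all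
  have "has_factor C (T (src C m)) (T Q)" using has_factor_of_mono[OF te(1)] te by simp
  then show ?thesis using has_factor_quotient[OF tm(1)] tm by simp
qed

text \<open>Being exact and contravariant, the functor turns the quotient added at the top into a subobject added
  at the bottom.\<close>

lemma t_filtered_by:
  assumes "filtered_by (opp C) R G" "fin G"
  shows "filtered_by C (T ` R) (T G)"
  using assms
proof induction
  case (zero P)
  then show ?case using t_zero_obj by (intro filtered_by.zero) simp
next
  case (ext q i)
  then have e: "ses C q i" "trg C i \<in> R" "fin (src C i)" by simp_all
  note D = sesD[OF e(1)]
  have f: "fin (trg C q)" "fin (src C q)" "fin (trg C i)"
    using e D fin_sub[of q] fin_quotient[of i] by simp_all
  have "filtered_by C (T ` R) (trg C (t q))" using ext f t_arr[OF D(1)] by simp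
  then have "filtered_by C (T ` R) (trg C (t i))"
    using t_ses[OF e(1)] e f t_arr[OF D(2)] by (intro filtered_by.ext[of _ _ "t q" "t i"]) simp_all
  then show ?case using t_arr[OF D(2)] f e by simp
qed

end

section \<open>Standard objects\<close>

context standing_highest_weight_category
begin

abbreviation standards :: "'o set" where "standards \<equiv> standard C T \<nu> ` \<Lambda>"

lemma dual:
  obtains S s where "finite_duality C T t S s"
proof -
  obtain S s where "contra_functor C {X. finite_length C X} T t"
    "contra_functor C {X. finite_length C X} S s"
    "nat_iso_to_identity C {X. finite_length C X} (S \<circ> T) (s \<circ> t)"
    "nat_iso_to_identity C {X. finite_length C X} (T \<circ> S) (t \<circ> s)"
    using duality unfolding contra_equivalence_def by blast
  then have "finite_duality C T t S s"
    by unfold_locales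
  then show ?thesis by (rule that)
qed

lemma finite_simple: "\<mu> \<in> \<Lambda> \<Longrightarrow> finite_length C (L \<mu>)"
  using series_simple[OF simple_L] finite_length_iff by blast

lemma inverse_simple:
  assumes d: "finite_duality C T t S s" and \<mu>: "\<mu> \<in> \<Lambda>"
  shows "isomorphic C (S (L \<mu>)) (L \<mu>)"
proof -
  interpret d: finite_duality C T t S s by (rule d)
  interpret o: finite_duality C S s T t by (rule d.swap)
  have "isomorphic C (S (L \<mu>)) (S (T (L \<mu>)))"
    using o.t_iso[OF duality_simple[OF \<mu>]] d.fin_T finite_simple[OF \<mu>] by blast
  moreover obtain e where "is_iso C e" "src C e = L \<mu>" "trg C e = S (T (L \<mu>))"
    using d.unit_obj[OF finite_simple[OF \<mu>]] by metis
  then have "isomorphic C (S (T (L \<mu>))) (L \<mu>)"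
    using isomorphicI[of e] isomorphic_sym by simp
  ultimately show ?thesis by (rule isomorphic_trans)
qed

lemma dual_has_factor:
  assumes X: "finite_length C X" and \<kappa>: "\<kappa> \<in> \<Lambda>"
  shows "has_factor C (T X) (L \<kappa>) \<longleftrightarrow> has_factor C X (L \<kappa>)"
    and "finite_duality C T t S s \<Longrightarrow> has_factor C (S X) (L \<kappa>) \<Longrightarrow> has_factor C X (L \<kappa>)"
proof -
  have A: "has_factor C (T X) (L \<kappa>)" if "finite_length C X" "has_factor C X (L \<kappa>)" for X
  proof -
    obtain S s where "finite_duality C T t S s" using dual by blast
    then interpret d: finite_duality C T t S s .
    show ?thesis using has_factor_iso_right[OF duality_simple[OF \<kappa>]] d.t_has_factor that by blast
  qed
  have B: "has_factor C (S X) (L \<kappa>)"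
    if "finite_duality C T t S s" "finite_length C X" "has_factor C X (L \<kappa>)" for X S s
  proof -
    interpret d: finite_duality C T t S s by (rule that)
    interpret o: finite_duality C S s T t by (rule d.swap)
    show ?thesis
      using has_factor_iso_right[OF inverse_simple[OF that(1) \<kappa>]] o.t_has_factor that by blast
  qed
  show "has_factor C (T X) (L \<kappa>) \<longleftrightarrow> has_factor C X (L \<kappa>)"
  proof
    assume F: "has_factor C (T X) (L \<kappa>)"
    obtain S s where dd: "finite_duality C T t S s" using dual by blast
    then interpret d: finite_duality C T t S s .
    have "has_factor C (S (T X)) (L \<kappa>)" using B[OF dd d.fin_T[OF X] F] .
    moreover obtain e where "is_iso C e" "src C e = X" "trg C e = S (T X)"
      using d.unit_obj[OF X] by metis
    ultimately show "has_factor C X (L \<kappa>)"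
      using has_factor_iso_left isomorphicI[of e] isomorphic_sym by metis
  qed (use A X in blast)
  show "has_factor C X (L \<kappa>)" if dd: "finite_duality C T t S s" and F: "has_factor C (S X) (L \<kappa>)"
  proof -
    interpret d: finite_duality C T t S s by (rule dd)
    interpret o: finite_duality C S s T t by (rule d.swap)
    have "has_factor C (T (S X)) (L \<kappa>)" using A[OF d.fin_S[OF X] F] .
    moreover obtain e where "is_iso C e" "src C e = X" "trg C e = T (S X)"
      using o.unit_obj[OF X] by metis
    ultimately show ?thesis
      using has_factor_iso_left isomorphicI[of e] isomorphic_sym by metis
  qed
qed

lemma standard_finite: "\<mu> \<in> \<Lambda> \<Longrightarrow> finite_length C (standard C T \<nu> \<mu>)"
proof -
  assume \<mu>: "\<mu> \<in> \<Lambda>"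
  obtain S s where "finite_duality C T t S s" using dual by blast
  then interpret d: finite_duality C T t S s .
  show ?thesis using d.fin_T costandard_finite[OF \<mu>] by (simp add: standard_def)
qed

lemma standard_factor:
  assumes "\<mu> \<in> \<Lambda>" "\<kappa> \<in> \<Lambda>" "has_factor C (standard C T \<nu> \<mu>) (L \<kappa>)"
  shows "\<kappa> \<le> \<mu>"
  using costandard_factor[OF assms(1,2)] dual_has_factor(1)[OF costandard_finite[OF assms(1)] assms(2)] assms(3)
  by (simp add: standard_def)

text \<open>Dual to \<open>costandard_relatively_injective\<close>: apply the inverse duality, extend, and return.\<close>

lemma standard_relatively_projective:
  assumes \<mu>: "\<mu> \<in> \<Lambda>" and e: "is_epi C e" "finite_length C (src C e)" and Y: "no_factor_above \<mu> (src C e)"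
    and g: "g \<in> hom C (standard C T \<nu> \<mu>) (trg C e)"
  shows "\<exists>h\<in>hom C (standard C T \<nu> \<mu>) (src C e). e \<cdot> h = g"
proof -
  obtain S s where dd: "finite_duality C T t S s" using dual by blast
  then interpret d: finite_duality C T t S s .
  interpret o: finite_duality C S s T t by (rule d.swap)
  let ?V = "costandard C \<nu> \<mu>" and ?W = "standard C T \<nu> \<mu>"
  note ea = epi_arr[OF e(1)]
  have f: "finite_length C (trg C e)" "finite_length C ?V" "finite_length C ?W"
    using d.fin_quotient e costandard_finite standard_finite \<mu> by blast+
  have se: "is_mono C (s e)" "s e \<in> arr C" "src C (s e) = S (trg C e)" "trg C (s e) = S (src C e)"
    using o.t_epi e o.t_arr[OF ea] f by simp_all
  have sg: "s g \<in> arr C" "src C (s g) = S (trg C e)" "trg C (s g) = S ?W"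
    using o.t_arr[of g] g f by simp_all
  obtain c where c: "is_iso C c" "c \<in> arr C" "src C c = ?V" "trg C c = S ?W"
    using d.unit_obj[OF f(2)] by (metis standard_def)
  obtain c' where c': "c' \<in> arr C" "src C c' = S ?W" "trg C c' = ?V" "c \<cdot> c' = \<one> (S ?W)"
    using isoE[OF c(1)] c by metis
  have "no_factor_above \<mu> (trg C (s e))"
    using Y dual_has_factor(2)[OF e(2) _ dd] se by (auto simp: no_factor_above_def)
  moreover have "c' \<cdot> s g \<in> hom C (src C (s e)) ?V" using c' sg se by simp
  ultimately obtain h' where h': "h' \<in> arr C" "src C h' = S (src C e)" "trg C h' = ?V" "h' \<cdot> s e = c' \<cdot> s g"
    using costandard_relatively_injective[OF \<mu> se(1)] se unfolding Bex_def hom_iff by metis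
  have ch: "c \<cdot> h' \<in> arr C" "src C (c \<cdot> h') = S (src C e)" "trg C (c \<cdot> h') = S ?W" using c h' by simp_all
  obtain h where h: "h \<in> arr C" "src C h = ?W" "trg C h = src C e" "s h = c \<cdot> h'"
    by (rule o.full[OF f(3) e(2) ch])
  have "s (e \<cdot> h) = s h \<cdot> s e" using o.t_comp[OF h(1) ea] h f e by simp
  also have "\<dots> = c \<cdot> (h' \<cdot> s e)" using h(4) c h' se by simp
  also have "\<dots> = c \<cdot> (c' \<cdot> s g)" using h'(4) by simp
  also have "\<dots> = s g" using comp_reduce[OF c'(4), of "s g"] c c' sg by simp
  finally have "e \<cdot> h = g" using ea h g f by - (rule o.faithful; simp)
  then show ?thesis using h by (intro bexI[of _ h]) simp_all
qed

text \<open>Dual to \<open>costandard_sub_least\<close>: every nonzero quotient of a standard object retains its top.\<close>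

lemma standard_quotient_least:
  assumes \<mu>: "\<mu> \<in> \<Lambda>" and x: "is_epi C x" "src C x = standard C T \<nu> \<mu>" "\<not> zero_obj C (trg C x)"
    and b: "b \<in> hom C (standard C T \<nu> \<mu>) (L \<mu>)"
  shows "\<exists>r\<in>hom C (trg C x) (L \<mu>). r \<cdot> x = b"
proof -
  obtain S s where dd: "finite_duality C T t S s" using dual by blast
  then interpret d: finite_duality C T t S s .
  interpret o: finite_duality C S s T t by (rule d.swap)
  let ?V = "costandard C \<nu> \<mu>" and ?W = "standard C T \<nu> \<mu>"
  note xa = epi_arr[OF x(1)]
  have f: "finite_length C (trg C x)" "finite_length C ?V" "finite_length C ?W" "finite_length C (L \<mu>)"
    using d.fin_quotient[OF x(1)] x costandard_finite standard_finite finite_simple \<mu> by simp_all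
  have sx: "is_mono C (s x)" "s x \<in> arr C" "src C (s x) = S (trg C x)" "trg C (s x) = S ?W"
    using o.t_epi[OF x(1)] x o.t_arr[OF xa] f by simp_all
  have sb: "s b \<in> arr C" "src C (s b) = S (L \<mu>)" "trg C (s b) = S ?W"
    using o.t_arr[of b] b f by simp_all
  obtain c where c: "is_iso C c" "c \<in> arr C" "src C c = ?V" "trg C c = S ?W"
    using d.unit_obj[OF f(2)] by (metis standard_def)
  obtain c' where c': "c' \<in> arr C" "src C c' = S ?W" "trg C c' = ?V" "c \<cdot> c' = \<one> (S ?W)" "is_iso C c'"
    using isoE[OF c(1)] c by metis
  obtain a where a: "is_iso C a" "a \<in> arr C" "src C a = S (L \<mu>)" "trg C a = L \<mu>"
    using inverse_simple[OF dd \<mu>] isomorphicE by metis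
  obtain a' where a': "a' \<in> arr C" "src C a' = L \<mu>" "trg C a' = S (L \<mu>)" "a' \<cdot> a = \<one> (S (L \<mu>))"
    using isoE[OF a(1)] a by metis
  have "is_mono C (c' \<cdot> s x)" using mono_comp[OF sx(1) iso_mono_epi(1)[OF c'(5)]] c' sx by simp
  moreover have "\<not> zero_obj C (S (trg C x))"
  proof
    assume "zero_obj C (S (trg C x))"
    then have z: "zero_obj C (T (S (trg C x)))" by (rule d.t_zero_obj)
    obtain e where "is_iso C e" "src C e = trg C x" "trg C e = T (S (trg C x))"
      using o.unit_obj[OF f(1)] by metis
    then show False using zero_obj_iso[OF z] isomorphicI[of e] isomorphic_sym x(3) by metis
  qed
  moreover have "(c' \<cdot> s b) \<cdot> a' \<in> hom C (L \<mu>) ?V" using c' sb a' by simp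
  ultimately have "sub_le C ((c' \<cdot> s b) \<cdot> a') (c' \<cdot> s x)"
    using costandard_sub_least[OF \<mu>, of "c' \<cdot> s x"] c' sx by simp
  then obtain r0 where r0: "r0 \<in> arr C" "src C r0 = L \<mu>" "trg C r0 = S (trg C x)"
    "(c' \<cdot> s x) \<cdot> r0 = (c' \<cdot> s b) \<cdot> a'"
    using sub_leE[of "(c' \<cdot> s b) \<cdot> a'" "c' \<cdot> s x"] c' sx sb a' by (metis comp_arr(2) comp_arr(1))
  have "c' \<cdot> (s x \<cdot> r0) = c' \<cdot> (s b \<cdot> a')" using r0 c' sx sb a' by simp
  then have xr: "s x \<cdot> r0 = s b \<cdot> a'"
    using r0(1-3) c' sx sb a' by - (rule mono_cancel[OF iso_mono_epi(1)[OF c'(5)]]; simp)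
  have ra: "r0 \<cdot> a \<in> arr C" "src C (r0 \<cdot> a) = S (L \<mu>)" "trg C (r0 \<cdot> a) = S (trg C x)" using r0 a by simp_all
  obtain r where r: "r \<in> arr C" "src C r = trg C x" "trg C r = L \<mu>" "s r = r0 \<cdot> a"
    by (rule o.full[OF f(1,4) ra])
  have "s (r \<cdot> x) = s x \<cdot> s r" using o.t_comp[OF xa r(1)] r f x by simp
  also have "\<dots> = s x \<cdot> (r0 \<cdot> a)" using r(4) by simp
  also have "\<dots> = (s b \<cdot> a') \<cdot> a" using comp_reduce[OF xr, of a] r0(1-3) a sx by simp
  also have "\<dots> = s b" using a a' sb by simp
  finally have "r \<cdot> x = b" using xa r x b f by - (rule o.faithful; simp)
  then show ?thesis using r by (intro bexI[of _ r]) simp_all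
qed

lemma standard_top:
  assumes \<mu>: "\<mu> \<in> \<Lambda>"
  obtains p where "is_epi C p" "p \<in> arr C" "src C p = standard C T \<nu> \<mu>" "trg C p = L \<mu>"
proof -
  obtain S s where "finite_duality C T t S s" using dual by blast
  then interpret d: finite_duality C T t S s .
  obtain l where l: "is_mono C l" "l \<in> arr C" "src C l = L \<mu>" "trg C l = costandard C \<nu> \<mu>"
    using socle[OF \<mu>] by metis
  have tl: "is_epi C (t l)" "t l \<in> arr C" "src C (t l) = standard C T \<nu> \<mu>" "trg C (t l) = T (L \<mu>)"
    using d.t_mono[OF l(1)] d.t_arr[OF l(2)] l finite_simple[OF \<mu>] costandard_finite[OF \<mu>]
    by (simp_all add: standard_def)
  obtain a where a: "is_iso C a" "a \<in> arr C" "src C a = T (L \<mu>)" "trg C a = L \<mu>"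
    using duality_simple[OF \<mu>] isomorphicE by metis
  show ?thesis
    using that[of "a \<cdot> t l"] epi_comp[OF tl(1) iso_mono_epi(2)[OF a(1)]] tl a by simp
qed

lemma standard_quotient_factor:
  assumes \<mu>: "\<mu> \<in> \<Lambda>" and x: "is_epi C x" "src C x = standard C T \<nu> \<mu>" "\<not> zero_obj C (trg C x)"
  shows "has_factor C (trg C x) (L \<mu>)"
proof -
  obtain p where p: "is_epi C p" "p \<in> arr C" "src C p = standard C T \<nu> \<mu>" "trg C p = L \<mu>"
    using standard_top[OF \<mu>] by metis
  then obtain r where r: "r \<in> hom C (trg C x) (L \<mu>)" "r \<cdot> x = p"
    using standard_quotient_least[OF \<mu> x, of p] by auto
  have "is_epi C r" using epi_second[of x r] r p epi_arr[OF x(1)] by simp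
  then show ?thesis using has_factor_of_epi[of r] r by simp
qed

text \<open>The image of a nonzero map has the top of the source and the socle of the target among its factors, so
  each of the two weights bounds the other.\<close>

lemma standard_costandard_hom:
  assumes \<mu>: "\<mu> \<in> \<Lambda>" and \<kappa>: "\<kappa> \<in> \<Lambda>" and g: "g \<in> hom C (standard C T \<nu> \<mu>) (costandard C \<nu> \<kappa>)"
    and n: "\<not> null C g"
  shows "\<mu> = \<kappa>"
proof -
  obtain m e where m: "is_mono C m" "is_epi C e" "m \<in> arr C" "e \<in> arr C" "trg C m = trg C g"
    "src C e = src C g" "src C m = trg C e" "m \<cdot> e = g"
    using image[of g] g by auto
  have "\<not> null C m" "\<not> null C e" using nonzero_image[of m e] m n by simp_all
  then have nz: "\<not> zero_obj C (src C m)" "\<not> zero_obj C (trg C e)"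
    using mono_null_src[OF m(1)] epi_null_trg[OF m(2)] by simp_all
  have "has_factor C (src C m) (L \<kappa>)" using costandard_sub_factor[OF \<kappa> m(1)] m g nz by simp
  then have "\<kappa> \<le> \<mu>" using standard_factor[OF \<mu> \<kappa>] has_factor_quotient[OF m(2)] m g by simp
  moreover have "has_factor C (trg C e) (L \<mu>)" using standard_quotient_factor[OF \<mu> m(2)] m g nz by simp
  then have "\<mu> \<le> \<kappa>" using costandard_factor[OF \<kappa> \<mu>] has_factor_sub[OF m(1)] m g by simp
  ultimately show ?thesis by simp
qed

text \<open>Modulo the socle, the image would be a quotient of the standard object and hence have the factor
  \<open>L \<mu>\<close>, but the factors of \<open>\<nabla>(\<mu>)/L(\<mu>)\<close> are smaller.\<close>

lemma standard_costandard_through_socle: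
  assumes \<mu>: "\<mu> \<in> \<Lambda>" and g: "g \<in> hom C (standard C T \<nu> \<mu>) (costandard C \<nu> \<mu>)"
  obtains b l where "b \<in> hom C (standard C T \<nu> \<mu>) (L \<mu>)" "l \<in> hom C (L \<mu>) (costandard C \<nu> \<mu>)"
    "is_mono C l" "l \<cdot> b = g"
proof -
  obtain l where l: "is_mono C l" "l \<in> arr C" "src C l = L \<mu>" "trg C l = costandard C \<nu> \<mu>" "\<nu> \<mu> \<cdot> l = \<iota> \<mu>"
    using socle[OF \<mu>] by metis
  obtain c where c: "ses C l c" using mono_ses l by blast
  note D = sesD[OF c]
  have "null C (c \<cdot> g)"
  proof (rule ccontr)
    assume n: "\<not> null C (c \<cdot> g)"
    obtain m e where m: "is_mono C m" "is_epi C e" "m \<in> arr C" "e \<in> arr C" "trg C m = trg C (c \<cdot> g)"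
      "src C e = src C (c \<cdot> g)" "src C m = trg C e" "m \<cdot> e = c \<cdot> g"
      using image[of "c \<cdot> g"] g D l by auto
    have "\<not> null C e" using nonzero_image[of m e] m n by simp
    then have "has_factor C (trg C e) (L \<mu>)"
      using standard_quotient_factor[OF \<mu> m(2)] m g D l epi_null_trg[OF m(2)] by simp
    then have "has_factor C (trg C c) (L \<mu>)" using has_factor_sub[OF m(1)] m g D l by simp
    then show False using socle_quotient_factor[OF \<mu> l(5) c l(4) \<mu>] by simp
  qed
  then obtain b where "b \<in> arr C" "src C b = src C g" "trg C b = src C l" "l \<cdot> b = g"
    using ses_lift[OF c, of g] g l by auto
  then show ?thesis using that[of b l] l g by simp
qed

text \<open>The dual of the stage given by \<open>finite_costandard_target\<close>. It plays the role of a projective cover.\<close>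

lemma finite_standard_source:
  assumes \<mu>: "\<mu> \<in> \<Lambda>" and a: "is_epi C a" "finite_length C (src C a)" "trg C a = L \<mu>"
  obtains P h where "filtered_by C standards P" "h \<in> hom C P (src C a)" "\<not> null C (a \<cdot> h)"
proof -
  obtain S s where dd: "finite_duality C T t S s" using dual by blast
  then interpret d: finite_duality C T t S s .
  interpret o: finite_duality C S s T t by (rule d.swap)
  note aa = epi_arr[OF a(1)]
  have fL: "finite_length C (L \<mu>)" by (rule finite_simple[OF \<mu>])
  have sa: "is_mono C (s a)" "s a \<in> arr C" "src C (s a) = S (L \<mu>)" "trg C (s a) = S (src C a)"
    using o.t_epi[OF a(1,2)] o.t_arr[OF aa] a fL by simp_all
  obtain c where c: "is_iso C c" "c \<in> arr C" "src C c = L \<mu>" "trg C c = S (L \<mu>)"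
    using isomorphic_sym[OF inverse_simple[OF dd \<mu>]] isomorphicE by metis
  have sac: "is_mono C (s a \<cdot> c)" "src C (s a \<cdot> c) = L \<mu>" "trg C (s a \<cdot> c) = S (src C a)"
    using mono_comp[OF iso_mono_epi(1)[OF c(1)] sa(1)] c sa by simp_all
  have "series C (L \<mu>) 0 (trg C (s a \<cdot> c))"
    using finite_length_iff d.fin_S[OF a(2)] sac by simp
  then obtain G h where G: "filtered_by (opp C) costandards G" "series C (L \<mu>) 0 G" "h \<in> hom C (S (src C a)) G"
    "\<not> null C (h \<cdot> (s a \<cdot> c))"
    using finite_costandard_target[OF \<mu> _ sac(1,2)] sac by metis
  have fG: "finite_length C G" using G finite_length_iff by blast
  have fSa: "finite_length C (S (src C a))" using d.fin_S a by blast
  have hsa: "\<not> null C (h \<cdot> s a)"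
    using G(3,4) nonzero_image(1)[of "h \<cdot> s a" c] sa c by simp
  have th: "t h \<in> arr C" "src C (t h) = T G" "trg C (t h) = T (S (src C a))"
    using d.t_arr[of h] G fG fSa by simp_all
  have tsa: "t (s a) \<in> arr C" "src C (t (s a)) = T (S (src C a))" "trg C (t (s a)) = T (S (L \<mu>))"
    using d.t_arr[OF sa(2)] sa fSa d.fin_S[OF fL] by simp_all
  obtain \<eta> where e: "\<forall>X. finite_length C X \<longrightarrow> is_iso C (\<eta> X) \<and> \<eta> X \<in> hom C X (T (S X))"
    and n: "\<forall>f. f \<in> arr C \<and> finite_length C (src C f) \<and> finite_length C (trg C f) \<longrightarrow>
      t (s f) \<cdot> \<eta> (src C f) = \<eta> (trg C f) \<cdot> f"
    by (rule o.unit)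
  \<comment> \<open>Naturality of the unit of the inverse duality transports the nonzero composite \<open>h (s a)\<close> back along \<open>t\<close>.\<close>
  let ?E = "\<eta> (src C a)" and ?F = "\<eta> (L \<mu>)"
  have E: "is_iso C ?E" "?E \<in> arr C" "src C ?E = src C a" "trg C ?E = T (S (src C a))"
    and F: "?F \<in> arr C" "src C ?F = L \<mu>"
    using e a fL by simp_all
  have nat: "t (s a) \<cdot> ?E = ?F \<cdot> a" using n aa a fL by simp
  obtain E' where E': "E' \<in> arr C" "src C E' = T (S (src C a))" "trg C E' = src C a"
    "?E \<cdot> E' = \<one> (T (S (src C a)))"
    using isoE[OF E(1)] E by metis
  have "?F \<cdot> (a \<cdot> (E' \<cdot> t h)) = (t (s a) \<cdot> ?E) \<cdot> (E' \<cdot> t h)"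
    unfolding nat using F aa a E' th by simp
  also have "\<dots> = t (s a) \<cdot> (?E \<cdot> (E' \<cdot> t h))" using tsa E E' th by simp
  also have "?E \<cdot> (E' \<cdot> t h) = t h" using comp_reduce[OF E'(4), of "t h"] E E' th by simp
  also have "t (s a) \<cdot> t h = t (h \<cdot> s a)" using d.t_comp[OF sa(2), of h] sa G fG fSa d.fin_S[OF fL] by simp
  finally have eq: "?F \<cdot> (a \<cdot> (E' \<cdot> t h)) = t (h \<cdot> s a)" .
  have "\<not> null C (t (h \<cdot> s a))" using d.t_null[of "h \<cdot> s a"] hsa sa G fG d.fin_S[OF fL] by simp
  then have "\<not> null C (?F \<cdot> (a \<cdot> (E' \<cdot> t h)))" unfolding eq .
  then have "\<not> null C (a \<cdot> (E' \<cdot> t h))"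
    using nonzero_image(2)[of ?F "a \<cdot> (E' \<cdot> t h)"] F aa a E' th by simp
  moreover have "filtered_by C (T ` costandards) (T G)" by (rule d.t_filtered_by[OF G(1) fG])
  moreover have "T ` costandards = standards" by (auto simp: standard_def)
  ultimately show ?thesis using that[of "T G" "E' \<cdot> t h"] E' th by simp
qed

end

section \<open>Exhausting a poset from above\<close>

text \<open>States carry a set of remaining weights; a move removes something at a weight that is maximal among the
  remaining ones, and a finite counter \<open>d\<close> bounds the number of moves at each weight. To clear all weights
  of a possibly infinite poset, the moves must be chosen fairly: take the least \<open>k\<close> for which weights outside
  \<open>G k\<close> remain, and among these finitely many a maximal one. It is maximal among all remaining weights
  because \<open>G k\<close> is closed downwards. As long as weights outside \<open>G k\<close> remain, each move decreases the sum of
  the counters over the finite set \<open>\<Gamma> - G k\<close>, so they are cleared after finitely many moves.\<close>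

lemma exhaust_from_above:
  fixes G :: "nat \<Rightarrow> 'l::order set" and supp :: "'s \<Rightarrow> 'l set" and d :: "'s \<Rightarrow> 'l \<Rightarrow> nat"
  assumes fin: "\<And>k. finite (\<Gamma> - G k)"
    and down: "\<And>k \<mu> \<kappa>. \<mu> \<in> G k \<Longrightarrow> \<kappa> \<in> \<Gamma> \<Longrightarrow> \<kappa> \<le> \<mu> \<Longrightarrow> \<kappa> \<in> G k"
    and anti: "\<And>k. G (Suc k) \<subseteq> G k"
    and inter: "(\<Inter>k. G k) = {}"
    and x0: "Inv x0"
    and supp: "\<And>x. Inv x \<Longrightarrow> supp x \<subseteq> \<Gamma>"
    and step: "\<And>x \<mu>. Inv x \<Longrightarrow> \<mu> \<in> supp x \<Longrightarrow> (\<And>\<kappa>. \<kappa> \<in> supp x \<Longrightarrow> \<not> \<mu> < \<kappa>) \<Longrightarrow>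
      \<exists>y. Inv y \<and> R \<mu> x y"
    and supp_mono: "\<And>x y \<mu>. Inv x \<Longrightarrow> Inv y \<Longrightarrow> R \<mu> x y \<Longrightarrow> supp y \<subseteq> supp x"
    and d_less: "\<And>x y \<mu>. Inv x \<Longrightarrow> Inv y \<Longrightarrow> \<mu> \<in> \<Gamma> \<Longrightarrow> R \<mu> x y \<Longrightarrow> d y \<mu> < d x \<mu>"
    and d_le: "\<And>x y \<mu> \<kappa>. Inv x \<Longrightarrow> Inv y \<Longrightarrow> \<kappa> \<in> \<Gamma> \<Longrightarrow> R \<mu> x y \<Longrightarrow> d y \<kappa> \<le> d x \<kappa>"
  obtains X where "X 0 = x0" "\<And>i. Inv (X i)"
    "\<And>i. supp (X i) \<noteq> {} \<Longrightarrow> \<exists>\<mu>\<in>supp (X i). R \<mu> (X i) (X (Suc i))"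
    "\<And>\<mu>. \<exists>i. \<mu> \<notin> supp (X i)"
proof -
  have anti': "G l \<subseteq> G k" if "k \<le> l" for k l
    using lift_Suc_antimono_le[of G, OF anti that] .
  have next_ex: "\<exists>y. Inv y \<and> (supp x \<noteq> {} \<longrightarrow>
      (\<exists>\<mu>\<in>supp x. R \<mu> x y \<and> (\<forall>k. \<not> supp x \<subseteq> G k \<longrightarrow> \<mu> \<notin> G k))) \<and> (supp x = {} \<longrightarrow> y = x)"
    if x: "Inv x" for x
  proof (cases "supp x = {}")
    case True
    then show ?thesis using x by auto
  next
    case False
    then have "\<exists>k. \<not> supp x \<subseteq> G k" using inter by blast
    \<comment> \<open>The fair choice.\<close>
    define k where "k = (LEAST k. \<not> supp x \<subseteq> G k)"
    have k: "\<not> supp x \<subseteq> G k" unfolding k_def using \<open>\<exists>k. \<not> supp x \<subseteq> G k\<close> by (rule LeastI_ex)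
    have least: "k \<le> l" if "\<not> supp x \<subseteq> G l" for l unfolding k_def using that by (rule Least_le)
    have f: "finite (supp x - G k)" by (rule finite_subset[OF _ fin[of k]]) (use supp[OF x] in blast)
    obtain \<mu> where \<mu>: "\<mu> \<in> supp x - G k" and max: "\<And>\<kappa>. \<kappa> \<in> supp x - G k \<Longrightarrow> \<mu> \<le> \<kappa> \<Longrightarrow> \<mu> = \<kappa>"
      using finite_has_maximal[OF f] k by blast
    have "\<not> \<mu> < \<kappa>" if \<kappa>: "\<kappa> \<in> supp x" for \<kappa>
    proof
      assume l: "\<mu> < \<kappa>"
      then have "\<kappa> \<notin> G k" using down[of \<kappa> k \<mu>] less_imp_le[OF l] \<mu> subsetD[OF supp[OF x], of \<mu>] by auto
      then show False using max[of \<kappa>] \<kappa> l less_imp_le[OF l] by auto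
    qed
    then obtain y where "Inv y" "R \<mu> x y" using step[OF x, of \<mu>] \<mu> by blast
    moreover have "\<mu> \<notin> G l" if "\<not> supp x \<subseteq> G l" for l
      using anti'[OF least[OF that]] \<mu> by blast
    ultimately show ?thesis using False \<mu> by blast
  qed
  have "\<exists>X. \<forall>n. (Inv (X n) \<and> (n = 0 \<longrightarrow> X n = x0)) \<and> ((supp (X n) \<noteq> {} \<longrightarrow>
      (\<exists>\<mu>\<in>supp (X n). R \<mu> (X n) (X (Suc n)) \<and> (\<forall>k. \<not> supp (X n) \<subseteq> G k \<longrightarrow> \<mu> \<notin> G k))) \<and>
      (supp (X n) = {} \<longrightarrow> X (Suc n) = X n))"
  proof (rule dependent_nat_choice)
    show "\<exists>x. Inv x \<and> (0 = 0 \<longrightarrow> x = x0)" using x0 by blast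
    fix x and n :: nat assume "Inv x \<and> (n = 0 \<longrightarrow> x = x0)"
    then show "\<exists>y. (Inv y \<and> (Suc n = 0 \<longrightarrow> y = x0)) \<and> ((supp x \<noteq> {} \<longrightarrow>
      (\<exists>\<mu>\<in>supp x. R \<mu> x y \<and> (\<forall>k. \<not> supp x \<subseteq> G k \<longrightarrow> \<mu> \<notin> G k))) \<and> (supp x = {} \<longrightarrow> y = x))"
      using next_ex[of x] by auto
  qed
  then obtain X where X0: "X 0 = x0" and inv: "\<And>n. Inv (X n)"
    and st: "\<And>n. supp (X n) \<noteq> {} \<Longrightarrow>
      \<exists>\<mu>\<in>supp (X n). R \<mu> (X n) (X (Suc n)) \<and> (\<forall>k. \<not> supp (X n) \<subseteq> G k \<longrightarrow> \<mu> \<notin> G k)"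
    by blast
  have reach: "\<exists>i. supp (X i) \<subseteq> G k" for k
  proof (rule ccontr)
    assume no: "\<nexists>i. supp (X i) \<subseteq> G k"
    define s where "s i = (\<Sum>\<kappa>\<in>\<Gamma> - G k. d (X i) \<kappa>)" for i
    have "s (Suc i) < s i" for i
    proof -
      have "\<not> supp (X i) \<subseteq> G k" using no by blast
      then obtain \<mu> where \<mu>: "\<mu> \<in> supp (X i)" "R \<mu> (X i) (X (Suc i))" "\<mu> \<notin> G k"
        using st[of i] by blast
      then have m: "\<mu> \<in> \<Gamma> - G k" using supp inv by blast
      show ?thesis
        unfolding s_def
        by (rule sum_strict_mono_ex1)
          (use fin m d_le[OF inv inv _ \<mu>(2)] d_less[OF inv inv _ \<mu>(2)] in auto)
    qed
    then have "\<not> wf (measure s)"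
      unfolding wf_iff_no_infinite_down_chain by (auto intro!: exI[of _ id])
    then show False by simp
  qed
  have "\<exists>i. \<mu> \<notin> supp (X i)" for \<mu>
  proof -
    obtain k where "\<mu> \<notin> G k" using inter by blast
    then show ?thesis using reach[of k] by blast
  qed
  then show ?thesis using that[of X] X0 inv st by blast
qed

section \<open>Filtrations\<close>

context standing_highest_weight_category
begin

definition factors :: "'o \<Rightarrow> 'l set" where
  "factors X = {\<mu> \<in> \<Lambda>. has_factor C X (L \<mu>)}"

lemma factors_empty:
  assumes "X \<in> obj C" "factors X = {}"
  shows "zero_obj C X"
proof (rule ccontr)
  assume "\<not> zero_obj C X"
  then obtain Q where Q: "simple_obj C Q" "has_factor C X Q" using nonzero_has_simple_factor assms by metis
  obtain \<mu> where "\<mu> \<in> \<Lambda>" "isomorphic C Q (L \<mu>)" using L_complete Q by blast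
  then have "\<mu> \<in> factors X" using has_factor_iso_right Q by (auto simp: factors_def)
  then show False using assms by simp
qed

lemma factors_sub: "is_mono C m \<Longrightarrow> factors (src C m) \<subseteq> factors (trg C m)"
  using has_factor_sub by (auto simp: factors_def)

lemma factors_quotient: "is_epi C q \<Longrightarrow> factors (trg C q) \<subseteq> factors (src C q)"
  using has_factor_quotient by (auto simp: factors_def)

lemma no_factor_above_if_maximal: "(\<And>\<kappa>. \<kappa> \<in> factors X \<Longrightarrow> \<not> \<mu> < \<kappa>) \<Longrightarrow> no_factor_above \<mu> X"
  by (auto simp: factors_def no_factor_above_def)

lemma restrictedD:
  assumes "restricted C \<Lambda> L \<Gamma> M"
  shows "M \<in> obj C" "factors M \<subseteq> \<Gamma>" "\<mu> \<in> \<Gamma> \<Longrightarrow> mult C M (L \<mu>) < \<infinity>"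
  using assms in_truncD[of \<Gamma> M] by (auto simp: restricted_def in_trunc_def factors_def)

lemma simple_iso_L:
  assumes "simple_obj C Q"
  obtains \<kappa> f where "\<kappa> \<in> \<Lambda>" "is_iso C f" "f \<in> arr C" "src C f = Q" "trg C f = L \<kappa>"
  using L_complete[OF assms] isomorphicE by metis

lemma zero_factorization:
  assumes "g \<in> arr C" "null C g" "f \<in> arr C" "trg C f = trg C g"
  shows "\<exists>h\<in>hom C (src C g) (src C f). f \<cdot> h = g"
proof (rule bexI)
  let ?z = "hzero C (src C g) (src C f)"
  have z: "?z \<in> arr C" "src C ?z = src C g" "trg C ?z = src C f" "null C ?z" using assms by simp_all
  then show "?z \<in> hom C (src C g) (src C f)" by simp
  have "null C (f \<cdot> ?z)" using z assms by - (rule null_comp(1); simp)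
  then show "f \<cdot> ?z = g" using z assms by - (rule null_eq; simp)
qed

lemma zero_cofactorization:
  assumes "g \<in> arr C" "null C g" "f \<in> arr C" "src C f = src C g"
  shows "\<exists>h\<in>hom C (trg C f) (trg C g). h \<cdot> f = g"
proof (rule bexI)
  let ?z = "hzero C (trg C f) (trg C g)"
  have z: "?z \<in> arr C" "src C ?z = trg C f" "trg C ?z = trg C g" "null C ?z" using assms by simp_all
  then show "?z \<in> hom C (trg C f) (trg C g)" by simp
  have "null C (?z \<cdot> f)" using z assms by - (rule null_comp(2); simp)
  then show "?z \<cdot> f = g" using z assms by - (rule null_eq; simp)
qed

text \<open>Relative injectivity of \<open>\<nabla>(\<mu>)\<close> gives a nonzero \<open>f\<close>. Its image contains the socle, through which every map
  \<open>\<Delta>(\<kappa>) \<rightarrow> \<nabla>(\<mu>)\<close> factors, and relative projectivity of \<open>\<Delta>(\<mu>)\<close> lifts it to \<open>N\<close>. With all these lifts, \<open>f\<close> is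
  epi by \<open>epi_if_filtered_lift\<close> and the kernel inherits the hypothesis by \<open>ext_vanishes_kernel\<close>.\<close>

lemma costandard_quotient_step:
  assumes N: "N \<in> obj C" and ext: "\<And>\<kappa>. \<kappa> \<in> \<Lambda> \<Longrightarrow> ext_vanishes C (standard C T \<nu> \<kappa>) N"
    and \<mu>: "\<mu> \<in> factors N" and max: "no_factor_above \<mu> N"
  obtains f k where "ses C k f" "src C f = N" "trg C f = costandard C \<nu> \<mu>"
    "\<And>\<kappa>. \<kappa> \<in> \<Lambda> \<Longrightarrow> ext_vanishes C (standard C T \<nu> \<kappa>) (src C k)"
proof -
  have \<mu>L: "\<mu> \<in> \<Lambda>" and F: "has_factor C N (L \<mu>)" using \<mu> by (auto simp: factors_def)
  let ?V = "costandard C \<nu> \<mu>"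
  obtain l0 where l0: "is_mono C l0" "l0 \<in> arr C" "src C l0 = L \<mu>" "trg C l0 = ?V"
    using socle[OF \<mu>L] by metis
  obtain x0 e0 where x0: "is_mono C x0" "is_epi C e0" "trg C x0 = N" "src C x0 = src C e0" "trg C e0 = L \<mu>"
    using F by (auto simp: has_factor_def)
  note x0a = mono_arr[OF x0(1)] epi_arr[OF x0(2)]
  obtain f where f: "f \<in> arr C" "src C f = N" "trg C f = ?V" "f \<cdot> x0 = l0 \<cdot> e0"
    using costandard_relatively_injective[OF \<mu>L x0(1), of "l0 \<cdot> e0"] max x0 x0a l0
    unfolding Bex_def hom_iff by auto
  have "\<not> null C (l0 \<cdot> e0)"
    using mono_null[OF l0(1), of e0] simple_epi_nonzero[of e0] x0 x0a l0 simple_L[OF \<mu>L] by simp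
  then have fn: "\<not> null C f" using null_comp(2)[of x0 f] f x0 x0a by auto
  obtain m x where m: "is_mono C m" "is_epi C x" "m \<in> arr C" "x \<in> arr C" "trg C m = ?V"
    "src C x = N" "src C m = trg C x" "m \<cdot> x = f"
    using image[OF f(1)] f by metis
  have "\<not> null C m" using nonzero_image(1)[of m x] m fn by simp
  then have mz: "\<not> zero_obj C (src C m)" using mono_null_src[OF m(1)] by simp
  have lift: "\<exists>h\<in>hom C D (src C f). f \<cdot> h = g"
    if D: "D \<in> standards" and g: "g \<in> hom C D (trg C f)" for D g
  proof (cases "null C g")
    case True
    then show ?thesis using zero_factorization[of g f] f g by simp
  next
    case False
    obtain \<kappa> where \<kappa>: "\<kappa> \<in> \<Lambda>" "D = standard C T \<nu> \<kappa>" using D by blast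
    then have "\<kappa> = \<mu>" using standard_costandard_hom[OF \<kappa>(1) \<mu>L, of g] g f False by simp
    then have D: "D = standard C T \<nu> \<mu>" using \<kappa> by simp
    obtain b l where b: "b \<in> hom C D (L \<mu>)" and l: "l \<in> hom C (L \<mu>) ?V" "is_mono C l" "l \<cdot> b = g"
      using standard_costandard_through_socle[OF \<mu>L, of g] g f D by auto
    have "sub_le C l m" using costandard_sub_least[OF \<mu>L m(1)] m mz l by simp
    then obtain r where r: "r \<in> arr C" "src C r = L \<mu>" "trg C r = src C m" "m \<cdot> r = l"
      using sub_leE l by (metis hom_iff)
    have rm: "is_mono C r" using mono_first[of r m] r m l by simp
    obtain p q where p: "is_epi C p" "p \<in> arr C" "q \<in> arr C" "trg C p = src C r" "src C p = src C q"
      "trg C q = src C x" "r \<cdot> p = x \<cdot> q" "is_mono C r \<Longrightarrow> is_mono C q"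
      using epi_lift[OF m(2) r(1)] r m by metis
    \<comment> \<open>The preimage of the socle in \<open>N\<close> has a part of finite length that still maps onto the socle.\<close>
    obtain n where n: "is_mono C n" "trg C n = src C p" "series C N 0 (src C n)" "is_epi C (p \<cdot> n)"
      using finite_sub_onto_simple[OF p(1), of N] p r simple_L[OF \<mu>L] by auto
    note na = mono_arr[OF n(1)]
    have qn: "is_mono C (q \<cdot> n)" "src C (q \<cdot> n) = src C n" "trg C (q \<cdot> n) = N"
      using mono_comp[OF n(1) p(8)[OF rm]] p n na m by simp_all
    have "no_factor_above \<mu> (src C n)" using no_factor_above_sub[OF _ qn(1)] max qn by simp
    then obtain h where h: "h \<in> arr C" "src C h = D" "trg C h = src C n" "(p \<cdot> n) \<cdot> h = b"
      using standard_relatively_projective[OF \<mu>L n(4), of b] n p na r b D finite_length_iff[of "src C n" N]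
      unfolding Bex_def hom_iff by auto
    have "f \<cdot> (q \<cdot> (n \<cdot> h)) = m \<cdot> (x \<cdot> (q \<cdot> (n \<cdot> h)))"
      using comp_reduce[OF m(8), of "q \<cdot> (n \<cdot> h)"] m(1-7) p(1-6) n na h(1-3) by simp
    also have "x \<cdot> (q \<cdot> (n \<cdot> h)) = (r \<cdot> p) \<cdot> (n \<cdot> h)"
      unfolding p(7) using m(1-7) p(1-6) n na h(1-3) by simp
    also have "\<dots> = r \<cdot> b" using h(4)[symmetric] r(1-3) p(1-6) n na h(1-3) by simp
    also have "m \<cdot> (r \<cdot> b) = l \<cdot> b" using comp_reduce[OF r(4), of b] r m b by simp
    finally have "f \<cdot> (q \<cdot> (n \<cdot> h)) = g" using l by simp
    then show ?thesis using h p n na m f by (intro bexI[of _ "q \<cdot> (n \<cdot> h)"]) simp_all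
  qed
  have "is_epi C f"
  proof (rule epi_if_filtered_lift[OF f(1)])
    show "series C S 0 (trg C f)" using costandard_finite[OF \<mu>L] f finite_length_iff by simp
    show "ext_vanishes C D (src C f)" if "D \<in> standards" for D using ext that f by auto
    fix e assume e: "is_epi C e" "src C e = trg C f" "simple_obj C (trg C e)"
    note ea = epi_arr[OF e(1)]
    obtain \<kappa> g where g: "\<kappa> \<in> \<Lambda>" "is_iso C g" "g \<in> arr C" "src C g = trg C e" "trg C g = L \<kappa>"
      using simple_iso_L[OF e(3)] by metis
    have ge: "is_epi C (g \<cdot> e)" "src C (g \<cdot> e) = ?V" "trg C (g \<cdot> e) = L \<kappa>"
      using epi_comp[OF e(1) iso_mono_epi(2)[OF g(2)]] g ea e f by simp_all
    have "finite_length C (src C (g \<cdot> e))" using costandard_finite[OF \<mu>L] ge by simp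
    then obtain P h where P: "filtered_by C standards P" "h \<in> hom C P (src C (g \<cdot> e))" "\<not> null C ((g \<cdot> e) \<cdot> h)"
      using finite_standard_source[OF g(1) ge(1)] ge(3) by metis
    have "\<not> null C (e \<cdot> h)" using P(2,3) g ea e ge f nonzero_image(2)[of g "e \<cdot> h"] by simp
    then show "\<exists>P h. filtered_by C standards P \<and> h \<in> hom C P (trg C f) \<and> \<not> null C (e \<cdot> h)"
      using P ge f by auto
  qed (use lift in blast)
  moreover obtain k where k: "is_kernel C k f" using kernelE[OF f(1)] by metis
  ultimately have kf: "ses C k f" by (rule epi_kernel_ses)
  have "ext_vanishes C (standard C T \<nu> \<kappa>) (src C k)" if "\<kappa> \<in> \<Lambda>" for \<kappa>
    using ext_vanishes_kernel[OF _ k, of "standard C T \<nu> \<kappa>"] ext[OF that] f lift that by blast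
  then show ?thesis using that[OF kf] f by blast
qed

text \<open>The mirror image of \<open>costandard_quotient_step\<close>, with \<open>epi_if_filtered_lift\<close> and
  \<open>ext_vanishes_kernel\<close> applied in the opposite category. Only the nonzero map \<open>f\<close> is found differently:
  relative projectivity holds for objects of finite length, so \<open>f\<close> goes through a finite part of \<open>N\<close>.\<close>

lemma standard_sub_step:
  assumes N: "N \<in> obj C" and ext: "\<And>\<kappa>. \<kappa> \<in> \<Lambda> \<Longrightarrow> ext_vanishes (opp C) (costandard C \<nu> \<kappa>) N"
    and \<mu>: "\<mu> \<in> factors N" and max: "no_factor_above \<mu> N"
  obtains f c where "ses C f c" "trg C f = N" "src C f = standard C T \<nu> \<mu>"
    "\<And>\<kappa>. \<kappa> \<in> \<Lambda> \<Longrightarrow> ext_vanishes (opp C) (costandard C \<nu> \<kappa>) (trg C c)"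
proof -
  have \<mu>L: "\<mu> \<in> \<Lambda>" and F: "has_factor C N (L \<mu>)" using \<mu> by (auto simp: factors_def)
  let ?W = "standard C T \<nu> \<mu>"
  obtain p where p: "is_epi C p" "p \<in> arr C" "src C p = ?W" "trg C p = L \<mu>"
    using standard_top[OF \<mu>L] by metis
  obtain x0 e0 where x0: "is_mono C x0" "trg C x0 = N" "series C N 0 (src C x0)" "is_epi C e0"
    "src C e0 = src C x0" "trg C e0 = L \<mu>"
    using has_factor_finite[OF F simple_L[OF \<mu>L]] by metis
  note x0a = mono_arr[OF x0(1)] epi_arr[OF x0(4)]
  have "no_factor_above \<mu> (src C x0)" using no_factor_above_sub[OF _ x0(1)] max x0 by simp
  then obtain h0 where h0: "h0 \<in> arr C" "src C h0 = ?W" "trg C h0 = src C x0" "e0 \<cdot> h0 = p"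
    using standard_relatively_projective[OF \<mu>L x0(4), of p] x0 p finite_length_iff[of "src C x0" N]
    unfolding Bex_def hom_iff by auto
  have "\<not> null C p" using simple_epi_nonzero[of p] p simple_L[OF \<mu>L] by simp
  then have "\<not> null C h0" using nonzero_image(2)[of e0 h0] h0 x0 x0a by simp
  then have fn: "\<not> null C (x0 \<cdot> h0)" using mono_null[OF x0(1), of h0] h0 by simp
  obtain f where f: "f \<in> arr C" "src C f = ?W" "trg C f = N" "\<not> null C f"
    using fn h0 x0 x0a by (metis comp_arr)
  obtain m x where m: "is_mono C m" "is_epi C x" "m \<in> arr C" "x \<in> arr C" "trg C m = N"
    "src C x = ?W" "src C m = trg C x" "m \<cdot> x = f"
    using image[OF f(1)] f by metis
  have "\<not> null C x" using nonzero_image(2)[of m x] m f by simp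
  then have xz: "\<not> zero_obj C (trg C x)" using epi_null_trg[OF m(2)] by simp
  have lift: "\<exists>h\<in>hom C N D. h \<cdot> f = g"
    if D: "D \<in> costandards" and g: "g \<in> hom C ?W D" for D g
  proof (cases "null C g")
    case True
    then show ?thesis using zero_cofactorization[of g f] f g by simp
  next
    case False
    obtain \<kappa> where \<kappa>: "\<kappa> \<in> \<Lambda>" "D = costandard C \<nu> \<kappa>" using D by blast
    then have "\<mu> = \<kappa>" using standard_costandard_hom[OF \<mu>L \<kappa>(1), of g] g False by simp
    then have D: "D = costandard C \<nu> \<mu>" using \<kappa> by simp
    obtain b l where b: "b \<in> hom C ?W (L \<mu>)" and l: "l \<in> hom C (L \<mu>) D" "l \<cdot> b = g"
      using standard_costandard_through_socle[OF \<mu>L, of g] g D by metis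
    obtain r where r: "r \<in> arr C" "src C r = trg C x" "trg C r = L \<mu>" "r \<cdot> x = b"
      using standard_quotient_least[OF \<mu>L m(2,6) xz b] by auto
    obtain h where h: "h \<in> arr C" "src C h = N" "trg C h = D" "h \<cdot> m = l \<cdot> r"
      using costandard_relatively_injective[OF \<mu>L m(1), of "l \<cdot> r"] max m r l D
      unfolding Bex_def hom_iff by auto
    have "h \<cdot> f = (h \<cdot> m) \<cdot> x" unfolding m(8)[symmetric] using h(1-3) m(1-7) by simp
    also have "\<dots> = l \<cdot> (r \<cdot> x)" unfolding h(4) using l r m(1-7) by simp
    finally have "h \<cdot> f = g" using r l by simp
    then show ?thesis using h by (intro bexI[of _ h]) simp_all
  qed
  have "is_epi (opp C) f"
  proof (rule abelian_linear_category.epi_if_filtered_lift[OF abelian_opp, where R = costandards])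
    show "series (opp C) S 0 (trg (opp C) f)" using standard_finite[OF \<mu>L] f finite_length_iff by simp
    show "ext_vanishes (opp C) D (src (opp C) f)" if "D \<in> costandards" for D using ext that f by auto
    show "\<exists>h\<in>hom (opp C) D (src (opp C) f). cmp (opp C) f h = g"
      if "D \<in> costandards" "g \<in> hom (opp C) D (trg (opp C) f)" for D g
      using lift[OF that(1), of g] that f by simp
    fix e assume "is_epi (opp C) e" "src (opp C) e = trg (opp C) f" "simple_obj (opp C) (trg (opp C) e)"
    then have e: "is_mono C e" "trg C e = ?W" "simple_obj C (src C e)" using f by simp_all
    note ea = mono_arr[OF e(1)]
    obtain \<kappa> g' where g': "\<kappa> \<in> \<Lambda>" "is_iso C g'" "g' \<in> arr C" "src C g' = src C e" "trg C g' = L \<kappa>"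
      using simple_iso_L[OF e(3)] by metis
    obtain g where g: "g \<in> arr C" "src C g = L \<kappa>" "trg C g = src C e" "is_iso C g"
      using isoE[OF g'(2)] g' by metis
    have ge: "is_mono C (e \<cdot> g)" "trg C (e \<cdot> g) = ?W" "src C (e \<cdot> g) = L \<kappa>"
      using mono_comp[OF iso_mono_epi(1)[OF g(4)] e(1)] g ea e by simp_all
    have sW: "series C N 0 (trg C (e \<cdot> g))" using standard_finite[OF \<mu>L] ge finite_length_iff by simp
    obtain P h where P: "filtered_by (opp C) costandards P" "h \<in> hom C (trg C (e \<cdot> g)) P" "\<not> null C (h \<cdot> (e \<cdot> g))"
      by (rule finite_costandard_target[OF g'(1) sW ge(1,3)])
    have "\<not> null C (h \<cdot> e)"
      using P(2,3) g ea e ge nonzero_image(1)[of "h \<cdot> e" g] by simp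
    then show "\<exists>P h. filtered_by (opp C) costandards P \<and> h \<in> hom (opp C) P (trg (opp C) f) \<and>
        \<not> null (opp C) (cmp (opp C) e h)"
      using P ge f by auto
  qed (use f in simp)
  then have "is_mono C f" by simp
  moreover obtain c where c: "is_cokernel C c f" using cokernelE[OF f(1)] by metis
  ultimately have fc: "ses C f c" by (rule mono_cokernel_ses)
  have "ext_vanishes (opp C) (costandard C \<nu> \<kappa>) (trg C c)" if "\<kappa> \<in> \<Lambda>" for \<kappa>
    using abelian_linear_category.ext_vanishes_kernel[OF abelian_opp, of "costandard C \<nu> \<kappa>" f c]
      ext[OF that] f c lift[of "costandard C \<nu> \<kappa>"] that by simp
  then show ?thesis using that[OF fc] f by blast
qed


subsection \<open>Multiplicities bound the number of steps\<close>

text \<open>The multiplicity \<open>[X : L(\<mu>)]\<close> as a natural number, for subobjects \<open>X\<close> of a restricted object.\<close>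

definition nat_mult :: "'o \<Rightarrow> 'l \<Rightarrow> nat" where
  "nat_mult X \<mu> = (GREATEST n. mult_at_least C (L \<mu>) X n)"

lemma nat_mult:
  assumes M: "restricted C \<Lambda> L \<Gamma> M" "\<mu> \<in> \<Gamma>" and m: "is_mono C m" "trg C m = M"
  shows "mult_at_least C (L \<mu>) (src C m) (nat_mult (src C m) \<mu>)"
    and "mult_at_least C (L \<mu>) (src C m) n \<Longrightarrow> n \<le> nat_mult (src C m) \<mu>"
    and "nat_mult (src C m) \<mu> \<le> the_enat (mult C M (L \<mu>))"
proof -
  have fin: "mult C M (L \<mu>) < \<infinity>" using restrictedD[OF M(1)] M by blast
  have b: "n \<le> the_enat (mult C M (L \<mu>))" if "mult_at_least C (L \<mu>) (src C m) n" for n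
  proof -
    have "enat n \<le> mult C M (L \<mu>)" using mult_at_least_le_mult mult_at_least_sub[OF m(1) that] m by simp
    then show ?thesis using fin by (cases "mult C M (L \<mu>)") auto
  qed
  have z: "mult_at_least C (L \<mu>) (src C m) 0" using mult_at_least_zero mono_arr[OF m(1)] by simp
  show A: "mult_at_least C (L \<mu>) (src C m) (nat_mult (src C m) \<mu>)"
    unfolding nat_mult_def by (rule GreatestI_nat[where P = "mult_at_least C (L \<mu>) (src C m)", OF z]) (use b in blast)
  show "n \<le> nat_mult (src C m) \<mu>" if "mult_at_least C (L \<mu>) (src C m) n"
    unfolding nat_mult_def by (rule Greatest_le_nat[where P = "mult_at_least C (L \<mu>) (src C m)", OF that]) (use b in blast)
  show "nat_mult (src C m) \<mu> \<le> the_enat (mult C M (L \<mu>))" using b A by blast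
qed

lemma nat_mult_mono:
  assumes M: "restricted C \<Lambda> L \<Gamma> M" "\<mu> \<in> \<Gamma>" and m: "is_mono C m" "trg C m = M"
    and j: "is_mono C j" "trg C j = src C m"
  shows "nat_mult (src C j) \<mu> \<le> nat_mult (src C m) \<mu>"
proof -
  have mj: "is_mono C (m \<cdot> j)" "src C (m \<cdot> j) = src C j" "trg C (m \<cdot> j) = M"
    using mono_comp[OF j(1) m(1)] m j mono_arr[OF j(1)] mono_arr[OF m(1)] by simp_all
  have "mult_at_least C (L \<mu>) (src C m) (nat_mult (src C j) \<mu>)"
    using mult_at_least_sub[OF j(1)] nat_mult(1)[OF M mj(1,3)] mj j by simp
  then show ?thesis by (rule nat_mult(2)[OF M m])
qed

lemma nat_mult_jump:
  assumes M: "restricted C \<Lambda> L \<Gamma> M" "\<mu> \<in> \<Gamma>" "\<mu> \<in> \<Lambda>" and m: "is_mono C m" "trg C m = M"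
    and e: "ses C j q" "trg C j = src C m" "has_factor C (trg C q) (L \<mu>)"
  shows "nat_mult (src C j) \<mu> < nat_mult (src C m) \<mu>"
proof -
  note D = sesD[OF e(1)]
  have mj: "is_mono C (m \<cdot> j)" "src C (m \<cdot> j) = src C j" "trg C (m \<cdot> j) = M"
    using mono_comp[OF D(4) m(1)] m e D mono_arr[OF m(1)] by simp_all
  have "mult_at_least C (L \<mu>) (trg C j) (Suc (nat_mult (src C j) \<mu>))"
    using mult_at_least_extension[OF e(1) simple_L[OF M(3)] e(3)] nat_mult(1)[OF M(1,2) mj(1,3)] mj by simp
  then show ?thesis using nat_mult(2)[OF M(1,2) m, of "Suc (nat_mult (src C j) \<mu>)"] e(2) by (simp add: Suc_le_eq)
qed

lemma fg_ideal_sub: "fg_ideal \<Lambda> \<Gamma> \<Longrightarrow> \<Gamma> \<subseteq> \<Lambda>"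
  by (auto simp: fg_ideal_def)

lemma fg_ideal_down: "fg_ideal \<Lambda> \<Gamma> \<Longrightarrow> \<mu> \<in> \<Gamma> \<Longrightarrow> \<kappa> \<in> \<Lambda> \<Longrightarrow> \<kappa> \<le> \<mu> \<Longrightarrow> \<kappa> \<in> \<Gamma>"
  by (auto simp: fg_ideal_def intro: order_trans)

lemma ideal_chainE:
  assumes "fg_ideal \<Lambda> \<Gamma>"
  obtains G :: "nat \<Rightarrow> 'l set" where "\<forall>k. finite (\<Gamma> - G k)"
    "\<forall>k. \<forall>\<mu>\<in>G k. \<forall>\<kappa>\<in>\<Gamma>. \<kappa> \<le> \<mu> \<longrightarrow> \<kappa> \<in> G k" "\<forall>k. G (Suc k) \<subseteq> G k" "(\<Inter>k. G k) = {}"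
proof -
  obtain G :: "nat \<Rightarrow> 'l set" where G: "\<forall>k. fg_ideal \<Lambda> (G k) \<and> G (Suc k) \<subseteq> G k \<and> finite (\<Gamma> - G k)"
    "(\<Inter>k. G k) = {}"
    using ideal_chain[OF assms] by blast
  have "\<forall>k. \<forall>\<mu>\<in>G k. \<forall>\<kappa>\<in>\<Gamma>. \<kappa> \<le> \<mu> \<longrightarrow> \<kappa> \<in> G k"
    using fg_ideal_down fg_ideal_sub[OF assms] G(1) by blast
  with G show ?thesis by (intro that[of G]) simp_all
qed

lemma costandard_has_top_factor:
  "\<mu> \<in> \<Lambda> \<Longrightarrow> has_factor C (costandard C \<nu> \<mu>) (L \<mu>)"
  using socle has_factor_of_mono by metis

lemma standard_has_top_factor:
  "\<mu> \<in> \<Lambda> \<Longrightarrow> has_factor C (standard C T \<nu> \<mu>) (L \<mu>)"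
  using standard_top has_factor_of_epi by metis

definition chain_length :: "(nat \<Rightarrow> bool) \<Rightarrow> enat" where
  "chain_length stop = (if \<exists>i. stop i then enat (LEAST i. stop i) else \<infinity>)"

lemma chain_length_less: "enat i < chain_length stop \<Longrightarrow> \<not> stop i"
  using not_less_Least[of i stop] by (auto simp: chain_length_def split: if_splits)

lemma chain_length_eq: "chain_length stop = enat i \<Longrightarrow> stop i"
  by (auto simp: chain_length_def split: if_splits intro: LeastI)

text \<open>The states of \<open>exhaust_from_above\<close> are the subobjects in the filtration. A subobject contained in all
  of them has no composition factors left.\<close>

theorem decr_costandard_filtration:
  assumes \<Gamma>: "fg_ideal \<Lambda> \<Gamma>" and M: "restricted C \<Lambda> L \<Gamma> M"
    and ext: "\<And>\<mu>. \<mu> \<in> \<Lambda> \<Longrightarrow> ext_vanishes C (standard C T \<nu> \<mu>) M"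
  shows "has_decr_filtration C costandards M"
proof -
  note MD = restrictedD[OF M]
  obtain G :: "nat \<Rightarrow> 'l set" where G0: "\<forall>k. finite (\<Gamma> - G k)"
    "\<forall>k. \<forall>\<mu>\<in>G k. \<forall>\<kappa>\<in>\<Gamma>. \<kappa> \<le> \<mu> \<longrightarrow> \<kappa> \<in> G k" "\<forall>k. G (Suc k) \<subseteq> G k" "(\<Inter>k. G k) = {}"
    by (rule ideal_chainE[OF \<Gamma>])
  have G: "finite (\<Gamma> - G k)" "\<mu> \<in> G k \<Longrightarrow> \<kappa> \<in> \<Gamma> \<Longrightarrow> \<kappa> \<le> \<mu> \<Longrightarrow> \<kappa> \<in> G k" "G (Suc k) \<subseteq> G k"
    "(\<Inter>k. G k) = {}" for k \<mu> \<kappa>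
    using G0 by blast+
  define Inv where "Inv m \<longleftrightarrow> is_mono C m \<and> trg C m = M \<and>
    (\<forall>\<mu>\<in>\<Lambda>. ext_vanishes C (standard C T \<nu> \<mu>) (src C m))" for m
  define supp where "supp m = factors (src C m)" for m
  define R where "R \<mu> m m' \<longleftrightarrow> (\<exists>k f. ses C k f \<and> trg C k = src C m \<and> m' = m \<cdot> k \<and>
    trg C f = costandard C \<nu> \<mu>)" for \<mu> m m'
  have Inv0: "Inv (\<one> M)" using MD ext iso_mono_epi(1)[OF id_iso] by (simp add: Inv_def)
  have RD: "src C m' = src C k" "trg C k = src C m" "is_mono C k"
    if "ses C k f" "trg C k = src C m" "m' = m \<cdot> k" "Inv m" for k f m m'
    using that sesD[OF that(1)] mono_arr[of m] by (simp_all add: Inv_def)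
  have suppG: "supp m \<subseteq> \<Gamma>" if "Inv m" for m
    using factors_sub[of m] that MD by (auto simp: Inv_def supp_def)
  have step: "\<exists>m'. Inv m' \<and> R \<mu> m m'"
    if m: "Inv m" "\<mu> \<in> supp m" and max: "\<And>\<kappa>. \<kappa> \<in> supp m \<Longrightarrow> \<not> \<mu> < \<kappa>" for m \<mu>
  proof -
    note ma = mono_arr[of m]
    obtain f k where f: "ses C k f" "src C f = src C m" "trg C f = costandard C \<nu> \<mu>"
      "\<And>\<kappa>. \<kappa> \<in> \<Lambda> \<Longrightarrow> ext_vanishes C (standard C T \<nu> \<kappa>) (src C k)"
      by (rule costandard_quotient_step[of "src C m" \<mu>])
        (use m ma no_factor_above_if_maximal[of "src C m" \<mu>] max in \<open>auto simp: Inv_def supp_def\<close>)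
    have "is_mono C (m \<cdot> k)" "trg C (m \<cdot> k) = M" "src C (m \<cdot> k) = src C k"
      using mono_comp[of k m] m ma sesD[OF f(1)] f(2) by (simp_all add: Inv_def)
    then have "Inv (m \<cdot> k)" using f(4) by (simp add: Inv_def)
    moreover have "R \<mu> m (m \<cdot> k)"
      unfolding R_def using f(1-3) sesD[OF f(1)] by (intro exI[of _ k] exI[of _ f]) simp
    ultimately show ?thesis by blast
  qed
  obtain X where X0: "X 0 = \<one> M" and inv: "\<And>i. Inv (X i)"
    and st: "\<And>i. supp (X i) \<noteq> {} \<Longrightarrow> \<exists>\<mu>\<in>supp (X i). R \<mu> (X i) (X (Suc i))"
    and ex: "\<And>\<mu>. \<exists>i. \<mu> \<notin> supp (X i)"
  proof (rule exhaust_from_above[OF G, where Inv = Inv and supp = supp and R = R and ?x0.0 = "\<one> M"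
        and d = "\<lambda>m. nat_mult (src C m)"])
    show "supp m' \<subseteq> supp m" if "Inv m" "R \<mu> m m'" for m m' \<mu>
      using that factors_sub RD unfolding R_def supp_def by metis
    show "nat_mult (src C m') \<kappa> \<le> nat_mult (src C m) \<kappa>"
      if "Inv m" "R \<mu> m m'" "\<kappa> \<in> \<Gamma>" for m m' \<mu> \<kappa>
      using that nat_mult_mono[OF M that(3)] RD unfolding R_def Inv_def by metis
    show "nat_mult (src C m') \<mu> < nat_mult (src C m) \<mu>"
      if m: "Inv m" "R \<mu> m m'" "\<mu> \<in> \<Gamma>" for m m' \<mu>
    proof -
      have \<mu>: "\<mu> \<in> \<Lambda>" using fg_ideal_sub[OF \<Gamma>] m by blast
      obtain k f where k: "ses C k f" "trg C k = src C m" "m' = m \<cdot> k" "trg C f = costandard C \<nu> \<mu>"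
        using m unfolding R_def by blast
      have "nat_mult (src C k) \<mu> < nat_mult (src C m) \<mu>"
        using nat_mult_jump[OF M m(3) \<mu> _ _ k(1,2)] costandard_has_top_factor[OF \<mu>] k m
        by (simp add: Inv_def)
      then show ?thesis using RD[OF k(1-3) m(1)] by simp
    qed
  qed (use Inv0 suppG step in blast)+
  define N where "N = chain_length (\<lambda>i. supp (X i) = {})"
  have Xm: "is_mono C (X i)" "X i \<in> arr C" "trg C (X i) = M" for i
    using inv[of i] mono_arr by (auto simp: Inv_def)
  have st': "\<exists>Q\<in>costandards. is_quotient C (X (Suc i)) (X i) Q \<and> sub_le C (X (Suc i)) (X i)"
    if i: "enat i < N" for i
  proof -
    obtain \<mu> where \<mu>: "\<mu> \<in> supp (X i)" "R \<mu> (X i) (X (Suc i))"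
      using st chain_length_less i unfolding N_def by blast
    then obtain k f where k: "ses C k f" "trg C k = src C (X i)" "X (Suc i) = X i \<cdot> k"
      "trg C f = costandard C \<nu> \<mu>"
      unfolding R_def by blast
    have "is_quotient C (X (Suc i)) (X i) (costandard C \<nu> \<mu>)"
      using k Xm by (intro is_quotientI[OF k(1)]) simp_all
    moreover have "sub_le C (X (Suc i)) (X i)"
      using k Xm sesD[OF k(1)] by (intro sub_leI[of k]) simp_all
    moreover have "\<mu> \<in> \<Lambda>" using \<mu> by (simp add: supp_def factors_def)
    ultimately show ?thesis by blast
  qed
  obtain z where z: "ses C z (\<one> M)" "zero_obj C (src C z)" using zero_ses MD by blast
  note zD = sesD[OF z(1)]
  have null_le: "sub_le C v w" if v: "v \<in> arr C" "null C v" "w \<in> arr C" "trg C w = trg C v" for v w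
    using zero_factorization[OF v] v(3) by (auto intro: sub_leI)
  have "is_inter C M {X i | i. enat i \<le> N} z"
    unfolding is_inter_def
  proof (intro conjI ballI allI impI)
    show "subobj C M z" using zD MD by (simp add: subobj_def)
    have zn: "null C z" using mono_null_src[OF zD(4)] z by simp
    show "sub_le C z s" if "s \<in> {X i | i. enat i \<le> N}" for s
      using that null_le[OF zD(1) zn] Xm zD MD by auto
    fix v assume v: "subobj C M v \<and> (\<forall>s\<in>{X i | i. enat i \<le> N}. sub_le C v s)"
    then have vm: "is_mono C v" "trg C v = M" "v \<in> arr C" by (auto simp: subobj_def mono_arr)
    have sub: "factors (src C v) \<subseteq> supp (X i)" if "enat i \<le> N" for i
    proof -
      have "sub_le C v (X i)" using v that by blast
      then obtain j where j: "j \<in> arr C" "src C j = src C v" "trg C j = src C (X i)" "X i \<cdot> j = v"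
        using sub_leE by metis
      have "is_mono C j" using mono_first[of j "X i"] j Xm vm by simp
      then show ?thesis using factors_sub[of j] j by (simp add: supp_def)
    qed
    have "factors (src C v) = {}"
    proof (cases N)
      case (enat i)
      then have "supp (X i) = {}" using chain_length_eq unfolding N_def by blast
      then show ?thesis using sub[of i] enat by simp
    next
      case infinity
      then show ?thesis using sub ex by (metis enat_ord_simps(3) subsetD subset_empty subsetI)
    qed
    then have "zero_obj C (src C v)" using factors_empty vm by simp
    then have "null C v" using mono_null_src[OF vm(1)] by simp
    then show "sub_le C v z" using null_le[OF vm(3)] zD vm MD by simp
  qed
  then have "\<exists>z. zero_obj C (src C z) \<and> is_inter C M {X i | i. enat i \<le> N} z" using z by blast
  then have "decr_chain C M N X"
    unfolding decr_chain_def using Xm X0 MD(1) st' id_iso by (simp add: subobj_def)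
  moreover have "\<forall>i. enat i < N \<longrightarrow> (\<exists>Q\<in>costandards. is_quotient C (X (Suc i)) (X i) Q)"
    using st' by blast
  ultimately show ?thesis
    unfolding has_decr_filtration_def using MD(1) by (intro conjI exI[of _ N] exI[of _ X])
qed

text \<open>A state consists of a subobject of \<open>M\<close> together with its quotient; the remaining weights are those of the
  quotient. The multiplicities of the subobjects increase and are bounded by those of \<open>M\<close>, so their
  complements serve as counters. A subobject containing all stages has a quotient without composition
  factors.\<close>

theorem incr_standard_filtration:
  assumes \<Gamma>: "fg_ideal \<Lambda> \<Gamma>" and M: "restricted C \<Lambda> L \<Gamma> M"
    and ext: "\<And>\<mu>. \<mu> \<in> \<Lambda> \<Longrightarrow> ext_vanishes (opp C) (costandard C \<nu> \<mu>) M"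
  shows "has_incr_filtration C standards M"
proof -
  note MD = restrictedD[OF M]
  obtain G :: "nat \<Rightarrow> 'l set" where G0: "\<forall>k. finite (\<Gamma> - G k)"
    "\<forall>k. \<forall>\<mu>\<in>G k. \<forall>\<kappa>\<in>\<Gamma>. \<kappa> \<le> \<mu> \<longrightarrow> \<kappa> \<in> G k" "\<forall>k. G (Suc k) \<subseteq> G k" "(\<Inter>k. G k) = {}"
    by (rule ideal_chainE[OF \<Gamma>])
  have G: "finite (\<Gamma> - G k)" "\<mu> \<in> G k \<Longrightarrow> \<kappa> \<in> \<Gamma> \<Longrightarrow> \<kappa> \<le> \<mu> \<Longrightarrow> \<kappa> \<in> G k" "G (Suc k) \<subseteq> G k"
    "(\<Inter>k. G k) = {}" for k \<mu> \<kappa>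
    using G0 by blast+
  define Inv where "Inv x \<longleftrightarrow> ses C (fst x) (snd x) \<and> trg C (fst x) = M \<and>
    (\<forall>\<mu>\<in>\<Lambda>. ext_vanishes (opp C) (costandard C \<nu> \<mu>) (trg C (snd x)))" for x
  define supp where "supp x = factors (trg C (snd x))" for x :: "'a \<times> 'a"
  define R where "R \<mu> x y \<longleftrightarrow> (\<exists>j e c. ses C j e \<and> trg C j = src C (fst y) \<and> src C j = src C (fst x) \<and>
    fst y \<cdot> j = fst x \<and> trg C e = standard C T \<nu> \<mu> \<and> is_epi C c \<and> src C c = trg C (snd x) \<and>
    snd y = c \<cdot> snd x)" for \<mu> and x y :: "'a \<times> 'a"
  obtain z where z: "ses C z (\<one> M)" "zero_obj C (src C z)" using zero_ses MD by blast
  have Inv0: "Inv (z, \<one> M)" using MD ext z sesD[OF z(1)] by (simp add: Inv_def)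
  have InvD: "is_mono C (fst x)" "fst x \<in> arr C" "is_epi C (snd x)" "snd x \<in> arr C" "src C (snd x) = M"
    "trg C (fst x) = M" if "Inv x" for x
    using that sesD[of "fst x" "snd x"] by (simp_all add: Inv_def)
  have suppG: "supp x \<subseteq> \<Gamma>" if "Inv x" for x
    using factors_quotient[of "snd x"] InvD[OF that] MD by (auto simp: supp_def)
  have step: "\<exists>y. Inv y \<and> R \<mu> x y"
    if x: "Inv x" "\<mu> \<in> supp x" and max: "\<And>\<kappa>. \<kappa> \<in> supp x \<Longrightarrow> \<not> \<mu> < \<kappa>" for x \<mu>
  proof -
    have s: "ses C (fst x) (snd x)" using x by (simp add: Inv_def)
    obtain f c where f: "ses C f c" "trg C f = trg C (snd x)" "src C f = standard C T \<nu> \<mu>"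
      "\<And>\<kappa>. \<kappa> \<in> \<Lambda> \<Longrightarrow> ext_vanishes (opp C) (costandard C \<nu> \<kappa>) (trg C c)"
      by (rule standard_sub_step[of "trg C (snd x)" \<mu>])
        (use x InvD[OF x(1)] no_factor_above_if_maximal[of "trg C (snd x)" \<mu>] max
          in \<open>auto simp: Inv_def supp_def\<close>)
    note cD = sesD[OF f(1)]
    obtain k j e where k: "ses C k (c \<cdot> snd x)" "ses C j e" "src C j = src C (fst x)" "trg C j = src C k"
      "trg C e = src C f" "k \<cdot> j = fst x" "trg C k = trg C (fst x)"
      using ses_preimage[OF f(1) s f(2)[symmetric]] by metis
    have "Inv (k, c \<cdot> snd x)" using k x f InvD[OF x(1)] cD by (simp add: Inv_def)
    moreover have "R \<mu> x (k, c \<cdot> snd x)"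
      unfolding R_def using k f cD by (intro exI[of _ j] exI[of _ e] exI[of _ c]) simp
    ultimately show ?thesis by blast
  qed
  obtain X where X0: "X 0 = (z, \<one> M)" and inv: "\<And>i. Inv (X i)"
    and st: "\<And>i. supp (X i) \<noteq> {} \<Longrightarrow> \<exists>\<mu>\<in>supp (X i). R \<mu> (X i) (X (Suc i))"
    and ex: "\<And>\<mu>. \<exists>i. \<mu> \<notin> supp (X i)"
  proof (rule exhaust_from_above[OF G, where Inv = Inv and supp = supp and R = R and ?x0.0 = "(z, \<one> M)"
        and d = "\<lambda>x \<mu>. the_enat (mult C M (L \<mu>)) - nat_mult (src C (fst x)) \<mu>"])
    show "supp y \<subseteq> supp x" if x: "Inv x" and r: "R \<mu> x y" for x y \<mu>
    proof -
      obtain c where "is_epi C c" "src C c = trg C (snd x)" "snd y = c \<cdot> snd x"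
        using r unfolding R_def by blast
      then show ?thesis
        using factors_quotient[of c] InvD[OF x] epi_arr[of c] by (simp add: supp_def)
    qed
    show "the_enat (mult C M (L \<kappa>)) - nat_mult (src C (fst y)) \<kappa>
      \<le> the_enat (mult C M (L \<kappa>)) - nat_mult (src C (fst x)) \<kappa>"
      if x: "Inv y" and r: "R \<mu> x y" and \<kappa>: "\<kappa> \<in> \<Gamma>" for x y \<mu> \<kappa>
    proof -
      obtain j e where "ses C j e" "trg C j = src C (fst y)" "src C j = src C (fst x)"
        using r unfolding R_def by blast
      then have "nat_mult (src C (fst x)) \<kappa> \<le> nat_mult (src C (fst y)) \<kappa>"
        using nat_mult_mono[OF M \<kappa> InvD(1,6)[OF x], of j] sesD(4)[of j e] by simp
      then show ?thesis by simp
    qed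
    show "the_enat (mult C M (L \<mu>)) - nat_mult (src C (fst y)) \<mu>
      < the_enat (mult C M (L \<mu>)) - nat_mult (src C (fst x)) \<mu>"
      if x: "Inv y" and r: "R \<mu> x y" and \<mu>: "\<mu> \<in> \<Gamma>" for x y \<mu>
    proof -
      have \<mu>L: "\<mu> \<in> \<Lambda>" using fg_ideal_sub[OF \<Gamma>] \<mu> by blast
      obtain j e where "ses C j e" "trg C j = src C (fst y)" "src C j = src C (fst x)"
        "trg C e = standard C T \<nu> \<mu>"
        using r unfolding R_def by blast
      then have "nat_mult (src C (fst x)) \<mu> < nat_mult (src C (fst y)) \<mu>"
        using nat_mult_jump[OF M \<mu> \<mu>L InvD(1,6)[OF x], of j e] standard_has_top_factor[OF \<mu>L] by simp
      then show ?thesis using nat_mult(3)[OF M \<mu> InvD(1,6)[OF x]] by simp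
    qed
  qed (use Inv0 suppG step in blast)+
  define N where "N = chain_length (\<lambda>i. supp (X i) = {})"
  let ?F = "\<lambda>i. fst (X i)"
  note XD = InvD[OF inv]
  have st': "\<exists>Q\<in>standards. is_quotient C (?F i) (?F (Suc i)) Q \<and> sub_le C (?F i) (?F (Suc i))"
    if i: "enat i < N" for i
  proof -
    obtain \<mu> where \<mu>: "\<mu> \<in> supp (X i)" "R \<mu> (X i) (X (Suc i))"
      using st chain_length_less i unfolding N_def by blast
    then obtain j e where k: "ses C j e" "trg C j = src C (?F (Suc i))" "?F (Suc i) \<cdot> j = ?F i"
      "trg C e = standard C T \<nu> \<mu>"
      unfolding R_def by blast
    have "is_quotient C (?F i) (?F (Suc i)) (standard C T \<nu> \<mu>)"
      using k XD by (intro is_quotientI[OF k(1)]) simp_all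
    moreover have "sub_le C (?F i) (?F (Suc i))"
      using k XD sesD[OF k(1)] by (intro sub_leI[of j]) simp_all
    moreover have "\<mu> \<in> \<Lambda>" using \<mu> by (simp add: supp_def factors_def)
    ultimately show ?thesis by blast
  qed
  have "is_union C M {?F i | i. enat i \<le> N} (\<one> M)"
    unfolding is_union_def
  proof (intro conjI ballI allI impI)
    show "subobj C M (\<one> M)" using MD iso_mono_epi(1)[OF id_iso] by (simp add: subobj_def)
    show "sub_le C s (\<one> M)" if sF: "s \<in> {?F i | i. enat i \<le> N}" for s
    proof -
      obtain i where "s = ?F i" using sF by blast
      then show ?thesis using XD[of i] MD(1) by (intro sub_leI[of "?F i"]) simp_all
    qed
    fix v assume v: "subobj C M v \<and> (\<forall>s\<in>{?F i | i. enat i \<le> N}. sub_le C s v)"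
    then have vm: "is_mono C v" "trg C v = M" "v \<in> arr C" by (auto simp: subobj_def mono_arr)
    obtain c where c: "ses C v c" using mono_ses vm by blast
    note cD = sesD[OF c]
    have sub: "factors (trg C c) \<subseteq> supp (X i)" if "enat i \<le> N" for i
    proof -
      have s: "ses C (?F i) (snd (X i))" using inv[of i] by (simp add: Inv_def)
      have "sub_le C (?F i) v" using v that by blast
      then obtain j where j: "j \<in> arr C" "src C j = src C (?F i)" "trg C j = src C v" "v \<cdot> j = ?F i"
        using sub_leE by metis
      have "null C ((c \<cdot> v) \<cdot> j)" using cD j by - (rule null_comp(2); simp)
      then have "null C (c \<cdot> ?F i)" using cD j by simp
      then obtain u where u: "u \<in> arr C" "src C u = trg C (snd (X i))" "trg C u = trg C c" "u \<cdot> snd (X i) = c"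
        using ses_colift[OF s, of c] cD vm XD[of i] by auto
      have "is_epi C u" using epi_second[of "snd (X i)" u] u XD[of i] cD by simp
      then show ?thesis using factors_quotient[of u] u by (simp add: supp_def)
    qed
    have "factors (trg C c) = {}"
    proof (cases N)
      case (enat i)
      then have "supp (X i) = {}" using chain_length_eq unfolding N_def by blast
      then show ?thesis using sub[of i] enat by simp
    next
      case infinity
      then show ?thesis using sub ex by (metis enat_ord_simps(3) subsetD subset_empty subsetI)
    qed
    then have "zero_obj C (trg C c)" using factors_empty cD by simp
    then have "null C c" using epi_null_trg[OF cD(5)] by simp
    then have "null C (c \<cdot> \<one> M)" using cD vm by simp
    then obtain u where "u \<in> arr C" "src C u = M" "trg C u = src C v" "v \<cdot> u = \<one> M"
      using ses_lift[OF c, of "\<one> M"] vm MD by auto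
    then show "sub_le C (\<one> M) v" using vm by (intro sub_leI[of u]) simp_all
  qed
  then have "incr_chain C M N ?F"
    unfolding incr_chain_def using XD X0 st' z by (simp add: subobj_def)
  moreover have "\<forall>i. enat i < N \<longrightarrow> (\<exists>Q\<in>standards. is_quotient C (?F i) (?F (Suc i)) Q)"
    using st' by blast
  ultimately show ?thesis
    unfolding has_incr_filtration_def using MD(1) by (intro conjI exI[of _ N] exI[of _ ?F])
qed

end

theorem theorem4p1:
  fixes C :: "('o, 'a, 'k::field) lincat"
    and \<Lambda> \<Gamma> :: "'l::order set"
    and L :: "'l \<Rightarrow> 'o" and \<iota> \<nu> :: "'l \<Rightarrow> 'a"
    and T :: "'o \<Rightarrow> 'o" and t :: "'a \<Rightarrow> 'a"
    and M :: 'o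
  assumes "standing_highest_weight_category TYPE('i) C \<Lambda> L \<iota> \<nu> T t"
    and "fg_ideal \<Lambda> \<Gamma>"
    and "restricted C \<Lambda> L \<Gamma> M"
  shows "((\<forall>\<mu>\<in>\<Lambda>. Ext1 C (standard C T \<nu> \<mu>) M = {Ext1_zero C (standard C T \<nu> \<mu>) M}) \<longrightarrow>
            has_decr_filtration C (costandard C \<nu> ` \<Lambda>) M)
       \<and> ((\<forall>\<mu>\<in>\<Lambda>. Ext1 C M (costandard C \<nu> \<mu>) = {Ext1_zero C M (costandard C \<nu> \<mu>)}) \<longrightarrow>
            has_incr_filtration C (standard C T \<nu> ` \<Lambda>) M)"
proof -
  interpret standing_highest_weight_category "TYPE('i)" C \<Lambda> L \<iota> \<nu> T t by fact
  show ?thesis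
  proof (intro conjI impI)
    assume "\<forall>\<mu>\<in>\<Lambda>. Ext1 C (standard C T \<nu> \<mu>) M = {Ext1_zero C (standard C T \<nu> \<mu>) M}"
    then show "has_decr_filtration C (costandard C \<nu> ` \<Lambda>) M"
      by (intro decr_costandard_filtration[OF assms(2,3)] ext_vanishes_of_Ext1) simp
  next
    assume "\<forall>\<mu>\<in>\<Lambda>. Ext1 C M (costandard C \<nu> \<mu>) = {Ext1_zero C M (costandard C \<nu> \<mu>)}"
    then show "has_incr_filtration C (standard C T \<nu> ` \<Lambda>) M"
      by (intro incr_standard_filtration[OF assms(2,3)] ext_vanishes_opp_of_Ext1) simp
  qed
qed

end
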